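(* For $\theta \in (0,2\pi)$ let $\gamma(\theta) = \tfrac{1}{\sqrt{2}}(\cos\theta,\sin\theta,1)$, let $\ell_{\theta} = \operatorname{span}(\gamma(\theta))$, and let $\rho_{\theta} \colon \mathbb{R}^{3} \to \ell_{\theta}$ be the orthogonal projection onto the line $\ell_{\theta}$. For every $s > 1/2$ there exists a constant $\tilde{\sigma}(s) > 1/2$ (depending only on $s$) such that the following holds: if $B \subset \mathbb{R}^{3}$ is an analytic set with $\dim B = s$, then $$\dim \rho_{\theta}(B) \geq \tilde{\sigma}(s) \quad \text{for almost every } \theta \in (0,2\pi).$$
   Context: $\dim$ denotes Hausdorff dimension, and "almost every" refers to Lebesgue measure. "Analytic set" means analytic (Suslin) set in the sense of descriptive set theory. *)

theory Defs
  imports "HOL-Analysis.Analysis"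
begin

text \<open>The covering sets must be bounded: \<^const>\<open>diameter\<close> has no meaningful value on unbounded sets.\<close>

definition is_delta_cover :: "real \<Rightarrow> 'a::metric_space set \<Rightarrow> (nat \<Rightarrow> 'a set) \<Rightarrow> bool" where
  "is_delta_cover \<delta> A U \<longleftrightarrow>
     A \<subseteq> (\<Union>i. U i) \<and> (\<forall>i. bounded (U i) \<and> diameter (U i) \<le> \<delta>)"

text \<open>The term \<open>(diam U)\<^sup>s\<close>, with \<open>(diam U)\<^sup>0 = 1\<close> for every nonempty \<open>U\<close>
  (whereas \<open>0 powr 0 = 0\<close> in the library), so that \<open>s = 0\<close> gives counting measure.
  Empty sets contribute \<open>0\<close>; hence covers indexed by \<^typ>\<open>nat\<close> include the finite ones.\<close>

definition diam_pow :: "real \<Rightarrow> 'a::metric_space set \<Rightarrow> ennreal" where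
  "diam_pow s U = (if U = {} then 0 else if s = 0 then 1 else ennreal (diameter U powr s))"

definition hausdorff_premeasure :: "real \<Rightarrow> real \<Rightarrow> 'a::metric_space set \<Rightarrow> ennreal" where
  "hausdorff_premeasure s \<delta> A = (INF U \<in> {U. is_delta_cover \<delta> A U}. \<Sum>i. diam_pow s (U i))"

definition hausdorff_measure :: "real \<Rightarrow> 'a::metric_space set \<Rightarrow> ennreal" where
  "hausdorff_measure s A = (SUP \<delta> \<in> {0<..}. hausdorff_premeasure s \<delta> A)"

definition hausdorff_dim :: "'a::metric_space set \<Rightarrow> ereal" where
  "hausdorff_dim A = (INF s \<in> {s. 0 \<le> s \<and> hausdorff_measure s A = 0}. ereal s)"

text \<open>Analytic sets are the continuous images of Polish spaces; as every nonempty Polish space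
  is a continuous image of the Baire space, it is enough to use the latter.
  Here \<^typ>\<open>nat \<Rightarrow> nat\<close> carries the product of the discrete topologies.\<close>

definition analytic_set :: "'a::topological_space set \<Rightarrow> bool" where
  "analytic_set A \<longleftrightarrow>
     A = {} \<or> (\<exists>f :: (nat \<Rightarrow> nat) \<Rightarrow> 'a. continuous_on UNIV f \<and> range f = A)"

definition orthogonal_projection :: "'a::euclidean_space set \<Rightarrow> 'a \<Rightarrow> 'a" where
  "orthogonal_projection V x = (THE p. p \<in> V \<and> (\<forall>v\<in>V. orthogonal (x - p) v))"

lemma orthogonal_projection_unique:
  assumes "subspace V" "p \<in> V" "\<And>v. v \<in> V \<Longrightarrow> orthogonal (x - p) v"
  shows "orthogonal_projection V x = p"
  unfolding orthogonal_projection_def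
proof (rule the_equality)
  show "p \<in> V \<and> (\<forall>v\<in>V. orthogonal (x - p) v)" using assms by blast
  fix q assume q: "q \<in> V \<and> (\<forall>v\<in>V. orthogonal (x - q) v)"
  then have "p - q \<in> V" using assms by (simp add: subspace_diff)
  then have "(x - q) \<bullet> (p - q) = 0" "(x - p) \<bullet> (p - q) = 0"
    using q assms(3) by (auto simp: orthogonal_def)
  then have "(p - q) \<bullet> (p - q) = 0" by (simp add: inner_diff_left)
  then show "q = p" by simp
qed

definition cone_curve :: "real \<Rightarrow> real^3" ("\<gamma>") where
  "\<gamma> \<theta> = (1 / sqrt 2) *\<^sub>R vector [cos \<theta>, sin \<theta>, 1]"

definition cone_line :: "real \<Rightarrow> (real^3) set" ("\<ell>") where
  "\<ell> \<theta> = span {\<gamma> \<theta>}"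

definition line_proj :: "real \<Rightarrow> real^3 \<Rightarrow> real^3" ("\<rho>") where
  "\<rho> \<theta> = orthogonal_projection (\<ell> \<theta>)"

lemma norm_cone_curve: "norm (\<gamma> \<theta>) = 1"
proof -
  have "\<gamma> \<theta> \<bullet> \<gamma> \<theta> = cos \<theta> * cos \<theta> / 2 + sin \<theta> * sin \<theta> / 2 + 1 / 2"
    by (simp add: cone_curve_def inner_vec_def sum_3)
  also have "\<dots> = 1" using sin_cos_squared_add3[of \<theta>] by argo
  finally show ?thesis by (simp add: norm_eq_1)
qed

lemma line_proj_eq: "\<rho> \<theta> x = (x \<bullet> \<gamma> \<theta>) *\<^sub>R \<gamma> \<theta>"
  unfolding line_proj_def cone_line_def
proof (rule orthogonal_projection_unique)
  have "\<gamma> \<theta> \<bullet> \<gamma> \<theta> = 1" using norm_cone_curve by (simp add: norm_eq_1)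
  then show "orthogonal (x - (x \<bullet> \<gamma> \<theta>) *\<^sub>R \<gamma> \<theta>) v" if "v \<in> span {\<gamma> \<theta>}" for v
    using that by (auto simp: span_singleton orthogonal_def inner_diff_left)
qed (auto simp: span_mul span_base)

end

theory Submission
  imports Defs
begin

text \<open>
  Dyadic content is continuous along increasing sequences of arbitrary sets, so an analytic set of
  positive content has a compact subset of positive content.
  Let \<open>\<mu>\<close> be a Frostman measure of exponent \<open>t \<in> (1/2, 1]\<close> on such a subset of \<open>B\<close>, and call the
  slab \<open>{x. \<bar>(x - y) \<bullet> \<gamma> \<theta>\<bar> \<le> \<delta>}\<close> heavy if its mass exceeds \<open>\<delta>\<^sup>\<sigma>\<close>, where \<open>\<sigma> - 1/2\<close> is small but fixed.
  If \<open>dim (\<rho> \<theta> ` B) < \<sigma>\<close>, then most points \<open>y\<close> have a heavy slab at some arbitrarily small scale, so it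
  is enough that the set of \<open>(\<theta>, y)\<close> with heavy slabs has measure at most a power of \<open>\<delta>\<close>.
  A pair \<open>x, y\<close> with \<open>\<bar>x - y\<bar>\<close> not small and \<open>x - y\<close> not within \<open>\<delta>\<^bsup>1-\<epsilon>\<^esup>\<close> of the light cone shares a slab
  for so few \<open>\<theta>\<close> that such pairs do not matter, and close pairs are negligible since \<open>t > 1/2\<close>.
  So heavy slabs come from pairs with nearly lightlike difference, which are tangent to each other
  only near one value of \<open>\<theta>\<close>. A point \<open>y\<close> with heavy slabs for many \<open>\<theta>\<close> thus is nearly lightlike to many
  triples \<open>x\<^sub>1, x\<^sub>2, x\<^sub>3\<close> with well separated tangency parameters. But the light cones of three such
  points meet transversally, so that \<open>y\<close> is determined by the triple up to an error \<open>\<delta>\<^bsup>1-O(\<epsilon>)\<^esup>\<close>,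
  and counting the quadruples leaves room for very few \<open>y\<close> only.

  All of this is done for finite weighted point sets at a finite scale, with uniform bounds, which
  avoids weak limits of measures: the scales are \<open>\<delta> = \<beta>\<^bsup>100\<^esup>\<close> with \<open>\<beta> = 2\<^bsup>-i\<^esup>\<close>, and \<open>\<beta>\<close> plays the role of \<open>\<delta>\<^sup>\<epsilon>\<close>.
\<close>

section \<open>Sublevel sets of the projected distance\<close>

text \<open>This is \<open>sqrt 2\<close> times the inner product with
  \<open>\<gamma> \<theta>\<close>; without the factor it is an explicit trigonometric polynomial in
  \<theta>.\<close>

definition cform :: "real \<Rightarrow> real^3 \<Rightarrow> real" where
  "cform \<theta> z = z$1 * cos \<theta> + z$2 * sin \<theta> + z$3"

text \<open>The Minkowski form, whose zero set is the light cone. For nonzero \<open>z\<close> the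
  function \<open>\<theta> \<mapsto> cform \<theta> z\<close> has zeros exactly if the form is
  nonnegative, and a double zero exactly on the cone.\<close>

definition lorentz :: "real^3 \<Rightarrow> real" where
  "lorentz z = (z$1)\<^sup>2 + (z$2)\<^sup>2 - (z$3)\<^sup>2"

lemma inner_cone_curve: "z \<bullet> \<gamma> \<theta> = cform \<theta> z / sqrt 2"
  by (simp add: cform_def cone_curve_def inner_vec_def sum_3 add_divide_distrib)

lemma norm_vec3_le: "norm (z::real^3) \<le> sqrt ((z$1)\<^sup>2 + (z$2)\<^sup>2) + \<bar>z$3\<bar>"
proof -
  have "(norm z)\<^sup>2 = ((z$1)\<^sup>2 + (z$2)\<^sup>2) + (z$3)\<^sup>2"
    unfolding power2_norm_eq_inner by (simp add: inner_vec_def sum_3 power2_eq_square)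
  then have "norm z = sqrt (((z$1)\<^sup>2 + (z$2)\<^sup>2) + (z$3)\<^sup>2)"
    by (metis norm_ge_zero real_sqrt_unique)
  also have "\<dots> \<le> sqrt ((z$1)\<^sup>2 + (z$2)\<^sup>2) + sqrt ((z$3)\<^sup>2)"
    by (rule sqrt_add_le_add_sqrt) auto
  finally show ?thesis by simp
qed

section \<open>Growth and monotonicity of the cosine on half periods\<close>

text \<open>The midpoint of an interval inside a half period is at least half its length away from
  both zeros of the sine, and the absolute sine grows with that distance.\<close>

lemma abs_sin_midpoint:
  fixes u v :: real and k :: int
  assumes "of_int k * pi \<le> u" "u \<le> v" "v \<le> (of_int k + 1) * pi"
  shows "sin ((v - u) / 2) \<le> \<bar>sin ((u + v) / 2)\<bar>"
proof -
  define m where "m = (u + v) / 2 - k * pi"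
  define h where "h = (v - u) / 2"
  have hm: "0 \<le> h" "h \<le> m" "m \<le> pi - h"
    using assms by (auto simp: m_def h_def field_simps)
  have "\<bar>sin ((u + v) / 2)\<bar> = \<bar>sin (m + k * pi)\<bar>" by (simp add: m_def)
  also have "\<dots> = \<bar>sin m\<bar>"
    by (simp add: sin_add abs_mult sin_times_pi_eq_0 cos_int_times_real mult.commute)
  finally have 1: "\<bar>sin ((u + v) / 2)\<bar> = \<bar>sin m\<bar>" .
  have "sin h \<le> sin m"
  proof (cases "m \<le> pi / 2")
    case True
    then show ?thesis using hm by (intro sin_monotone_2pi_le) auto
  next
    case False
    have "sin h \<le> sin (pi - m)" using hm False by (intro sin_monotone_2pi_le) auto
    then show ?thesis by simp
  qed
  then show ?thesis using 1 by (simp add: h_def)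
qed

text \<open>The mean value theorem is applied at the half angle, where the cosine is at least
  \<open>sqrt 2 / 2\<close>; the double angle formula then leads back to \<open>h\<close>.\<close>

lemma sin_ge_chord:
  fixes h :: real
  assumes "0 \<le> h" "h \<le> pi / 2"
  shows "h / 2 \<le> sin h"
proof (cases "h = 0")
  case False
  then obtain \<xi> where xi: "0 < \<xi>" "\<xi> < h / 2" "sin (h / 2) - sin 0 = (h / 2 - 0) * cos \<xi>"
    using assms MVT2[of 0 "h / 2" sin cos] by auto
  have cos_ge: "sqrt 2 / 2 \<le> cos x" if "0 \<le> x" "x \<le> h / 2" for x
    using cos_monotone_0_pi_le[of x "pi / 4"] that assms by (simp add: cos_45)
  have "h / 2 = 2 * (h / 2 * (sqrt 2 / 2)) * (sqrt 2 / 2)" by simp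
  also have "\<dots> \<le> 2 * (h / 2 * cos \<xi>) * cos (h / 2)"
    using cos_ge[of \<xi>] cos_ge[of "h / 2"] xi assms
    by (intro mult_mono mult_left_mono mult_nonneg_nonneg) (auto intro: order_trans[of 0 "sqrt 2 / 2"])
  also have "\<dots> = sin h" using xi sin_double[of "h / 2"] by simp
  finally show ?thesis .
qed simp

text \<open>The difference is \<open>2 * sin ((u + v) / 2) * sin ((v - u) / 2)\<close>, and both
  sines are at least \<open>(v - u) / 4\<close> in absolute value. Quadratic growth is all that
  survives near an extremum of the cosine, that is, at a tangency.\<close>

lemma cos_diff_ge:
  fixes u v :: real and k :: int
  assumes "of_int k * pi \<le> u" "u \<le> v" "v \<le> (of_int k + 1) * pi"
  shows "(v - u)\<^sup>2 / 8 \<le> \<bar>cos u - cos v\<bar>"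
proof -
  define h where "h = (v - u) / 2"
  have h: "0 \<le> h" "h \<le> pi / 2" using assms by (auto simp: h_def field_simps)
  have s: "h / 2 \<le> sin h" using sin_ge_chord h by blast
  have "(v - u)\<^sup>2 / 8 = 2 * (h / 2 * (h / 2))" by (simp add: h_def power2_eq_square field_simps)
  also have "\<dots> \<le> 2 * (\<bar>sin ((u + v) / 2)\<bar> * \<bar>sin h\<bar>)"
    using s h abs_sin_midpoint[OF assms] by (intro mult_left_mono mult_mono) (auto simp: h_def)
  also have "\<dots> = \<bar>cos u - cos v\<bar>"
    by (simp add: cos_diff_cos abs_mult h_def)
  finally show ?thesis .
qed

text \<open>The cosine is monotone on a half period, so a sublevel set meets it in an interval.
  Hence the intermediate point of a mean value argument stays in the sublevel set.\<close>

lemma abs_cos_piece_mono: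
  fixes u v \<xi> r h d :: real and k :: int
  assumes "of_int k * pi \<le> u" "u \<le> \<xi>" "\<xi> \<le> v" "v \<le> (of_int k + 1) * pi" 
    and "\<bar>r * cos u + h\<bar> \<le> d" "\<bar>r * cos v + h\<bar> \<le> d" "0 \<le> r"
  shows "\<bar>r * cos \<xi> + h\<bar> \<le> d"
proof -
  define e where "e = cos (of_int k * pi)"
  have e: "e = 1 \<or> e = -1" unfolding e_def by (simp add: cos_int_times_real mult.commute)
  have c: "cos x = e * cos (x - k * pi)" for x
  proof -
    have "cos x = cos ((x - k * pi) + k * pi)" by simp
    also have "\<dots> = cos (x - k * pi) * e"
      unfolding e_def by (subst cos_add) (simp add: sin_times_pi_eq_0 mult.commute)
    finally show ?thesis by simp
  qed
  have "cos (v - k * pi) \<le> cos (\<xi> - k * pi)" "cos (\<xi> - k * pi) \<le> cos (u - k * pi)"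
    using assms by (auto intro!: cos_monotone_0_pi_le simp: algebra_simps)
  then have "(cos v \<le> cos \<xi> \<and> cos \<xi> \<le> cos u) \<or> (cos u \<le> cos \<xi> \<and> cos \<xi> \<le> cos v)"
    using e c[of u] c[of v] c[of \<xi>] by auto
  then have "(r * cos v \<le> r * cos \<xi> \<and> r * cos \<xi> \<le> r * cos u) \<or> (r * cos u \<le> r * cos \<xi> \<and> r * cos \<xi> \<le> r * cos v)"
    using \<open>0 \<le> r\<close> mult_left_mono by meson
  then show ?thesis using assms(5,6) by linarith
qed

lemma cform_polar:
  obtains r \<phi> where "r = sqrt ((z$1)\<^sup>2 + (z$2)\<^sup>2)" "\<And>\<theta>. cform \<theta> z = r * cos (\<theta> - \<phi>) + z$3"
proof -
  obtain r' \<phi> where p: "z$1 = r' * cos \<phi>" "z$2 = r' * sin \<phi>" using polar_Ex by blast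
  define r where "r = \<bar>r'\<bar>"
  obtain \<phi>' where p': "z$1 = r * cos \<phi>'" "z$2 = r * sin \<phi>'"
  proof (cases "r' \<ge> 0")
    case True then show ?thesis using that[of \<phi>] p by (simp add: r_def)
  next
    \<comment> \<open>A negative radius changes its sign when the angle is turned by
      \<open>pi\<close>.\<close>
    case False then show ?thesis using that[of "\<phi> + pi"] p by (simp add: r_def)
  qed
  have "(z$1)\<^sup>2 + (z$2)\<^sup>2 = r\<^sup>2 * ((sin \<phi>')\<^sup>2 + (cos \<phi>')\<^sup>2)"
    unfolding p' by (simp only: power_mult_distrib distrib_left add.commute)
  then have "r = sqrt ((z$1)\<^sup>2 + (z$2)\<^sup>2)" by (simp add: r_def)
  moreover have "cform \<theta> z = r * cos (\<theta> - \<phi>') + z$3" for \<theta>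
    by (simp add: cform_def p' cos_diff algebra_simps)
  ultimately show ?thesis using that by blast
qed

section \<open>Measure of the angles for which two points share a slab\<close>

definition sublevel :: "real set \<Rightarrow> real \<Rightarrow> real^3 \<Rightarrow> real set" where
  "sublevel I \<delta> z = {\<theta> \<in> I. \<bar>cform \<theta> z\<bar> \<le> \<delta>}"

lemma sublevel_measurable [measurable]:
  assumes [measurable]: "I \<in> sets borel"
  shows "sublevel I \<delta> z \<in> sets borel"
  unfolding sublevel_def cform_def by measurable

lemma fmeasurable_interval: "{a..b::real} \<in> fmeasurable lborel"
  using fmeasurable_cbox[of a b] by simp

lemma sublevel_fmeasurable:
  assumes "I \<in> sets borel" "I \<subseteq> {a..b}"
  shows "sublevel I \<delta> z \<in> fmeasurable lborel"
proof (rule fmeasurableI2)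
  show "{a..b} \<in> fmeasurable lborel" by (rule fmeasurable_interval)
qed (use assms sublevel_measurable[OF assms(1), of \<delta> z] in \<open>auto simp: sublevel_def\<close>)

text \<open>The left end \<open>c\<close> is the infimum of \<open>S\<close>. An enclosing interval
  bounds the measure in terms of differences of elements only.\<close>

lemma measure_le_diameter:
  fixes S :: "real set"
  assumes "0 \<le> D" and D: "\<And>u v. u \<in> S \<Longrightarrow> v \<in> S \<Longrightarrow> u \<le> v \<Longrightarrow> v - u \<le> D"
  shows "\<exists>c. S \<subseteq> {c..c + D}"
proof (cases "S = {}")
  case False
  have b: "bdd_below S"
  proof -
    obtain x where "x \<in> S" using False by blast
    then have "\<And>y. y \<in> S \<Longrightarrow> x - D \<le> y" using D \<open>0 \<le> D\<close> by (metis diff_le_eq linear add.commute diff_ge_0_iff_ge le_diff_eq order_trans)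
    then show ?thesis by (meson bdd_belowI)
  qed
  have "S \<subseteq> {Inf S..Inf S + D}"
  proof
    fix v assume v: "v \<in> S"
    have "v - D \<le> Inf S"
    proof (rule cInf_greatest[OF False])
      fix u assume "u \<in> S"
      then show "v - D \<le> u" using D[of u v] v \<open>0 \<le> D\<close> by (cases "u \<le> v") auto
    qed
    moreover have "Inf S \<le> v" using v b by (rule cInf_lower)
    ultimately show "v \<in> {Inf S..Inf S + D}" by auto
  qed
  then show ?thesis by blast
qed auto

text \<open>An interval of length one meets at most two of the intervals on which
  \<open>\<theta> \<mapsto> cos (\<theta> - \<phi>)\<close> is monotone.\<close>

lemma measure_sublevel_le:
  assumes I: "I \<in> sets borel" "I \<subseteq> {a..a+1}" and "0 \<le> D"
    and z: "\<And>\<theta>. cform \<theta> z = r * cos (\<theta> - \<phi>) + z$3"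
    and D: "\<And>u v (k::int). of_int k * pi \<le> u \<Longrightarrow> u \<le> v \<Longrightarrow> v \<le> (of_int k + 1) * pi \<Longrightarrow>
        \<bar>r * cos u + z$3\<bar> \<le> \<delta> \<Longrightarrow> \<bar>r * cos v + z$3\<bar> \<le> \<delta> \<Longrightarrow> v - u \<le> D"
  shows "measure lborel (sublevel I \<delta> z) \<le> 2 * D"
proof -
  define k where "k = \<lfloor>(a - \<phi>) / pi\<rfloor>"
  have k: "k * pi \<le> a - \<phi>" "a - \<phi> < (k + 1) * pi"
  proof -
    have "k \<le> (a - \<phi>) / pi" "(a - \<phi>) / pi < k + 1" unfolding k_def by linarith+
    then show "k * pi \<le> a - \<phi>" "a - \<phi> < (k + 1) * pi" by (auto simp: field_simps)
  qed
  define S where "S j = {\<theta> \<in> sublevel I \<delta> z. j * pi \<le> \<theta> - \<phi> \<and> \<theta> - \<phi> \<le> (j + 1) * pi}" for j :: int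
  have "\<exists>c. S j \<subseteq> {c..c+D}" for j
  proof (rule measure_le_diameter[OF \<open>0 \<le> D\<close>])
    fix u v assume uv: "u \<in> S j" "v \<in> S j" "u \<le> v"
    have "(v - \<phi>) - (u - \<phi>) \<le> D"
      by (rule D[of j]) (use uv in \<open>auto simp: S_def sublevel_def z\<close>)
    then show "v - u \<le> D" by simp
  qed
  then obtain c where c: "\<And>j. S j \<subseteq> {c j..c j+D}" by metis
  have "sublevel I \<delta> z \<subseteq> S k \<union> S (k + 1)"
  proof
    fix \<theta> assume t: "\<theta> \<in> sublevel I \<delta> z"
    then have "\<theta> \<in> {a..a+1}" using I by (auto simp: sublevel_def)
    then have "k * pi \<le> \<theta> - \<phi>" "\<theta> - \<phi> \<le> (k + 2) * pi" 
      using k pi_gt3 by (auto simp: algebra_simps)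
    then show "\<theta> \<in> S k \<union> S (k + 1)" using t by (cases "\<theta> - \<phi> \<le> (k + 1) * pi") (auto simp: S_def algebra_simps)
  qed
  then have sub: "sublevel I \<delta> z \<subseteq> {c k..c k+D} \<union> {c (k+1)..c (k+1)+D}" using c by blast
  have "measure lborel (sublevel I \<delta> z) \<le> measure lborel ({c k..c k+D} \<union> {c (k+1)..c (k+1)+D})"
    by (rule measure_mono_fmeasurable[OF sub])
      (use I(1) sublevel_measurable in \<open>auto intro!: fmeasurable.Un fmeasurable_interval\<close>)
  also have "\<dots> \<le> measure lborel {c k..c k+D} + measure lborel {c (k+1)..c (k+1)+D}"
    by (rule measure_Un_le) auto
  also have "\<dots> = 2 * D" using \<open>0 \<le> D\<close> by simp
  finally show ?thesis .
qed

lemma measure_sublevel_le_1: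
  assumes I: "I \<in> sets borel" "I \<subseteq> {a..a+1}"
  shows "measure lborel (sublevel I \<delta> z) \<le> 1"
proof -
  have "measure lborel (sublevel I \<delta> z) \<le> measure lborel {a..a+1}"
    using I by (intro measure_mono_fmeasurable)
      (use I sublevel_measurable in \<open>auto simp: sublevel_def fmeasurable_def\<close>)
  then show ?thesis by simp
qed

text \<open>Nothing is assumed about \<open>lorentz z\<close>, so the worst case is a tangency,
  where the quadratic growth in \<open>cos_diff_ge\<close> only gives the square root.\<close>

lemma measure_sublevel_near_tangent:
  assumes I: "I \<in> sets borel" "I \<subseteq> {a..a+1}" and "0 < \<eta>" "\<eta> \<le> norm z" "0 \<le> \<delta>"
  shows "measure lborel (sublevel I \<delta> z) \<le> 16 * sqrt (\<delta> / \<eta>)"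
proof (cases "\<eta> \<le> 2 * \<delta>")
  case True
  \<comment> \<open>Here the right-hand side exceeds 1, and the trivial bound by the length of the
    interval suffices.\<close>
  then have "1 \<le> 2 * (\<delta> / \<eta>)" using \<open>0 < \<eta>\<close> by (simp add: field_simps)
  then have "(1/2)\<^sup>2 \<le> \<delta> / \<eta>" unfolding power2_eq_square by linarith
  then have "1/2 \<le> sqrt (\<delta> / \<eta>)" by (rule real_le_rsqrt)
  then show ?thesis using measure_sublevel_le_1[OF I, of \<delta> z] by simp
next
  case False
  obtain r \<phi> where r: "r = sqrt ((z$1)\<^sup>2 + (z$2)\<^sup>2)" "\<And>\<theta>. cform \<theta> z = r * cos (\<theta> - \<phi>) + z$3"
    using cform_polar by metis
  have "0 \<le> r" using r by simp
  show ?thesis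
  proof (cases "sublevel I \<delta> z = {}")
    case True then show ?thesis using assms by simp
  next
    case ne: False
    \<comment> \<open>A single point of the sublevel set forces \<open>z$3\<close> to be at most
      about the planar radius \<open>r\<close>, which is therefore comparable to
      \<open>\<eta>\<close>.\<close>
    then obtain \<theta> where "\<bar>r * cos (\<theta> - \<phi>) + z$3\<bar> \<le> \<delta>" by (auto simp: sublevel_def r)
    moreover have "\<bar>r * cos (\<theta> - \<phi>)\<bar> \<le> r" using \<open>0 \<le> r\<close> by (simp add: abs_mult mult_left_le)
    ultimately have "\<bar>z$3\<bar> \<le> r + \<delta>" by linarith
    then have "\<eta> \<le> 2 * r + \<delta>" using norm_vec3_le[of z] r(1) assms by linarith
    then have r4: "\<eta> \<le> 4 * r" using False by linarith
    then have rpos: "0 < r" using \<open>0 < \<eta>\<close> by linarith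
    have "measure lborel (sublevel I \<delta> z) \<le> 2 * (4 * sqrt (\<delta> / r))"
    proof (rule measure_sublevel_le[OF I _ r(2)])
      fix u v :: real and k :: int
      assume uv: "of_int k * pi \<le> u" "u \<le> v" "v \<le> (of_int k + 1) * pi" "\<bar>r * cos u + z$3\<bar> \<le> \<delta>" "\<bar>r * cos v + z$3\<bar> \<le> \<delta>"
      have "r * ((v - u)\<^sup>2 / 8) \<le> r * \<bar>cos u - cos v\<bar>"
        using cos_diff_ge[OF uv(1-3)] rpos by (intro mult_left_mono) auto
      also have "\<dots> = \<bar>r * cos u - r * cos v\<bar>" using rpos by (simp add: abs_mult right_diff_distrib[symmetric])
      also have "\<dots> \<le> 2 * \<delta>" using uv by linarith
      finally have "(v - u)\<^sup>2 \<le> 16 * (\<delta> / r)" using rpos by (simp add: field_simps)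
      then have "v - u \<le> sqrt (16 * (\<delta> / r))" by (rule real_le_rsqrt)
      also have "\<dots> = 4 * sqrt (\<delta> / r)" by (subst real_sqrt_mult) simp
      finally have "v - u \<le> 4 * sqrt (\<delta> / r)" .
      then show "v - u \<le> 4 * sqrt (\<delta> / r)" by simp
    qed (use assms rpos in simp)
    moreover have "sqrt (\<delta> / r) \<le> sqrt (4 * (\<delta> / \<eta>))"
      using r4 rpos assms by (intro real_sqrt_le_mono) (simp add: field_simps mult_left_mono)
    moreover have "sqrt (4 * (\<delta> / \<eta>)) = 2 * sqrt (\<delta> / \<eta>)" by (subst real_sqrt_mult) simp
    ultimately show ?thesis by linarith
  qed
qed

text \<open>Where \<open>G = cform \<theta> z\<close> is small, the squared derivative in \<theta>
  equals \<open>lorentz z + 2 * (G * z$3) - G\<^sup>2\<close>. Away from the light cone zero is thus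
  crossed with speed at least \<open>sqrt q / 2\<close>.\<close>

lemma measure_sublevel_transversal:
  assumes I: "I \<in> sets borel" "I \<subseteq> {a..a+1}" and "norm z \<le> 1" "0 < \<delta>" "\<delta> \<le> 1" "4 * \<delta> \<le> q" "q < \<bar>lorentz z\<bar>"
  shows "measure lborel (sublevel I \<delta> z) \<le> 8 * (\<delta> / sqrt q)"
proof -
  obtain r \<phi> where r: "r = sqrt ((z$1)\<^sup>2 + (z$2)\<^sup>2)" "\<And>\<theta>. cform \<theta> z = r * cos (\<theta> - \<phi>) + z$3"
    using cform_polar by metis
  have r0: "0 \<le> r" using r by simp
  have r2: "r\<^sup>2 = (z$1)\<^sup>2 + (z$2)\<^sup>2" using r by simp
  have z3: "\<bar>z$3\<bar> \<le> 1" using component_le_norm_cart[of z 3] assms by linarith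
  have key: "q / 4 \<le> (r * sin \<xi>)\<^sup>2" if "\<bar>r * cos \<xi> + z$3\<bar> \<le> \<delta>" for \<xi>
  proof -
    define G where "G = r * cos \<xi> + z$3"
    have "(r * sin \<xi>)\<^sup>2 = r\<^sup>2 * (1 - (cos \<xi>)\<^sup>2)" by (simp add: power_mult_distrib sin_squared_eq)
    also have "\<dots> = r\<^sup>2 - (G - z$3)\<^sup>2" by (simp add: G_def power_mult_distrib right_diff_distrib)
    also have "\<dots> = lorentz z + 2 * (G * z$3) - G\<^sup>2" by (simp add: lorentz_def r2 power2_diff)
    finally have eq: "(r * sin \<xi>)\<^sup>2 = lorentz z + 2 * (G * z$3) - G\<^sup>2" .
    have "\<bar>G * z$3\<bar> \<le> \<delta> * 1" unfolding abs_mult using that z3 by (intro mult_mono) (auto simp: G_def)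
    moreover have "G\<^sup>2 \<le> \<delta>\<^sup>2" using that by (intro power2_le_iff_abs_le[THEN iffD2]) (use assms in \<open>auto simp: G_def\<close>)
    moreover have "\<delta>\<^sup>2 \<le> \<delta>" using assms by (simp add: power2_eq_square mult_left_le)
    moreover have "0 \<le> (r * sin \<xi>)\<^sup>2" "0 \<le> G\<^sup>2" by auto
    \<comment> \<open>The negative alternative would make the square on the left of
      \<open>eq\<close> negative, so it is impossible on the sublevel set.\<close>
    moreover have "lorentz z < -q \<or> q < lorentz z" using assms by linarith
    ultimately show ?thesis unfolding abs_le_iff using eq assms(4-6) by linarith
  qed
  have "measure lborel (sublevel I \<delta> z) \<le> 2 * (4 * (\<delta> / sqrt q))"
  proof (rule measure_sublevel_le[OF I _ r(2)])
    fix u v :: real and k :: int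
    assume uv: "of_int k * pi \<le> u" "u \<le> v" "v \<le> (of_int k + 1) * pi" "\<bar>r * cos u + z$3\<bar> \<le> \<delta>" "\<bar>r * cos v + z$3\<bar> \<le> \<delta>"
    show "v - u \<le> 4 * (\<delta> / sqrt q)"
    proof (cases "u = v")
      case True then show ?thesis using assms by simp
    next
      case False
      then have "u < v" using uv by simp
      then obtain \<xi> where xi: "u < \<xi>" "\<xi> < v" "cos v - cos u = (v - u) * (- sin \<xi>)"
        using MVT2[of u v cos "\<lambda>x. - sin x"] by (metis DERIV_cos)
      have "\<bar>r * cos \<xi> + z$3\<bar> \<le> \<delta>" by (rule abs_cos_piece_mono[of k u _ v]) (use uv xi r0 in auto)
      from key[OF this] have "(sqrt q / 2)\<^sup>2 \<le> (r * sin \<xi>)\<^sup>2" using assms by (simp add: power_divide)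
      then have s: "sqrt q / 2 \<le> \<bar>r * sin \<xi>\<bar>" by (metis abs_ge_zero power2_abs power2_le_imp_le)
      have "(v - u) * (sqrt q / 2) \<le> (v - u) * \<bar>r * sin \<xi>\<bar>" using s uv by (intro mult_left_mono) auto
      also have "\<dots> = \<bar>r * (cos v - cos u)\<bar>" unfolding xi(3) using uv by (simp add: abs_mult)
      also have "\<dots> \<le> 2 * \<delta>" using uv by (simp add: right_diff_distrib abs_le_iff)
      finally show ?thesis using assms by (simp add: field_simps)
    qed
  qed (use assms in simp)
  then show ?thesis by simp
qed

section \<open>Light cones of three points\<close>

definition cone_vec :: "real \<Rightarrow> real^3" where
  "cone_vec \<theta> = vector [cos \<theta>, sin \<theta>, 1]"

lemma inner_cone_vec: "z \<bullet> cone_vec \<theta> = cform \<theta> z"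
  by (simp add: cform_def cone_vec_def inner_vec_def sum_3)

lemma norm_cone_vec_le: "norm (cone_vec \<theta>) \<le> 3/2"
proof -
  have "cone_vec \<theta> \<bullet> cone_vec \<theta> = (sin \<theta>)\<^sup>2 + (cos \<theta>)\<^sup>2 + 1"
    by (simp add: cone_vec_def inner_vec_def sum_3 flip: power2_eq_square)
  then have "(norm (cone_vec \<theta>))\<^sup>2 = 2" unfolding power2_norm_eq_inner by simp
  also have "\<dots> \<le> (3/2)\<^sup>2" by (simp add: power2_eq_square)
  finally show ?thesis by (rule power2_le_imp_le) simp
qed

section \<open>Determinants of cone vectors\<close>

definition triple :: "real^3 \<Rightarrow> real^3 \<Rightarrow> real^3 \<Rightarrow> real" where
  "triple X Y Z = X \<bullet> cross3 Y Z"

lemma triple_linear: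
  "triple (p *\<^sub>R X + p' *\<^sub>R X') Y Z = p * triple X Y Z + p' * triple X' Y Z"
  "triple X (p *\<^sub>R Y + p' *\<^sub>R Y') Z = p * triple X Y Z + p' * triple X Y' Z"
  "triple X Y (p *\<^sub>R Z + p' *\<^sub>R Z') = p * triple X Y Z + p' * triple X Y Z'"
  by (simp_all add: triple_def inner_add_left inner_add_right cross_add_left cross_add_right
      cross_mult_left cross_mult_right)

lemma norm_cross_le: "norm (cross3 x y) \<le> norm x * norm y"
proof -
  have "(norm (cross3 x y))\<^sup>2 \<le> (norm x * norm y)\<^sup>2"
    using norm_cross_dot[of x y] zero_le_power2[of "x \<bullet> y"] by linarith
  then show ?thesis by (rule power2_le_imp_le) simp
qed

lemma triple_cramer:
  "triple X Y Z *\<^sub>R d = (d \<bullet> X) *\<^sub>R cross3 Y Z + (d \<bullet> Y) *\<^sub>R cross3 Z X + (d \<bullet> Z) *\<^sub>R cross3 X Y"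
  unfolding triple_def by (simp add: cross3_simps forall_3)

text \<open>By Cramer's rule the determinant times \<open>d\<close> is a combination of cross
  products, with the inner products of \<open>d\<close> and the rows as coefficients. A vector
  nearly orthogonal to three well spread rows is therefore short.\<close>

lemma triple_norm_le:
  assumes "norm X \<le> B" "norm Y \<le> B" "norm Z \<le> B" "\<bar>d \<bullet> X\<bar> \<le> e" "\<bar>d \<bullet> Y\<bar> \<le> e" "\<bar>d \<bullet> Z\<bar> \<le> e"
  shows "triple X Y Z * norm d \<le> 3 * (e * (B * B))"
proof -
  have B: "0 \<le> B" using assms(1) norm_ge_zero order_trans by blast
  have *: "norm ((d \<bullet> U) *\<^sub>R cross3 V W) \<le> e * (B * B)" if "\<bar>d \<bullet> U\<bar> \<le> e" "norm V \<le> B" "norm W \<le> B" for U V W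
  proof -
    have "norm (cross3 V W) \<le> norm V * norm W" by (rule norm_cross_le)
    also have "\<dots> \<le> B * B" using that B by (intro mult_mono) auto
    finally show ?thesis using that by (simp only: norm_scaleR real_norm_def) (intro mult_mono, auto)
  qed
  have "triple X Y Z * norm d \<le> norm (triple X Y Z *\<^sub>R d)" by (simp add: mult_right_mono)
  also have "\<dots> \<le> norm ((d \<bullet> X) *\<^sub>R cross3 Y Z) + norm ((d \<bullet> Y) *\<^sub>R cross3 Z X) + norm ((d \<bullet> Z) *\<^sub>R cross3 X Y)"
    unfolding triple_cramer by (intro norm_triangle_le add_mono order_refl)
  also have "\<dots> \<le> 3 * (e * (B * B))" using *[of X Y Z] *[of Y Z X] *[of Z X Y] assms by linarith
  finally show ?thesis .
qed

text \<open>With the gaps \<open>a = v - u\<close> and \<open>b = w - v\<close> the determinant is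
  \<open>sin a * (1 - cos b) + sin b * (1 - cos a)\<close>. The factors are of first and second
  order in the gaps.\<close>

lemma triple_cone_vec_ge:
  assumes "0 \<le> \<beta>" "u + \<beta> \<le> v" "v + \<beta> \<le> w" "w \<le> u + 1"
  shows "\<beta>^3 / 8 \<le> triple (cone_vec u) (cone_vec v) (cone_vec w)"
proof -
  define a b where ab: "a = v - u" "b = w - v"
  have "triple (cone_vec u) (cone_vec v) (cone_vec w) = sin a + sin b - sin (a + b)"
    unfolding ab by (simp add: triple_def cone_vec_def cross3_def inner_vec_def sum_3 sin_diff algebra_simps)
  also have "\<dots> = sin a * (1 - cos b) + sin b * (1 - cos a)"
    by (simp add: sin_add algebra_simps)
  finally have eq: "triple (cone_vec u) (cone_vec v) (cone_vec w) = sin a * (1 - cos b) + sin b * (1 - cos a)" .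
  have s: "\<beta> / 2 \<le> sin x" "\<beta>\<^sup>2 / 8 \<le> 1 - cos x" if "\<beta> \<le> x" "x \<le> 1" for x
  proof -
    have "x / 2 \<le> sin x" "x / 2 / 2 \<le> sin (x / 2)" using that assms pi_gt3 by (intro sin_ge_chord; simp)+
    then show "\<beta> / 2 \<le> sin x" using that by simp
    have "\<beta>\<^sup>2 / 8 = 2 * (\<beta> / 4)\<^sup>2" by (simp add: power2_eq_square)
    also have "\<dots> \<le> 2 * (sin (x / 2))\<^sup>2"
      using that assms \<open>x / 2 / 2 \<le> sin (x / 2)\<close> by (intro mult_left_mono power_mono) auto
    also have "\<dots> = 1 - cos x" using cos_double_sin[of "x / 2"] by simp
    finally show "\<beta>\<^sup>2 / 8 \<le> 1 - cos x" .
  qed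
  have "\<beta>^3 / 8 = \<beta> / 2 * (\<beta>\<^sup>2 / 8) + \<beta> / 2 * (\<beta>\<^sup>2 / 8)" by (simp add: power2_eq_square power3_eq_cube)
  also have "\<dots> \<le> sin a * (1 - cos b) + sin b * (1 - cos a)"
    using assms by (intro add_mono mult_mono s) (auto simp: ab intro!: sin_ge_zero order_trans[OF _ pi_ge_two])
  finally show ?thesis using eq by simp
qed

lemma mult_combination_ge:
  fixes p p' :: real
  assumes "c \<le> p" "c \<le> p'" "0 \<le> c" "0 \<le> D" "D \<le> t" "D \<le> t'"
  shows "2 * c * D \<le> p * t + p' * t'"
proof -
  have "c * D \<le> p * t" "c * D \<le> p' * t'" using assms by (intro mult_mono; linarith)+
  then show ?thesis by linarith
qed

text \<open>Multilinearity expands the determinant into eight determinants of cone vectors. The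
  order of the arcs and the signs of the coefficients exclude cancellation, and each term is at
  least \<open>c^3 * \<beta>^3 / 8\<close>.\<close>

lemma triple_arcs_ge:
  assumes "0 \<le> \<beta>" "v1 + \<beta> \<le> u2" "v2 + \<beta> \<le> u3" "v3 \<le> u1 + 1" "0 \<le> c"
    and t: "\<theta>1 \<in> {u1..v1}" "\<theta>1' \<in> {u1..v1}" "\<theta>2 \<in> {u2..v2}" "\<theta>2' \<in> {u2..v2}" "\<theta>3 \<in> {u3..v3}" "\<theta>3' \<in> {u3..v3}"
    and p: "c \<le> p1" "c \<le> p1'" "c \<le> p2" "c \<le> p2'" "c \<le> p3" "c \<le> p3'"
  shows "c^3 * \<beta>^3 \<le> triple (p1 *\<^sub>R cone_vec \<theta>1 + p1' *\<^sub>R cone_vec \<theta>1')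
      (p2 *\<^sub>R cone_vec \<theta>2 + p2' *\<^sub>R cone_vec \<theta>2') (p3 *\<^sub>R cone_vec \<theta>3 + p3' *\<^sub>R cone_vec \<theta>3')"
proof -
  let ?U = "\<lambda>p \<theta> p' \<theta>'. p *\<^sub>R cone_vec \<theta> + p' *\<^sub>R cone_vec \<theta>'"
  define D where "D = \<beta>^3 / 8"
  have D0: "0 \<le> D" using assms by (simp add: D_def)
  have 0: "D \<le> triple (cone_vec x) (cone_vec y) (cone_vec z)"
    if "x \<in> {u1..v1}" "y \<in> {u2..v2}" "z \<in> {u3..v3}" for x y z
    unfolding D_def by (rule triple_cone_vec_ge) (use that assms in auto)
  have 1: "2 * c * D \<le> triple (?U p1 \<theta>1 p1' \<theta>1') (cone_vec y) (cone_vec z)"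
    if "y \<in> {u2..v2}" "z \<in> {u3..v3}" for y z
    unfolding triple_linear using that 0 t p D0 assms(5) by (intro mult_combination_ge) auto
  have 2: "2 * c * (2 * c * D) \<le> triple (?U p1 \<theta>1 p1' \<theta>1') (?U p2 \<theta>2 p2' \<theta>2') (cone_vec z)"
    if "z \<in> {u3..v3}" for z
    unfolding triple_linear(2) using that 1 t p D0 assms(5) by (intro mult_combination_ge) auto
  have "2 * c * (2 * c * (2 * c * D)) \<le> triple (?U p1 \<theta>1 p1' \<theta>1') (?U p2 \<theta>2 p2' \<theta>2') (?U p3 \<theta>3 p3' \<theta>3')"
    unfolding triple_linear(3) using 2 t p D0 assms(5) by (intro mult_combination_ge) auto
  moreover have "2 * c * (2 * c * (2 * c * D)) = c^3 * \<beta>^3" by (simp add: D_def power3_eq_cube)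
  ultimately show ?thesis by simp
qed

section \<open>Nearly lightlike differences as linear conditions\<close>

text \<open>A nearly lightlike \<open>z\<close> that is nearly orthogonal to
  \<open>cone_vec \<theta>\<close> is close to \<open>p\<close> times
  \<open>(cos \<theta>, sin \<theta>, -1)\<close>. So the Minkowski product with \<open>z\<close>
  acts nearly as \<open>p\<close> times the Euclidean product with
  \<open>cone_vec \<theta>\<close>.\<close>

lemma near_tangent_decomposition:
  assumes "norm z \<le> 1" "\<eta> \<le> norm z" "\<bar>lorentz z\<bar> \<le> k\<^sup>2" "\<bar>cform \<theta> z\<bar> \<le> k\<^sup>2" "0 < k" "6 * k \<le> \<eta>" "k \<le> 1"
  obtains p where "\<eta> / 4 \<le> \<bar>p\<bar>" "\<bar>p\<bar> \<le> 1" "0 < z$3 \<longleftrightarrow> p < 0"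
    "\<And>d. \<bar>(d$1 * z$1 + d$2 * z$2 - d$3 * z$3) - p * cform \<theta> d\<bar> \<le> 3 * k * norm d"
proof -
  define G where "G = cform \<theta> z"
  \<comment> \<open>The planar part of \<open>z\<close> has the component \<open>p\<close> along the
    direction of angle \<theta> and the component \<open>b\<close> orthogonal to it. As
    \<open>z$3\<close> is nearly \<open>-p\<close>, \<open>b\<^sup>2\<close> is nearly
    \<open>lorentz z\<close>, hence small.\<close>
  define p where "p = z$1 * cos \<theta> + z$2 * sin \<theta>"
  define b where "b = - z$1 * sin \<theta> + z$2 * cos \<theta>"
  have z3: "z$3 = G - p" by (simp add: G_def p_def cform_def)
  have pb: "p\<^sup>2 + b\<^sup>2 = (z$1)\<^sup>2 + (z$2)\<^sup>2"
  proof -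
    have "p\<^sup>2 + b\<^sup>2 = ((z$1)\<^sup>2 + (z$2)\<^sup>2) * ((sin \<theta>)\<^sup>2 + (cos \<theta>)\<^sup>2)"
      unfolding p_def b_def by algebra
    then show ?thesis by simp
  qed
  have "k\<^sup>2 \<le> k" using assms by (simp add: power2_eq_square mult_left_le)
  have G: "\<bar>G\<bar> \<le> k\<^sup>2" "\<bar>G\<bar> \<le> k" using assms \<open>k\<^sup>2 \<le> k\<close> by (auto simp: G_def)
  have "\<bar>z$3\<bar> \<le> 1" using component_le_norm_cart[of z 3] assms by linarith
  then have "\<bar>G * z$3\<bar> \<le> k\<^sup>2 * 1" unfolding abs_mult using G by (intro mult_mono) auto
  moreover have "b\<^sup>2 = lorentz z + 2 * (G * z$3) - G\<^sup>2"
    using pb by (simp add: lorentz_def z3 power2_eq_square algebra_simps)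
  ultimately have "b\<^sup>2 \<le> 4 * k\<^sup>2" using assms zero_le_power2[of G] zero_le_power2[of k] by linarith
  then have "b\<^sup>2 \<le> (2 * k)\<^sup>2" by (simp add: power2_eq_square)
  then have b: "\<bar>b\<bar> \<le> 2 * k" using assms by (intro power2_le_imp_le[of "\<bar>b\<bar>"]) auto
  have "norm z \<le> sqrt (p\<^sup>2 + b\<^sup>2) + \<bar>z$3\<bar>" using norm_vec3_le[of z] pb by simp
  also have "sqrt (p\<^sup>2 + b\<^sup>2) \<le> \<bar>p\<bar> + \<bar>b\<bar>" by (metis sqrt_sum_squares_le_sum_abs)
  finally have "\<eta> \<le> 2 * \<bar>p\<bar> + 3 * k" using b G z3 assms by linarith
  then have p1: "\<eta> / 4 \<le> \<bar>p\<bar>" using assms by linarith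
  have "\<bar>p\<bar>\<^sup>2 \<le> (norm z)\<^sup>2" using pb unfolding power2_norm_eq_inner
    by (simp add: inner_vec_def sum_3 power2_eq_square) (metis add_increasing2 zero_le_square add_increasing le_add_same_cancel1)
  then have "\<bar>p\<bar> \<le> norm z" by (rule power2_le_imp_le) simp
  then have p2: "\<bar>p\<bar> \<le> 1" using assms by linarith
  have p3: "0 < z$3 \<longleftrightarrow> p < 0" using p1 z3 G assms by linarith
  have p4: "\<bar>(d$1 * z$1 + d$2 * z$2 - d$3 * z$3) - p * cform \<theta> d\<bar> \<le> 3 * k * norm d" for d :: "real^3"
  proof -
    let ?v = "- d$1 * sin \<theta> + d$2 * cos \<theta>"
    have t: "(sin \<theta>)\<^sup>2 + (cos \<theta>)\<^sup>2 = 1" by simp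
    have "(d$1 * z$1 + d$2 * z$2 - d$3 * z$3) - p * cform \<theta> d = b * ?v - G * d$3"
      using t unfolding p_def b_def cform_def G_def by algebra
    moreover have "\<bar>?v\<bar> \<le> norm d"
    proof -
      have "?v\<^sup>2 + (d$1 * cos \<theta> + d$2 * sin \<theta>)\<^sup>2 + (d$3)\<^sup>2 = (norm d)\<^sup>2"
      proof -
        have "d \<bullet> d = (d$1)\<^sup>2 + (d$2)\<^sup>2 + (d$3)\<^sup>2"
          by (simp add: inner_vec_def sum_3 power2_eq_square)
        then show ?thesis using t unfolding power2_norm_eq_inner by algebra
      qed
      then have "\<bar>?v\<bar>\<^sup>2 \<le> (norm d)\<^sup>2"
        using zero_le_power2[of "d$1 * cos \<theta> + d$2 * sin \<theta>"] zero_le_power2[of "d$3"] unfolding power2_abs by linarith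
      then show ?thesis by (rule power2_le_imp_le) simp
    qed
    then have "\<bar>b * ?v\<bar> \<le> (2 * k) * norm d" unfolding abs_mult using b by (intro mult_mono) auto
    moreover have "\<bar>G * d$3\<bar> \<le> k * norm d" unfolding abs_mult
      using G component_le_norm_cart[of d 3] by (intro mult_mono) auto
    ultimately show ?thesis by (simp add: algebra_simps)
  qed
  show ?thesis using that p1 p2 p3 p4 by blast
qed

text \<open>Polarization: the difference of the Minkowski forms of \<open>z'\<close> and
  \<open>z\<close> is the sum of the Minkowski products of \<open>d = z' - z\<close> with
  \<open>z\<close> and with \<open>z'\<close>. This turns two tangencies into one linear condition
  on \<open>d\<close>, whose row has positive coefficients.\<close>

lemma tangent_pair_row:
  assumes z: "norm z \<le> 1" "\<eta> \<le> norm z" "\<bar>lorentz z\<bar> \<le> k\<^sup>2" "\<bar>cform \<theta> z\<bar> \<le> k\<^sup>2"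
    and z': "norm z' \<le> 1" "\<eta> \<le> norm z'" "\<bar>lorentz z'\<bar> \<le> k\<^sup>2" "\<bar>cform \<theta>' z'\<bar> \<le> k\<^sup>2"
    and sgn: "0 < z$3 \<longleftrightarrow> 0 < z'$3" and k: "0 < k" "6 * k \<le> \<eta>" "k \<le> 1"
  obtains p p' where "\<eta> / 4 \<le> p" "p \<le> 1" "\<eta> / 4 \<le> p'" "p' \<le> 1"
    "\<bar>(z' - z) \<bullet> (p *\<^sub>R cone_vec \<theta> + p' *\<^sub>R cone_vec \<theta>')\<bar> \<le> 2 * k\<^sup>2 + 6 * k * norm (z' - z)"
proof -
  define d where "d = z' - z"
  obtain p where p: "\<eta> / 4 \<le> \<bar>p\<bar>" "\<bar>p\<bar> \<le> 1" "0 < z$3 \<longleftrightarrow> p < 0"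
    "\<bar>(d$1 * z$1 + d$2 * z$2 - d$3 * z$3) - p * cform \<theta> d\<bar> \<le> 3 * k * norm d"
    using near_tangent_decomposition[OF z k] by metis
  obtain p' where p': "\<eta> / 4 \<le> \<bar>p'\<bar>" "\<bar>p'\<bar> \<le> 1" "0 < z'$3 \<longleftrightarrow> p' < 0"
    "\<bar>(d$1 * z'$1 + d$2 * z'$2 - d$3 * z'$3) - p' * cform \<theta>' d\<bar> \<le> 3 * k * norm d"
    using near_tangent_decomposition[OF z' k] by metis
  have "(d$1 * z$1 + d$2 * z$2 - d$3 * z$3) + (d$1 * z'$1 + d$2 * z'$2 - d$3 * z'$3) = lorentz z' - lorentz z"
    by (simp add: d_def lorentz_def power2_eq_square algebra_simps)
  then have *: "\<bar>p * cform \<theta> d + p' * cform \<theta>' d\<bar> \<le> 2 * k\<^sup>2 + 6 * k * norm d"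
    using p(4) p'(4) z(3) z'(3) by linarith
  \<comment> \<open>Equal signs of the third coordinates give \<open>p\<close> and \<open>p'\<close>
    equal signs, so both may be replaced by their absolute values.\<close>
  have "\<bar>p * cform \<theta> d + p' * cform \<theta>' d\<bar> = \<bar>\<bar>p\<bar> * cform \<theta> d + \<bar>p'\<bar> * cform \<theta>' d\<bar>"
  proof (cases "p < 0")
    case True
    then have "p' < 0" using p(3) p'(3) sgn by simp
    then have "\<bar>p\<bar> * cform \<theta> d + \<bar>p'\<bar> * cform \<theta>' d = - (p * cform \<theta> d + p' * cform \<theta>' d)"
      using True by simp
    then show ?thesis by simp
  next
    case False
    then have "\<not> p' < 0" using p(3) p'(3) sgn by simp
    then show ?thesis using False by simp
  qed
  then have "\<bar>d \<bullet> (\<bar>p\<bar> *\<^sub>R cone_vec \<theta> + \<bar>p'\<bar> *\<^sub>R cone_vec \<theta>')\<bar> \<le> 2 * k\<^sup>2 + 6 * k * norm d"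
    using * by (simp add: inner_add_right inner_cone_vec)
  then show ?thesis using that[of "\<bar>p\<bar>" "\<bar>p'\<bar>"] p p' by (simp add: d_def)
qed

definition tangent_pair :: "real \<Rightarrow> real \<Rightarrow> real \<Rightarrow> real set \<Rightarrow> real^3 \<Rightarrow> bool" where
  "tangent_pair \<eta> q \<delta> I z \<longleftrightarrow>
     \<eta> \<le> norm z \<and> \<bar>lorentz z\<bar> \<le> q \<and> (\<exists>\<theta>\<in>I. \<bar>cform \<theta> z\<bar> \<le> \<delta>)"

text \<open>A quantitative form of the problem of Apollonius: points of space encode circles (by centre and
  signed radius), and lightlike differences encode tangency.\<close>

lemma tangent_triple_close:
  assumes b: "0 < \<beta>" "\<beta> \<le> 1/2"
    and arcs: "v1 + \<beta> \<le> u2" "v2 + \<beta> \<le> u3" "v3 \<le> u1 + 1"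
    and dist: "norm (x1 - y) \<le> 1" "norm (x1 - y') \<le> 1" "norm (x2 - y) \<le> 1" "norm (x2 - y') \<le> 1"
      "norm (x3 - y) \<le> 1" "norm (x3 - y') \<le> 1"
    and t1: "tangent_pair \<beta> (\<beta>^98) (\<beta>^100) {u1..v1} (x1 - y)" "tangent_pair \<beta> (\<beta>^98) (\<beta>^100) {u1..v1} (x1 - y')"
    and t2: "tangent_pair \<beta> (\<beta>^98) (\<beta>^100) {u2..v2} (x2 - y)" "tangent_pair \<beta> (\<beta>^98) (\<beta>^100) {u2..v2} (x2 - y')"
    and t3: "tangent_pair \<beta> (\<beta>^98) (\<beta>^100) {u3..v3} (x3 - y)" "tangent_pair \<beta> (\<beta>^98) (\<beta>^100) {u3..v3} (x3 - y')"
    and sgn: "0 < (x1 - y)$3 \<longleftrightarrow> 0 < (x1 - y')$3" "0 < (x2 - y)$3 \<longleftrightarrow> 0 < (x2 - y')$3"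
      "0 < (x3 - y)$3 \<longleftrightarrow> 0 < (x3 - y')$3"
  shows "norm (y' - y) \<le> \<beta>^78"
proof -
  \<comment> \<open>With this choice \<open>k\<^sup>2\<close> is the tolerance
    \<open>\<beta>^98\<close> of the Minkowski form, and it dominates the slab width
    \<open>\<beta>^100\<close>.\<close>
  define k where "k = \<beta>^49"
  define d where "d = y - y'"
  have k2: "k\<^sup>2 = \<beta>^98" by (simp add: k_def flip: power_mult)
  have b100: "\<beta>^100 \<le> k\<^sup>2" unfolding k2 by (rule power_decreasing) (use b in auto)
  have kpos: "0 < k" using b by (simp add: k_def)
  have bk: "\<beta>^n \<le> (1/2)^n" for n using b by (intro power_mono) auto
  have "k = \<beta>^48 * \<beta>" by (simp add: k_def flip: power_Suc2)
  also have "\<dots> \<le> (1/6) * \<beta>" using bk[of 48] b by (intro mult_right_mono) (auto simp: power_divide)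
  finally have k6: "6 * k \<le> \<beta>" by simp
  have k1: "k \<le> 1" using k6 b by linarith
  have ex: "\<exists>\<theta>\<in>I. \<exists>\<theta>'\<in>I. \<exists>p p'. \<beta> / 4 \<le> p \<and> p \<le> 1 \<and> \<beta> / 4 \<le> p' \<and> p' \<le> 1 \<and>
      \<bar>d \<bullet> (p *\<^sub>R cone_vec \<theta> + p' *\<^sub>R cone_vec \<theta>')\<bar> \<le> 2 * k\<^sup>2 + 6 * k * norm d"
    if *: "norm (x - y) \<le> 1" "norm (x - y') \<le> 1" "tangent_pair \<beta> (\<beta>^98) (\<beta>^100) I (x - y)"
      "tangent_pair \<beta> (\<beta>^98) (\<beta>^100) I (x - y')" "0 < (x - y)$3 \<longleftrightarrow> 0 < (x - y')$3" for x I
  proof -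
    obtain \<theta> where th: "\<theta> \<in> I" "\<bar>cform \<theta> (x - y)\<bar> \<le> \<beta>^100" using *(3) by (auto simp: tangent_pair_def)
    obtain \<theta>' where th': "\<theta>' \<in> I" "\<bar>cform \<theta>' (x - y')\<bar> \<le> \<beta>^100" using *(4) by (auto simp: tangent_pair_def)
    have th2: "\<bar>cform \<theta> (x - y)\<bar> \<le> k\<^sup>2" "\<bar>cform \<theta>' (x - y')\<bar> \<le> k\<^sup>2" using th th' b100 by linarith+
    have tp: "\<beta> \<le> norm (x - y)" "\<bar>lorentz (x - y)\<bar> \<le> k\<^sup>2" "\<beta> \<le> norm (x - y')" "\<bar>lorentz (x - y')\<bar> \<le> k\<^sup>2"
      using that k2 by (auto simp: tangent_pair_def)
    have dd: "(x - y') - (x - y) = d" by (simp add: d_def)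
    show ?thesis
      using tangent_pair_row[OF that(1) tp(1,2) th2(1) that(2) tp(3,4) th2(2) that(5) kpos k6 k1, unfolded dd] th(1) th'(1)
      by metis
  qed
  obtain \<theta>1 \<theta>1' p1 p1' where 1: "\<theta>1 \<in> {u1..v1}" "\<theta>1' \<in> {u1..v1}" "\<beta> / 4 \<le> p1" "p1 \<le> 1" "\<beta> / 4 \<le> p1'" "p1' \<le> 1"
     "\<bar>d \<bullet> (p1 *\<^sub>R cone_vec \<theta>1 + p1' *\<^sub>R cone_vec \<theta>1')\<bar> \<le> 2 * k\<^sup>2 + 6 * k * norm d"
    using ex[OF dist(1,2) t1 sgn(1)] by metis
  obtain \<theta>2 \<theta>2' p2 p2' where 2: "\<theta>2 \<in> {u2..v2}" "\<theta>2' \<in> {u2..v2}" "\<beta> / 4 \<le> p2" "p2 \<le> 1" "\<beta> / 4 \<le> p2'" "p2' \<le> 1"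
     "\<bar>d \<bullet> (p2 *\<^sub>R cone_vec \<theta>2 + p2' *\<^sub>R cone_vec \<theta>2')\<bar> \<le> 2 * k\<^sup>2 + 6 * k * norm d"
    using ex[OF dist(3,4) t2 sgn(2)] by metis
  obtain \<theta>3 \<theta>3' p3 p3' where 3: "\<theta>3 \<in> {u3..v3}" "\<theta>3' \<in> {u3..v3}" "\<beta> / 4 \<le> p3" "p3 \<le> 1" "\<beta> / 4 \<le> p3'" "p3' \<le> 1"
     "\<bar>d \<bullet> (p3 *\<^sub>R cone_vec \<theta>3 + p3' *\<^sub>R cone_vec \<theta>3')\<bar> \<le> 2 * k\<^sup>2 + 6 * k * norm d"
    using ex[OF dist(5,6) t3 sgn(3)] by metis
  have nb: "norm (p *\<^sub>R cone_vec \<theta> + p' *\<^sub>R cone_vec \<theta>') \<le> 3" if "\<beta> / 4 \<le> p" "p \<le> 1" "\<beta> / 4 \<le> p'" "p' \<le> 1" for p p' \<theta> \<theta>'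
  proof -
    have *: "norm (r *\<^sub>R cone_vec \<phi>) \<le> 1 * (3/2)" if "\<beta> / 4 \<le> r" "r \<le> 1" for r \<phi>
      unfolding norm_scaleR using that b norm_cone_vec_le[of \<phi>] by (intro mult_mono) auto
    show ?thesis using *[OF that(1,2), of \<theta>] *[OF that(3,4), of \<theta>'] by (intro norm_triangle_le) linarith
  qed
  let ?T = "triple (p1 *\<^sub>R cone_vec \<theta>1 + p1' *\<^sub>R cone_vec \<theta>1')
      (p2 *\<^sub>R cone_vec \<theta>2 + p2' *\<^sub>R cone_vec \<theta>2') (p3 *\<^sub>R cone_vec \<theta>3 + p3' *\<^sub>R cone_vec \<theta>3')"
  \<comment> \<open>The three linear conditions have coefficients at least
    \<open>\<beta> / 4\<close> and arcs separated by \<beta>, so their determinant is at least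
    \<open>\<beta>^6 / 64\<close>.\<close>
  have "(\<beta>/4)^3 * \<beta>^3 \<le> ?T"
    by (rule triple_arcs_ge[OF _ arcs]) (use 1 2 3 b in auto)
  then have "(\<beta>/4)^3 * \<beta>^3 * norm d \<le> ?T * norm d" by (rule mult_right_mono) simp
  also have "\<dots> \<le> 3 * ((2 * k\<^sup>2 + 6 * k * norm d) * (3 * 3))"
    by (intro triple_norm_le) (use 1 2 3 nb in auto)
  finally have "\<beta>^6 * norm d \<le> 3456 * k\<^sup>2 + 10368 * k * norm d"
    by (simp add: power_divide algebra_simps flip: power_add)
  \<comment> \<open>The part of the error that is linear in \<open>norm d\<close> is absorbed into
    half of the left-hand side.\<close>
  moreover have "10368 * k * norm d \<le> (1/2 * \<beta>^6) * norm d"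
  proof -
    have "k = \<beta>^43 * \<beta>^6" by (simp add: k_def flip: power_add)
    also have "\<dots> \<le> (1/2)^43 * \<beta>^6" using bk[of 43] b by (intro mult_right_mono) auto
    also have "\<dots> \<le> (1/20736) * \<beta>^6" using b by (intro mult_right_mono) (auto simp: power_divide)
    finally show ?thesis by (intro mult_right_mono) auto
  qed
  ultimately have "\<beta>^6 * norm d \<le> 6912 * k\<^sup>2" by simp
  \<comment> \<open>The exponent splits as 98 = 14 + 6 + 78: the factor \<open>\<beta>^14\<close>
    pays for the constant, since \<open>6912 \<le> 2^14\<close>, and \<open>\<beta>^6\<close>
    cancels the determinant.\<close>
  also have "k\<^sup>2 = \<beta>^14 * (\<beta>^6 * \<beta>^78)" unfolding k2 by (simp flip: power_add)
  also have "6912 * \<dots> \<le> 6912 * ((1/2)^14 * (\<beta>^6 * \<beta>^78))" using bk[of 14] b by (intro mult_left_mono mult_right_mono) auto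
  also have "\<dots> \<le> 1 * (\<beta>^6 * \<beta>^78)" using b unfolding mult.assoc[symmetric] by (intro mult_right_mono) (auto simp: power_divide)
  finally have "\<beta>^6 * norm d \<le> \<beta>^6 * \<beta>^78" by simp
  then have "norm d \<le> \<beta>^78" by (rule mult_left_le_imp_le) (use b in simp)
  then show ?thesis by (simp add: d_def norm_minus_commute)
qed

section \<open>Heavy slabs of discrete Frostman measures\<close>

definition slab_mass :: "(real^3 \<Rightarrow> real) \<Rightarrow> (real^3) set \<Rightarrow> real \<Rightarrow> real^3 \<Rightarrow> real \<Rightarrow> real" where
  "slab_mass w X \<delta> y \<theta> = (\<Sum>x\<in>{x\<in>X. \<bar>cform \<theta> (x - y)\<bar> \<le> \<delta>}. w x)"

section \<open>Measurability and Markov inequalities for slab masses\<close>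

lemma slab_mass_eq_indicator:
  assumes "finite X" "\<theta> \<in> I"
  shows "slab_mass w X \<delta> y \<theta> = (\<Sum>x\<in>X. w x * indicator (sublevel I \<delta> (x - y)) \<theta>)"
  unfolding slab_mass_def using assms
  by (auto simp: sublevel_def indicator_def sum.If_cases if_distrib[of "\<lambda>u. _ * u"] Int_def cong: if_cong)

lemma slab_mass_measurable [measurable]:
  assumes "finite X"
  shows "slab_mass w X \<delta> y \<in> borel_measurable borel"
proof -
  have "slab_mass w X \<delta> y = (\<lambda>\<theta>. \<Sum>x\<in>X. w x * indicator (sublevel UNIV \<delta> (x - y)) \<theta>)"
    using slab_mass_eq_indicator[OF assms, of _ UNIV] by auto
  then show ?thesis by simp
qed

lemma superlevel_measurable [measurable]:
  assumes [simp]: "finite X" and [measurable]: "I \<in> sets borel"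
  shows "{\<theta>\<in>I. c \<le> slab_mass w X \<delta> y \<theta>} \<in> sets borel"
proof -
  have "{\<theta>\<in>I. c \<le> slab_mass w X \<delta> y \<theta>} = I \<inter> slab_mass w X \<delta> y -` {c..}" by auto
  moreover have "slab_mass w X \<delta> y -` {c..} \<in> sets borel"
    using measurable_sets_borel[OF slab_mass_measurable[of X w \<delta> y]] by simp
  ultimately show ?thesis by simp
qed

lemma superlevel_fmeasurable:
  assumes "finite X" "I \<in> sets borel" "I \<subseteq> {a..b}"
  shows "{\<theta>\<in>I. c \<le> slab_mass w X \<delta> y \<theta>} \<in> fmeasurable lborel"
  by (rule fmeasurableI2[OF fmeasurable_interval[of a b]]) (use assms superlevel_measurable in auto)

text \<open>Integrate the pointwise lower bound over \<open>A\<close> and exchange the finite sum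
  with the integral.\<close>

lemma markov_weighted:
  fixes w :: "'a \<Rightarrow> real" and E :: "'a \<Rightarrow> real set"
  assumes X: "finite X" and A: "A \<in> fmeasurable lborel" and E: "\<And>x. x \<in> X \<Longrightarrow> E x \<in> fmeasurable lborel"
    and w: "\<And>x. x \<in> X \<Longrightarrow> 0 \<le> w x" and c: "\<And>\<theta>. \<theta> \<in> A \<Longrightarrow> c \<le> (\<Sum>x\<in>X. w x * indicator (E x) \<theta>)"
  shows "c * measure lborel A \<le> (\<Sum>x\<in>X. w x * measure lborel (E x))"
proof -
  have "c * measure lborel A = (\<integral>\<theta>. c * indicator A \<theta> \<partial>lborel)" by simp
  also have "\<dots> \<le> (\<integral>\<theta>. (\<Sum>x\<in>X. w x * indicator (E x) \<theta>) \<partial>lborel)"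
  proof (rule integral_mono)
    show "integrable lborel (\<lambda>\<theta>. c * indicator A \<theta>)" 
      using A by (intro integrable_mult_right integrable_real_indicator) (auto simp: fmeasurable_def)
    show "integrable lborel (\<lambda>\<theta>. \<Sum>x\<in>X. w x * indicator (E x) \<theta>)"
      using E by (intro Bochner_Integration.integrable_sum integrable_mult_right integrable_real_indicator) (auto simp: fmeasurable_def)
    show "c * indicator A \<theta> \<le> (\<Sum>x\<in>X. w x * indicator (E x) \<theta>)" for \<theta>
      using c[of \<theta>] w by (cases "\<theta> \<in> A") (auto intro!: sum_nonneg)
  qed
  also have "\<dots> = (\<Sum>x\<in>X. w x * measure lborel (E x))"
    using E by (subst Bochner_Integration.integral_sum)
      (auto intro!: integrable_mult_right integrable_real_indicator simp: fmeasurable_def)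
  finally show ?thesis .
qed

lemma markov_slab_mass:
  assumes X: "finite X" "\<And>x. x \<in> X \<Longrightarrow> 0 \<le> w x" and I: "I \<in> sets borel" "I \<subseteq> {a..b}"
  shows "c * measure lborel {\<theta>\<in>I. c \<le> slab_mass w X \<delta> y \<theta>}
    \<le> (\<Sum>x\<in>X. w x * measure lborel (sublevel I \<delta> (x - y)))"
proof (rule markov_weighted[OF X(1) superlevel_fmeasurable[OF X(1) I] sublevel_fmeasurable[OF I] X(2)])
  show "c \<le> (\<Sum>x\<in>X. w x * indicator (sublevel I \<delta> (x - y)) \<theta>)" if "\<theta> \<in> {\<theta>\<in>I. c \<le> slab_mass w X \<delta> y \<theta>}" for \<theta>
    using that slab_mass_eq_indicator[OF X(1), of \<theta> I w \<delta> y] by simp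
qed

text \<open>The minimum, the maximum and their inner neighbours are at most four numbers, so a fifth
  element lies at distance at least two from both ends.\<close>

lemma separated_triple_in:
  fixes H :: "nat set"
  assumes "finite H" "5 \<le> card H"
  obtains x y z where "x \<in> H" "y \<in> H" "z \<in> H" "x + 2 \<le> y" "y + 2 \<le> z"
proof -
  have ne: "H \<noteq> {}" using assms by auto
  have "card {Min H, Min H + 1, Max H, Max H - 1} \<le> 4" by (rule card_insert_le_m1; simp add: card_insert_if)+
  then have "card H > card {Min H, Min H + 1, Max H, Max H - 1}" using assms by linarith
  then obtain y where y: "y \<in> H" "y \<notin> {Min H, Min H + 1, Max H, Max H - 1}"
    using assms by (metis card_mono finite.intros leD subsetI)
  have "Min H \<le> y" "y \<le> Max H" using y assms by auto
  then have "Min H + 2 \<le> y" "y + 2 \<le> Max H" using y(2) by auto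
  then show ?thesis using that[of "Min H" y "Max H"] y(1) assms ne by simp
qed

lemma sum_UN_le:
  fixes f :: "'a \<Rightarrow> real"
  assumes "finite S" "\<And>s. s \<in> S \<Longrightarrow> finite (E s)" "\<And>x. 0 \<le> f x"
  shows "sum f (\<Union>s\<in>S. E s) \<le> (\<Sum>s\<in>S. sum f (E s))"
  using assms(1,2)
proof (induction S)
  case (insert s S)
  have "sum f (\<Union>s\<in>insert s S. E s) \<le> sum f (E s) + sum f (\<Union>s\<in>S. E s)"
    using insert assms(3) by (simp add: sum_Un sum_nonneg)
  then show ?case using insert by fastforce
qed simp

lemma sum_product3:
  fixes f g h :: "'a \<Rightarrow> 'b::comm_semiring_0"
  shows "sum f A * sum g B * sum h C = (\<Sum>x\<in>A. \<Sum>y\<in>B. \<Sum>z\<in>C. f x * g y * h z)"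
  by (simp flip: sum_distrib_left sum_distrib_right)

text \<open>A finite stand-in for a Frostman measure at the single scale \<delta> = 2^(-100 i): the
  growth bound is required only for radii between \<delta> and 1.\<close>

locale frostman_weights =
  fixes P :: "(real^3) set" and w :: "real^3 \<Rightarrow> real" and t :: real and i :: nat
  assumes finP: "finite P" and w0: "\<And>x. 0 \<le> w x"
    and diam: "\<And>x y. x \<in> P \<Longrightarrow> y \<in> P \<Longrightarrow> norm (x - y) \<le> 1"
    and t: "1/2 < t" "t \<le> 1" and i: "0 < i"
    and frost: "\<And>x r. x \<in> P \<Longrightarrow> ((1/2)^i)^100 \<le> r \<Longrightarrow> r \<le> 1 \<Longrightarrow>
        (\<Sum>y\<in>{y\<in>P. norm (y - x) \<le> r}. w y) \<le> r powr t"
begin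

definition \<beta> :: real where "\<beta> = (1/2)^i"
definition \<kappa> :: real where "\<kappa> = (t - 1/2) / 2"
text \<open>The mass threshold \<delta>^\<sigma> of a heavy slab, for \<delta> =
  \<open>\<beta>^100\<close> and \<sigma> = 1/2 + (t - 1/2)/200.\<close>

definition T :: real where "T = \<beta>^50 * \<beta> powr \<kappa>"

lemma beta: "0 < \<beta>" "\<beta> \<le> 1/2"
proof -
  show "0 < \<beta>" by (simp add: \<beta>_def)
  have "(1/2)^i \<le> (1/2::real)^1" by (rule power_decreasing) (use i in auto)
  then show "\<beta> \<le> 1/2" by (simp add: \<beta>_def)
qed

lemma sqrt_beta: "sqrt (\<beta>^(2 * n)) = \<beta>^n"
  using beta by (simp add: power_even_eq)

lemma kappa: "0 < \<kappa>" "\<kappa> \<le> 1/4" using t by (auto simp: \<kappa>_def)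

lemma beta_power_le: "\<beta>^m \<le> 1" "n \<le> m \<Longrightarrow> \<beta>^m \<le> \<beta>^n"
  using beta by (auto intro!: power_le_one power_decreasing)

lemma T_pos: "0 < T" using beta by (simp add: T_def)

lemma T_ge: "\<beta>^51 \<le> T"
proof -
  have "\<beta> powr 1 \<le> \<beta> powr \<kappa>" using beta kappa by (intro powr_mono') auto
  then have "\<beta>^50 * \<beta> \<le> \<beta>^50 * \<beta> powr \<kappa>" using beta by (intro mult_left_mono) auto
  then show ?thesis by (simp add: T_def flip: power_Suc2)
qed

lemma total_mass_le: "sum w P \<le> 1"
proof (cases "P = {}")
  case False
  then obtain x where x: "x \<in> P" by blast
  then have "{y\<in>P. norm (y - x) \<le> 1} = P" using diam by auto
  then show ?thesis using frost[OF x, of 1] beta_power_le[of 100] by (simp add: \<beta>_def)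
qed simp

section \<open>Pairs that are close or far from lightlike\<close>

text \<open>The sum of a geometric series: the fixed point of the recursion from one dyadic shell to
  the next in \<open>near_sum\<close>. It depends on \<open>t\<close> only, not on the
  scale.\<close>

definition near_const :: real where "near_const = 25 / (1 - (1/2) powr (2 * \<kappa>))"

lemma near_const: "25 \<le> near_const" "near_const * (1/2) powr (2 * \<kappa>) + 25 = near_const"
proof -
  define d :: real where "d = (1/2) powr (2 * \<kappa>)"
  have "d < 1 powr (2 * \<kappa>)" unfolding d_def using kappa by (intro powr_less_mono2) auto
  then have d: "0 < d" "d < 1" by (auto simp: d_def)
  then show "25 \<le> near_const" unfolding near_const_def d_def[symmetric] by (simp add: field_simps)
  show "near_const * (1/2) powr (2 * \<kappa>) + 25 = near_const"
    using d unfolding near_const_def d_def[symmetric] by (simp add: field_simps)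
qed

text \<open>Induction from the finest radius outwards. A shell of radius \<open>b\<close> has mass
  at most \<open>b powr t\<close>, and each of its points costs at most about
  \<open>\<beta>^50 / sqrt b\<close>; the product decays as \<open>b\<close> shrinks because
  \<open>t > 1/2\<close>.\<close>

lemma near_sum:
  assumes y: "y \<in> P" and I: "I \<in> sets borel" "I \<subseteq> {a..a+1}" and k: "k \<le> 100 * i"
  shows "(\<Sum>x\<in>{x\<in>P. norm (x - y) < (1/2)^k}. w x * measure lborel (sublevel I (\<beta>^100) (x - y)))
     \<le> near_const * \<beta>^50 * ((1/2)^k) powr (2 * \<kappa>)"
  using k
proof (induction rule: inc_induct)
  let ?m = "\<lambda>x. measure lborel (sublevel I (\<beta>^100) (x - y))"
  have m1: "?m x \<le> 1" for x using measure_sublevel_le_1[OF I] .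
  have mass: "(\<Sum>x\<in>{x\<in>P. norm (x - y) < (1/2)^k}. w x) \<le> ((1/2)^k) powr t" if "k \<le> 100 * i" for k
  proof -
    have "(\<Sum>x\<in>{x\<in>P. norm (x - y) < (1/2)^k}. w x) \<le> (\<Sum>x\<in>{x\<in>P. norm (x - y) \<le> (1/2)^k}. w x)"
      using finP w0 by (intro sum_mono2) auto
    also have "\<dots> \<le> ((1/2)^k) powr t"
    proof (rule frost[OF y])
      have "((1/2::real)^i)^100 = (1/2)^(100 * i)" by (simp add: mult.commute flip: power_mult)
      also have "\<dots> \<le> (1/2)^k" using that by (intro power_decreasing) auto
      finally show "((1/2::real)^i)^100 \<le> (1/2)^k" .
    qed (simp add: power_le_one)
    finally show ?thesis .
  qed
  {
    case base
    have b100: "(1/2)^(100 * i) = \<beta>^100" by (simp add: \<beta>_def mult.commute flip: power_mult)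
    \<comment> \<open>In the ball of radius \<delta> the trivial bound 1 for the sublevel sets is
      enough.\<close>
    have "(\<Sum>x\<in>{x\<in>P. norm (x - y) < (1/2)^(100 * i)}. w x * ?m x) \<le> (\<Sum>x\<in>{x\<in>P. norm (x - y) < (1/2)^(100 * i)}. w x)"
      using m1 w0 by (intro sum_mono) (simp add: mult_left_le)
    also have "\<dots> \<le> (\<beta>^100) powr t" using mass[of "100 * i"] b100 by simp
    also have "\<dots> = (\<beta>^100) powr (1/2) * (\<beta>^100) powr (2 * \<kappa>)"
      by (simp add: \<kappa>_def field_simps flip: powr_add)
    also have "(\<beta>^100) powr (1/2) = \<beta>^50"
      using beta sqrt_beta[of 50] by (simp add: powr_half_sqrt)
    also have "\<beta>^50 * (\<beta>^100) powr (2 * \<kappa>) \<le> near_const * (\<beta>^50 * (\<beta>^100) powr (2 * \<kappa>))"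
    proof -
      have "1 * (\<beta>^50 * (\<beta>^100) powr (2 * \<kappa>)) \<le> near_const * (\<beta>^50 * (\<beta>^100) powr (2 * \<kappa>))"
        using near_const beta by (intro mult_right_mono) auto
      then show ?thesis by simp
    qed
    finally show ?case by (simp add: b100 mult.assoc)
  next
    case (step k)
    define b :: real where "b = (1/2)^k"
    have b: "0 < b" "b \<le> 1" by (auto simp: b_def power_le_one)
    \<comment> \<open>The ball of radius \<open>b\<close> splits into the ball of half the radius,
      covered by the induction hypothesis, and a shell on which
      \<open>measure_sublevel_near_tangent\<close> applies with \<open>b / 2\<close>.\<close>
    have "(\<Sum>x\<in>{x\<in>P. norm (x - y) < b}. w x * ?m x)
        \<le> (\<Sum>x\<in>{x\<in>P. norm (x - y) < b / 2} \<union> {x\<in>P. b / 2 \<le> norm (x - y) \<and> norm (x - y) < b}. w x * ?m x)"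
      using finP w0 by (intro sum_mono2) auto
    also have "\<dots> \<le> (\<Sum>x\<in>{x\<in>P. norm (x - y) < b / 2}. w x * ?m x)
        + (\<Sum>x\<in>{x\<in>P. b / 2 \<le> norm (x - y) \<and> norm (x - y) < b}. w x * ?m x)"
      by (subst sum.union_disjoint) (use finP in auto)
    also have "(\<Sum>x\<in>{x\<in>P. norm (x - y) < b / 2}. w x * ?m x) \<le> near_const * \<beta>^50 * (b / 2) powr (2 * \<kappa>)"
      using step.IH by (simp add: b_def)
    also have "(b / 2) powr (2 * \<kappa>) = (1/2) powr (2 * \<kappa>) * b powr (2 * \<kappa>)"
      using b powr_mult[of "1/2" b "2 * \<kappa>"] by simp
    also have "(\<Sum>x\<in>{x\<in>P. b / 2 \<le> norm (x - y) \<and> norm (x - y) < b}. w x * ?m x)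
        \<le> (\<Sum>x\<in>{x\<in>P. b / 2 \<le> norm (x - y) \<and> norm (x - y) < b}. w x * (25 * (\<beta>^50 * b powr (-1/2))))"
    proof (rule sum_mono)
      fix x assume x: "x \<in> {x\<in>P. b / 2 \<le> norm (x - y) \<and> norm (x - y) < b}"
      have "?m x \<le> 16 * sqrt (\<beta>^100 / (b / 2))"
        using x b beta by (intro measure_sublevel_near_tangent[OF I]) auto
      also have "sqrt (\<beta>^100 / (b / 2)) = sqrt 2 * (\<beta>^50 * b powr (-1/2))"
        using b beta sqrt_beta[of 50] by (simp add: real_sqrt_mult real_sqrt_divide powr_half_sqrt powr_minus_divide)
      also have "16 * (sqrt 2 * (\<beta>^50 * b powr (-1/2))) \<le> 25 * (\<beta>^50 * b powr (-1/2))"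
      proof -
        have "sqrt 2 \<le> 25/16" by (rule real_le_lsqrt) (auto simp: power2_eq_square)
        then have "16 * sqrt 2 \<le> (25::real)" by simp
        then have "16 * sqrt 2 * (\<beta>^50 * b powr (-1/2)) \<le> 25 * (\<beta>^50 * b powr (-1/2))"
          using beta by (intro mult_right_mono) auto
        then show ?thesis by simp
      qed
      finally show "w x * ?m x \<le> w x * (25 * (\<beta>^50 * b powr (-1/2)))" using w0 by (intro mult_left_mono) auto
    qed
    also have "\<dots> = (\<Sum>x\<in>{x\<in>P. b / 2 \<le> norm (x - y) \<and> norm (x - y) < b}. w x) * (25 * (\<beta>^50 * b powr (-1/2)))"
      by (simp add: sum_distrib_right)
    also have "\<dots> \<le> b powr t * (25 * (\<beta>^50 * b powr (-1/2)))"
    proof (rule mult_right_mono)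
      have "(\<Sum>x\<in>{x\<in>P. b / 2 \<le> norm (x - y) \<and> norm (x - y) < b}. w x) \<le> (\<Sum>x\<in>{x\<in>P. norm (x - y) < (1/2)^k}. w x)"
        using finP w0 by (intro sum_mono2) (auto simp: b_def)
      also have "\<dots> \<le> b powr t" unfolding b_def by (rule mass) (use step in simp)
      finally show "(\<Sum>x\<in>{x\<in>P. b / 2 \<le> norm (x - y) \<and> norm (x - y) < b}. w x) \<le> b powr t" .
    qed (use beta in simp)
    also have "\<dots> = 25 * \<beta>^50 * (b powr t * b powr (-1/2))" by simp
    also have "b powr t * b powr (-1/2) = b powr (2 * \<kappa>)" by (simp add: \<kappa>_def diff_divide_distrib flip: powr_add)
    also have "near_const * \<beta>^50 * ((1/2) powr (2 * \<kappa>) * b powr (2 * \<kappa>)) + 25 * \<beta>^50 * b powr (2 * \<kappa>)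
        = (near_const * (1/2) powr (2 * \<kappa>) + 25) * (\<beta>^50 * b powr (2 * \<kappa>))"
      by (simp add: algebra_simps)
    also have "\<dots> = near_const * (\<beta>^50 * b powr (2 * \<kappa>))" unfolding near_const ..
    finally show ?case by (simp add: b_def mult.assoc)
  }
qed

text \<open>The pairs that cannot produce heavy slabs for many angles. The bound
  \<open>\<beta>^98\<close> is \<delta> enlarged by two powers of
  \<open>1 / \<beta>\<close>.\<close>

definition generic :: "real^3 \<Rightarrow> bool" where
  "generic z \<longleftrightarrow> norm z < \<beta> \<or> \<beta>^98 < \<bar>lorentz z\<bar>"

lemma generic_sum:
  assumes y: "y \<in> P" and I: "I \<in> sets borel" "I \<subseteq> {a..a+1}"
  shows "(\<Sum>x\<in>{x\<in>P. generic (x - y)}. w x * measure lborel (sublevel I (\<beta>^100) (x - y)))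
     \<le> (near_const + 8) * (\<beta>^50 * \<beta> powr (2 * \<kappa>))"
proof -
  let ?m = "\<lambda>x. measure lborel (sublevel I (\<beta>^100) (x - y))"
  let ?N = "{x\<in>P. norm (x - y) < \<beta>}" and ?L = "{x\<in>P. \<not> norm (x - y) < \<beta> \<and> \<beta>^98 < \<bar>lorentz (x - y)\<bar>}"
  have "{x\<in>P. generic (x - y)} = ?N \<union> ?L" by (auto simp: generic_def)
  then have "(\<Sum>x\<in>{x\<in>P. generic (x - y)}. w x * ?m x) = (\<Sum>x\<in>?N. w x * ?m x) + (\<Sum>x\<in>?L. w x * ?m x)"
    using finP by (simp add: sum.union_disjoint disjoint_iff)
  also have "(\<Sum>x\<in>?N. w x * ?m x) \<le> near_const * \<beta>^50 * \<beta> powr (2 * \<kappa>)"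
    using near_sum[OF y I, of i] by (simp add: \<beta>_def)
  \<comment> \<open>Away from the light cone transversality yields
    \<open>\<beta>^100 / \<beta>^49\<close>, a whole factor \<beta> below
    \<open>\<beta>^50\<close>.\<close>
  also have "(\<Sum>x\<in>?L. w x * ?m x) \<le> (\<Sum>x\<in>?L. w x * (8 * \<beta>^51))"
  proof (intro sum_mono mult_left_mono w0)
    fix x assume x: "x \<in> ?L"
    have "?m x \<le> 8 * (\<beta>^100 / sqrt (\<beta>^98))"
    proof (rule measure_sublevel_transversal[OF I])
      show "norm (x - y) \<le> 1" using diam x y by auto
      have "4 * \<beta>^100 = (2 * \<beta>)\<^sup>2 * \<beta>^98" by (simp add: power_mult_distrib flip: power_add)
      also have "\<dots> \<le> 1 * \<beta>^98" using beta by (intro mult_right_mono power_le_one) auto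
      finally show "4 * \<beta>^100 \<le> \<beta>^98" by simp
    qed (use x beta beta_power_le in auto)
    also have "\<beta>^100 / sqrt (\<beta>^98) = \<beta>^51"
    proof -
      have "\<beta>^100 = \<beta>^51 * \<beta>^49" by (simp flip: power_add)
      moreover have "sqrt (\<beta>^98) = \<beta>^49" using sqrt_beta[of 49] by simp
      moreover have "\<beta>^49 \<noteq> 0" using beta by simp
      ultimately show ?thesis by (metis nonzero_mult_div_cancel_right)
    qed
    finally show "?m x \<le> 8 * \<beta>^51" .
  qed
  also have "\<dots> = (\<Sum>x\<in>?L. w x) * (8 * \<beta>^51)" by (simp add: sum_distrib_right)
  also have "\<dots> \<le> 1 * (8 * \<beta>^51)"
  proof (rule mult_right_mono)
    have "(\<Sum>x\<in>?L. w x) \<le> sum w P" using finP w0 by (intro sum_mono2) auto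
    then show "(\<Sum>x\<in>?L. w x) \<le> 1" using total_mass_le by linarith
  qed (use beta in simp)
  also have "\<beta>^51 \<le> \<beta>^50 * \<beta> powr (2 * \<kappa>)"
  proof -
    have "\<beta> powr 1 \<le> \<beta> powr (2 * \<kappa>)" using beta kappa by (intro powr_mono') auto
    then have "\<beta>^50 * \<beta> \<le> \<beta>^50 * \<beta> powr (2 * \<kappa>)" using beta by (intro mult_left_mono) auto
    then show ?thesis by (simp flip: power_Suc2)
  qed
  finally show ?thesis by (simp add: algebra_simps)
qed

text \<open>Markov's inequality. The mean from \<open>generic_sum\<close> is a multiple of
  \<open>T * \<beta> powr \<kappa>\<close>, so the threshold \<open>T / 2\<close> leaves the gain
  \<open>\<beta> powr \<kappa>\<close>.\<close>

lemma generic_superlevel: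
  assumes y: "y \<in> P" and I: "I \<in> sets borel" "I \<subseteq> {a..a+1}"
  shows "measure lborel {\<theta>\<in>I. T / 2 \<le> slab_mass w {x\<in>P. generic (x - y)} (\<beta>^100) y \<theta>}
     \<le> 2 * (near_const + 8) * \<beta> powr \<kappa>" (is "?m \<le> _")
proof -
  have "T / 2 * ?m \<le> (near_const + 8) * (\<beta>^50 * \<beta> powr (2 * \<kappa>))"
    by (rule order_trans[OF markov_slab_mass generic_sum[OF y I]]) (use finP w0 I in auto)
  also have "\<beta>^50 * \<beta> powr (2 * \<kappa>) = T * \<beta> powr \<kappa>" by (simp add: T_def mult.assoc flip: powr_add)
  finally have "T * ?m \<le> T * (2 * (near_const + 8) * \<beta> powr \<kappa>)" by (simp add: algebra_simps)
  then show ?thesis using T_pos by simp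
qed

section \<open>Tangencies sorted by arcs of angles\<close>

text \<open>Since \<open>\<beta>\<close> is 2^(-i), the arcs with \<open>k < 2^i\<close> cover an
  interval of length one. Consecutive arcs share an end, so a gap of length \<beta> needs indices
  that differ by at least two.\<close>

definition arc :: "real \<Rightarrow> nat \<Rightarrow> real set" where
  "arc a k = {a + k * \<beta>..a + (real k + 1) * \<beta>}"

text \<open>The angles at which pairs that are not generic alone account for half of a heavy
  slab.\<close>

definition bad :: "real set \<Rightarrow> real^3 \<Rightarrow> real set" where
  "bad I y = {\<theta>\<in>I. T / 2 \<le> slab_mass w {x\<in>P. \<not> generic (x - y)} (\<beta>^100) y \<theta>}"

lemma arc_borel: "arc a k \<in> sets borel" by (simp add: arc_def)

lemma beta_arcs: "2^i * \<beta> = 1" by (simp add: \<beta>_def flip: power_mult_distrib)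

lemma arc_subset:
  assumes "k < 2^i"
  shows "arc a k \<subseteq> {a..a+1}"
proof -
  have "real (k + 1) \<le> 2^i" using assms by (metis Suc_eq_plus1 Suc_leI of_nat_le_iff of_nat_numeral of_nat_power)
  then have "(real k + 1) * \<beta> \<le> 2^i * \<beta>" using beta by (intro mult_right_mono) auto
  then have "(real k + 1) * \<beta> \<le> 1" by (simp only: beta_arcs)
  moreover have "0 \<le> k * \<beta>" using beta by simp
  ultimately show ?thesis by (auto simp: arc_def algebra_simps)
qed

lemma bad_fmeasurable: "I \<in> sets borel \<Longrightarrow> I \<subseteq> {a..b} \<Longrightarrow> bad I y \<in> fmeasurable lborel"
  unfolding bad_def using finP by (intro superlevel_fmeasurable) auto

lemma bad_borel: "I \<in> sets borel \<Longrightarrow> bad I y \<in> sets borel"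
  unfolding bad_def using finP by (intro superlevel_measurable) auto

lemma measure_bad_le:
  assumes "a \<le> b"
  shows "measure lborel (bad {a..b} y) \<le> b - a"
proof -
  have "measure lborel (bad {a..b} y) \<le> measure lborel {a..b}"
    by (rule measure_mono_fmeasurable) (use bad_borel[of "{a..b}"] fmeasurable_interval in \<open>auto simp: bad_def\<close>)
  then show ?thesis using assms by simp
qed

abbreviation tangent_in :: "real \<Rightarrow> nat \<Rightarrow> real^3 \<Rightarrow> bool" where
  "tangent_in a k z \<equiv> tangent_pair \<beta> (\<beta>^98) (\<beta>^100) (arc a k) z"

text \<open>Markov's inequality on one arc. A point whose difference to \<open>y\<close> is not
  generic contributes only if it is tangent within the arc, and then at most
  \<open>16 * \<beta>^49\<close>; so \<open>y\<close> sees tangent mass at least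
  \<open>\<beta>^4 / 32\<close>.\<close>

lemma bad_arc_le:
  assumes "k < 2^i" "y \<in> P" "\<beta>\<^sup>2 \<le> measure lborel (bad (arc a k) y)"
  shows "\<beta>^53 / 2 \<le> 16 * \<beta>^49 * (\<Sum>x\<in>P. w x * of_bool (tangent_in a k (x - y)))"
proof -
  let ?G = "{x\<in>P. \<not> generic (x - y)}"
  let ?m = "\<lambda>x. measure lborel (sublevel (arc a k) (\<beta>^100) (x - y))"
  have "\<beta>^53 / 2 = \<beta>^51 / 2 * \<beta>\<^sup>2" by (simp flip: power_add)
  also have "\<dots> \<le> T / 2 * measure lborel (bad (arc a k) y)"
    using T_ge T_pos assms beta by (intro mult_mono) auto
  also have "\<dots> \<le> (\<Sum>x\<in>?G. w x * ?m x)"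
    unfolding bad_def by (rule markov_slab_mass[OF _ _ arc_borel arc_subset[OF assms(1)]]) (use finP w0 in auto)
  also have "\<dots> \<le> (\<Sum>x\<in>?G. 16 * \<beta>^49 * (w x * of_bool (tangent_in a k (x - y))))"
  proof (rule sum_mono)
    fix x assume x: "x \<in> ?G"
    show "w x * ?m x \<le> 16 * \<beta>^49 * (w x * of_bool (tangent_in a k (x - y)))"
    proof (cases "tangent_in a k (x - y)")
      case False
      then have "sublevel (arc a k) (\<beta>^100) (x - y) = {}"
        using x by (auto simp: generic_def tangent_pair_def sublevel_def)
      then show ?thesis using False by simp
    next
      case True
      have "?m x \<le> 16 * sqrt (\<beta>^100 / \<beta>)"
        using x beta by (intro measure_sublevel_near_tangent[OF arc_borel arc_subset[OF assms(1)]]) (auto simp: generic_def)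
      also have "\<beta>^100 / \<beta> = \<beta>^99" using beta by (simp add: field_simps flip: power_Suc)
      \<comment> \<open>Giving up one power makes the exponent even, so that the root is a natural
        power of \<beta>.\<close>
      also have "sqrt (\<beta>^99) \<le> sqrt (\<beta>^98)" using beta_power_le(2)[of 98 99] by simp
      also have "\<dots> = \<beta>^49" using sqrt_beta[of 49] by simp
      finally have "w x * ?m x \<le> w x * (16 * \<beta>^49)" using w0 by (intro mult_left_mono) auto
      then show ?thesis using True by (simp add: algebra_simps)
    qed
  qed
  also have "\<dots> \<le> (\<Sum>x\<in>P. 16 * \<beta>^49 * (w x * of_bool (tangent_in a k (x - y))))"
    using finP w0 beta by (intro sum_mono2) auto
  also have "\<dots> = 16 * \<beta>^49 * (\<Sum>x\<in>P. w x * of_bool (tangent_in a k (x - y)))"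
    by (simp add: sum_distrib_left)
  finally show ?thesis .
qed

text \<open>The signs of the third coordinates decide between the eight solutions of the
  problem of Apollonius.\<close>

lemma tangent_triple_mass:
  assumes k: "k1 + 2 \<le> k2" "k2 + 2 \<le> k3" "k3 < 2^i" and x: "x1 \<in> P" "x2 \<in> P" "x3 \<in> P"
  shows "(\<Sum>y\<in>P. w y * of_bool (tangent_in a k1 (x1 - y) \<and> tangent_in a k2 (x2 - y) \<and> tangent_in a k3 (x3 - y))) \<le> 8 * \<beta>^39"
proof -
  \<comment> \<open>One class for each of the eight sign patterns. By
    \<open>tangent_triple_close\<close> a class lies in a ball of radius \<open>\<beta>^78\<close>
    around any of its points, so its mass is at most the square root of this radius.\<close>
  define E where "E s = {y\<in>P. tangent_in a k1 (x1 - y) \<and> tangent_in a k2 (x2 - y) \<and> tangent_in a k3 (x3 - y) \<and>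
    (0 < (x1 - y)$3, 0 < (x2 - y)$3, 0 < (x3 - y)$3) = s}" for s
  have E: "(\<Sum>y\<in>E s. w y) \<le> \<beta>^39" for s
  proof (cases "E s = {}")
    case True then show ?thesis using beta by simp
  next
    case False
    then obtain y where y: "y \<in> E s" by blast
    then have yP: "y \<in> P" by (simp add: E_def)
    have "E s \<subseteq> {y'\<in>P. norm (y' - y) \<le> \<beta>^78}"
    proof
      fix y' assume y': "y' \<in> E s"
      have arcs: "a + (real k1 + 1) * \<beta> + \<beta> \<le> a + k2 * \<beta>" "a + (real k2 + 1) * \<beta> + \<beta> \<le> a + k3 * \<beta>"
      proof -
        have "real (k1 + 2) * \<beta> \<le> real k2 * \<beta>" "real (k2 + 2) * \<beta> \<le> real k3 * \<beta>"
          using k beta by (intro mult_right_mono; simp)+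
        then show "a + (real k1 + 1) * \<beta> + \<beta> \<le> a + k2 * \<beta>" "a + (real k2 + 1) * \<beta> + \<beta> \<le> a + k3 * \<beta>" by (auto simp: algebra_simps)
      qed
      have last: "a + (real k3 + 1) * \<beta> \<le> a + k1 * \<beta> + 1"
      proof -
        have "a + (real k3 + 1) * \<beta> \<in> arc a k3" using beta by (auto simp: arc_def)
        then have "a + (real k3 + 1) * \<beta> \<le> a + 1" using arc_subset[OF k(3), of a] by auto
        moreover have "0 \<le> k1 * \<beta>" using beta by simp
        ultimately show ?thesis by linarith
      qed
      have P: "y \<in> P" "y' \<in> P" using y y' by (auto simp: E_def)
      have tp: "tangent_in a k1 (x1 - y)" "tangent_in a k1 (x1 - y')" "tangent_in a k2 (x2 - y)"
        "tangent_in a k2 (x2 - y')" "tangent_in a k3 (x3 - y)" "tangent_in a k3 (x3 - y')"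
        using y y' by (simp_all add: E_def)
      have "(0 < (x1 - y)$3, 0 < (x2 - y)$3, 0 < (x3 - y)$3) = s"
        "(0 < (x1 - y')$3, 0 < (x2 - y')$3, 0 < (x3 - y')$3) = s"
        using y y' unfolding E_def by blast+
      then have sg: "(0 < (x1 - y)$3) = (0 < (x1 - y')$3)" "(0 < (x2 - y)$3) = (0 < (x2 - y')$3)"
        "(0 < (x3 - y)$3) = (0 < (x3 - y')$3)" by (metis Pair_inject)+
      have "norm (y' - y) \<le> \<beta>^78"
        using tangent_triple_close[OF beta arcs last diam[OF x(1) P(1)] diam[OF x(1) P(2)]
            diam[OF x(2) P(1)] diam[OF x(2) P(2)] diam[OF x(3) P(1)] diam[OF x(3) P(2)]
            tp[unfolded arc_def] sg] .
      then show "y' \<in> {y'\<in>P. norm (y' - y) \<le> \<beta>^78}" using y' by (simp add: E_def)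
    qed
    then have "(\<Sum>y\<in>E s. w y) \<le> (\<Sum>y'\<in>{y'\<in>P. norm (y' - y) \<le> \<beta>^78}. w y')"
      using finP w0 by (intro sum_mono2) auto
    also have "\<dots> \<le> (\<beta>^78) powr t"
      by (rule frost[OF yP]) (use beta_power_le in \<open>auto simp: \<beta>_def[symmetric]\<close>)
    also have "\<dots> \<le> (\<beta>^78) powr (1/2)"
      using t beta beta_power_le by (intro powr_mono') auto
    also have "\<dots> = \<beta>^39" using beta sqrt_beta[of 39] by (simp add: powr_half_sqrt)
    finally show ?thesis .
  qed
  have "(\<Sum>y\<in>P. w y * of_bool (tangent_in a k1 (x1 - y) \<and> tangent_in a k2 (x2 - y) \<and> tangent_in a k3 (x3 - y)))
      = (\<Sum>y\<in>(\<Union>s\<in>UNIV. E s). w y)"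
    using finP by (intro sum.mono_neutral_cong_right) (auto simp: E_def)
  also have "\<dots> \<le> (\<Sum>s\<in>UNIV. \<Sum>y\<in>E s. w y)"
    using finP w0 by (intro sum_UN_le) (auto simp: E_def)
  also have "\<dots> \<le> of_nat (card (UNIV :: (bool \<times> bool \<times> bool) set)) * \<beta>^39"
    using E by (intro sum_bounded_above) auto
  also have "card (UNIV :: (bool \<times> bool \<times> bool) set) = 8" by (simp add: card_UNIV_bool flip: UNIV_Times_UNIV)
  finally show ?thesis by simp
qed

definition rich :: "real \<Rightarrow> nat \<Rightarrow> nat \<Rightarrow> nat \<Rightarrow> (real^3) set" where
  "rich a k1 k2 k3 = {y\<in>P. \<beta>\<^sup>2 \<le> measure lborel (bad (arc a k1) y) \<and>
     \<beta>\<^sup>2 \<le> measure lborel (bad (arc a k2) y) \<and> \<beta>\<^sup>2 \<le> measure lborel (bad (arc a k3) y)}"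

text \<open>Double counting of quadruples \<open>y, x1, x2, x3\<close>: each rich \<open>y\<close>
  has tangent triples of mass at least \<open>(\<beta>^4 / 32)^3\<close>, while each triple is
  tangent to a set of \<open>y\<close> of mass at most \<open>8 * \<beta>^39\<close>.\<close>

lemma rich_mass:
  assumes k: "k1 + 2 \<le> k2" "k2 + 2 \<le> k3" "k3 < 2^i"
  shows "sum w (rich a k1 k2 k3) \<le> 2^18 * \<beta>^27"
proof -
  define S where "S k y = (\<Sum>x\<in>P. w x * of_bool (tangent_in a k (x - y)))" for k y
  let ?tt = "\<lambda>x1 x2 x3 y. tangent_in a k1 (x1 - y) \<and> tangent_in a k2 (x2 - y) \<and> tangent_in a k3 (x3 - y)"
  have S0: "0 \<le> S k y" for k y unfolding S_def using w0 by (intro sum_nonneg) auto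
  have "sum w (rich a k1 k2 k3) * (\<beta>^53 / 2)^3 = (\<Sum>y\<in>rich a k1 k2 k3. w y * (\<beta>^53 / 2)^3)"
    by (simp only: sum_distrib_right)
  also have "\<dots> \<le> (\<Sum>y\<in>rich a k1 k2 k3. w y * ((16 * \<beta>^49)^3 * (S k1 y * S k2 y * S k3 y)))"
  proof (intro sum_mono mult_left_mono w0)
    fix y assume y: "y \<in> rich a k1 k2 k3"
    have *: "\<beta>^53 / 2 \<le> 16 * \<beta>^49 * S k1 y" "\<beta>^53 / 2 \<le> 16 * \<beta>^49 * S k2 y" "\<beta>^53 / 2 \<le> 16 * \<beta>^49 * S k3 y"
      unfolding S_def using y k by (intro bad_arc_le; auto simp: rich_def)+
    have "(\<beta>^53 / 2)^3 = (\<beta>^53 / 2) * (\<beta>^53 / 2) * (\<beta>^53 / 2)" by (simp only: power3_eq_cube)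
    also have "\<dots> \<le> (16 * \<beta>^49 * S k1 y) * (16 * \<beta>^49 * S k2 y) * (16 * \<beta>^49 * S k3 y)"
      using beta S0 by (intro mult_mono *) auto
    also have "\<dots> = (16 * \<beta>^49)^3 * (S k1 y * S k2 y * S k3 y)" by (simp only: power3_eq_cube mult_ac)
    finally show "(\<beta>^53 / 2)^3 \<le> (16 * \<beta>^49)^3 * (S k1 y * S k2 y * S k3 y)" .
  qed
  also have "\<dots> \<le> (\<Sum>y\<in>P. w y * ((16 * \<beta>^49)^3 * (S k1 y * S k2 y * S k3 y)))"
    using finP w0 S0 beta by (intro sum_mono2) (auto simp: rich_def)
  also have "\<dots> = (16 * \<beta>^49)^3 * (\<Sum>y\<in>P. w y * (S k1 y * S k2 y * S k3 y))"
    by (simp add: sum_distrib_left mult_ac)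
  also have "(\<Sum>y\<in>P. w y * (S k1 y * S k2 y * S k3 y))
      = (\<Sum>y\<in>P. \<Sum>x1\<in>P. \<Sum>x2\<in>P. \<Sum>x3\<in>P. w x1 * w x2 * w x3 * (w y * of_bool (?tt x1 x2 x3 y)))"
  proof (rule sum.cong[OF refl])
    fix y
    have "S k1 y * S k2 y * S k3 y = (\<Sum>x1\<in>P. \<Sum>x2\<in>P. \<Sum>x3\<in>P. w x1 * of_bool (tangent_in a k1 (x1 - y)) *
        (w x2 * of_bool (tangent_in a k2 (x2 - y))) * (w x3 * of_bool (tangent_in a k3 (x3 - y))))"
      unfolding S_def by (rule sum_product3)
    then show "w y * (S k1 y * S k2 y * S k3 y) =
        (\<Sum>x1\<in>P. \<Sum>x2\<in>P. \<Sum>x3\<in>P. w x1 * w x2 * w x3 * (w y * of_bool (?tt x1 x2 x3 y)))"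
      by (simp only: sum_distrib_left) (simp only: of_bool_conj mult_ac)
  qed
  \<comment> \<open>The sum over \<open>y\<close> is moved inside, so that
    \<open>tangent_triple_mass\<close> can be applied to a fixed triple.\<close>
  also have "\<dots> = (\<Sum>x1\<in>P. \<Sum>x2\<in>P. \<Sum>x3\<in>P. \<Sum>y\<in>P. w x1 * w x2 * w x3 * (w y * of_bool (?tt x1 x2 x3 y)))"
    by (subst sum.swap, rule sum.cong[OF refl], subst sum.swap, rule sum.cong[OF refl], rule sum.swap)
  also have "\<dots> = (\<Sum>x1\<in>P. \<Sum>x2\<in>P. \<Sum>x3\<in>P. w x1 * w x2 * w x3 * (\<Sum>y\<in>P. w y * of_bool (?tt x1 x2 x3 y)))"
    by (simp only: sum_distrib_left)
  also have "\<dots> \<le> (\<Sum>x1\<in>P. \<Sum>x2\<in>P. \<Sum>x3\<in>P. w x1 * w x2 * w x3 * (8 * \<beta>^39))"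
    using k w0 by (intro sum_mono mult_left_mono tangent_triple_mass mult_nonneg_nonneg) auto
  also have "\<dots> = sum w P * sum w P * sum w P * (8 * \<beta>^39)"
    by (subst sum_product3) (simp only: sum_distrib_right)
  also have "\<dots> \<le> 1 * 1 * 1 * (8 * \<beta>^39)"
    using total_mass_le w0 beta by (intro mult_mono) (auto intro!: sum_nonneg mult_nonneg_nonneg)
  finally have "sum w (rich a k1 k2 k3) * (\<beta>^53 / 2)^3 \<le> (16 * \<beta>^49)^3 * (8 * \<beta>^39)"
    using beta by (simp add: mult_left_mono)
  moreover have "(16 * \<beta>^49)^3 * (8 * \<beta>^39) = (2^18 * \<beta>^27) * (\<beta>^53 / 2)^3"
    by (simp add: power_mult_distrib power_divide flip: power_mult power_add)
  ultimately have "sum w (rich a k1 k2 k3) * (\<beta>^53 / 2)^3 \<le> (2^18 * \<beta>^27) * (\<beta>^53 / 2)^3" by simp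
  then show ?thesis by (rule mult_right_le_imp_le) (use beta in simp)
qed

lemma bad_subset_arcs: "bad {a..a+1} y \<subseteq> (\<Union>k<2^i. bad (arc a k) y)"
proof
  fix \<theta> assume t: "\<theta> \<in> bad {a..a+1} y"
  then have th: "a \<le> \<theta>" "\<theta> \<le> a + 1" by (auto simp: bad_def)
  have ba: "\<beta> = 1 / 2^i" using beta_arcs by (simp add: field_simps)
  \<comment> \<open>The minimum matters only at the right end \<open>\<theta> = a + 1\<close>, which
    belongs to the last arc.\<close>
  define k where "k = min (nat \<lfloor>(\<theta> - a) * 2^i\<rfloor>) (2^i - 1)"
  have "k \<le> 2^i - 1" "(0::nat) < 2^i" by (simp_all add: k_def)
  then have "k < 2^i" by linarith
  moreover have "\<theta> \<in> arc a k"
  proof (cases "\<theta> = a + 1")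
    case True
    then have "k = 2^i - 1" by (simp add: k_def nat_power_eq)
    then have "real k + 1 = 2^i" by simp
    then have "(real k + 1) * \<beta> = 1" using beta_arcs by simp
    then show ?thesis using True beta by (simp add: arc_def algebra_simps)
  next
    case False
    define x where "x = (\<theta> - a) * 2^i"
    have x: "0 \<le> x" "x < 2^i" using th False by (auto simp: x_def)
    then have "\<lfloor>x\<rfloor> < 2^i" by (simp add: floor_less_iff)
    then have "nat \<lfloor>x\<rfloor> < 2^i" using x by (simp add: nat_less_iff)
    then have "nat \<lfloor>x\<rfloor> \<le> 2^i - 1" by linarith
    then have "k = nat \<lfloor>x\<rfloor>" unfolding k_def x_def[symmetric] by (rule min_absorb1)
    then have "real k \<le> x" "x \<le> real k + 1" using x by (auto simp: of_nat_nat)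
    moreover have "\<theta> = a + x * \<beta>" by (simp add: x_def ba)
    ultimately show ?thesis using beta by (auto simp: arc_def intro!: mult_right_mono)
  qed
  ultimately show "\<theta> \<in> (\<Union>k<2^i. bad (arc a k) y)" using t by (auto simp: bad_def)
qed

text \<open>At most four arcs carry bad measure \<open>\<beta>\<^sup>2\<close> or more, since five
  would contain a separated triple. These contribute at most \<open>4 * \<beta>\<close>, and the
  other arcs less than \<open>\<beta>\<^sup>2\<close> each, hence at most \<beta>
  altogether.\<close>

lemma bad_measure_le:
  assumes "y \<in> P" and nr: "\<And>k1 k2 k3. k1 + 2 \<le> k2 \<Longrightarrow> k2 + 2 \<le> k3 \<Longrightarrow> k3 < 2^i \<Longrightarrow> y \<notin> rich a k1 k2 k3"
  shows "measure lborel (bad {a..a+1} y) \<le> 5 * \<beta>"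
proof -
  let ?m = "\<lambda>k. measure lborel (bad (arc a k) y)"
  define H where "H = {k. k < 2^i \<and> \<beta>\<^sup>2 \<le> ?m k}"
  have "finite H" by (simp add: H_def)
  have card: "card H \<le> 4"
  proof (rule ccontr)
    assume "\<not> card H \<le> 4"
    then have "5 \<le> card H" by simp
    then obtain k1 k2 k3 where "k1 \<in> H" "k2 \<in> H" "k3 \<in> H" "k1 + 2 \<le> k2" "k2 + 2 \<le> k3"
      using separated_triple_in[OF \<open>finite H\<close>] by metis
    then show False using nr[of k1 k2 k3] assms(1) by (auto simp: H_def rich_def)
  qed
  have arc_m: "?m k \<le> \<beta>" for k
    using measure_bad_le[of "a + k * \<beta>" "a + (real k + 1) * \<beta>" y] beta
    by (simp add: arc_def algebra_simps)
  have fm: "bad (arc a k) y \<in> fmeasurable lborel" if "k < 2^i" for k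
    by (rule bad_fmeasurable[OF arc_borel arc_subset[OF that]])
  have "(\<Union>k<2^i. bad (arc a k) y) \<in> fmeasurable lborel"
    using fm by (intro fmeasurable.finite_UN) auto
  then have "measure lborel (bad {a..a+1} y) \<le> measure lborel (\<Union>k<2^i. bad (arc a k) y)"
    using bad_subset_arcs bad_borel[of "{a..a+1}" y]
    by (intro measure_mono_fmeasurable) (simp_all only: sets_lborel atLeastAtMost_borel)
  also have "\<dots> \<le> (\<Sum>k<2^i. ?m k)"
    using bad_borel[OF arc_borel] by (intro measure_UNION_le) auto
  also have "\<dots> \<le> (\<Sum>k<2^i. \<beta> * of_bool (k \<in> H) + \<beta>\<^sup>2)"
  proof (rule sum_mono)
    fix k :: nat assume "k \<in> {..<2^i}"
    then show "?m k \<le> \<beta> * of_bool (k \<in> H) + \<beta>\<^sup>2"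
      using arc_m[of k] beta by (cases "k \<in> H") (auto simp: H_def intro: add_increasing2)
  qed
  also have "\<dots> = card H * \<beta> + 2^i * \<beta> * \<beta>"
  proof -
    have "{..<2^i} \<inter> {k. k \<in> H} = H" by (auto simp: H_def)
    then show ?thesis by (simp add: sum.distrib flip: sum_distrib_left) (simp add: power2_eq_square mult.commute)
  qed
  also have "\<dots> \<le> 4 * \<beta> + \<beta>"
    using card beta by (simp add: beta_arcs mult_right_mono)
  finally show ?thesis by simp
qed

text \<open>There are at most \<open>(2^i)^3\<close> triples of arcs. This costs three powers of
  \<beta> in the union bound over the rich sets, and \<open>\<beta>^24\<close> remains.\<close>

lemma bad_mass: "(\<Sum>y\<in>P. w y * measure lborel (bad {a..a+1} y)) \<le> 5 * \<beta> + 2^18 * \<beta>^24"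
proof -
  define K where "K = {(k1, k2, k3). k1 + 2 \<le> k2 \<and> k2 + 2 \<le> k3 \<and> k3 < (2::nat)^i}"
  have K: "K \<subseteq> {..<2^i} \<times> {..<2^i} \<times> {..<2^i}" by (auto simp: K_def)
  have finK: "finite K" by (rule finite_subset[OF K]) simp
  have "card K \<le> card ({..<(2::nat)^i} \<times> {..<(2::nat)^i} \<times> {..<(2::nat)^i})" by (rule card_mono[OF _ K]) simp
  also have "\<dots> = (2^i)^3" by (simp add: card_cartesian_product power3_eq_cube)
  finally have cardK: "real (card K) \<le> (2^i)^3" by (metis of_nat_le_iff of_nat_numeral of_nat_power)
  define Y where "Y = (\<Union>(k1,k2,k3)\<in>K. rich a k1 k2 k3)"
  have Y: "Y \<subseteq> P" by (auto simp: Y_def rich_def)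
  let ?m = "\<lambda>y. measure lborel (bad {a..a+1} y)"
  have m1: "?m y \<le> 1" for y using measure_bad_le[of a "a+1" y] by simp
  have "(\<Sum>y\<in>P. w y * ?m y) \<le> (\<Sum>y\<in>P. w y * (5 * \<beta>) + w y * of_bool (y \<in> Y))"
  proof (rule sum_mono)
    fix y assume y: "y \<in> P"
    have "?m y \<le> 5 * \<beta> + of_bool (y \<in> Y)"
    proof (cases "y \<in> Y")
      case True then show ?thesis using m1[of y] beta by simp
    next
      case False
      then show ?thesis using bad_measure_le[OF y, of a] by (auto simp: Y_def K_def)
    qed
    from mult_left_mono[OF this w0[of y]]
    show "w y * ?m y \<le> w y * (5 * \<beta>) + w y * of_bool (y \<in> Y)" by (simp only: distrib_left)
  qed
  also have "\<dots> = sum w P * (5 * \<beta>) + sum w Y"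
  proof -
    have "(\<Sum>y\<in>P. w y * of_bool (y \<in> Y)) = sum w Y"
      using finP Y by (intro sum.mono_neutral_cong_right) auto
    then show ?thesis by (simp only: sum.distrib sum_distrib_right)
  qed
  also have "sum w P * (5 * \<beta>) \<le> 1 * (5 * \<beta>)" using total_mass_le beta by (intro mult_right_mono) auto
  also have "sum w Y \<le> (\<Sum>k\<in>K. sum w (case k of (k1,k2,k3) \<Rightarrow> rich a k1 k2 k3))"
    unfolding Y_def using finP w0 finK by (intro sum_UN_le) (auto simp: rich_def split: prod.splits)
  also have "\<dots> \<le> of_nat (card K) * (2^18 * \<beta>^27)"
  proof (rule sum_bounded_above)
    fix k assume "k \<in> K"
    then obtain k1 k2 k3 where "k = (k1, k2, k3)" "k1 + 2 \<le> k2" "k2 + 2 \<le> k3" "k3 < 2^i"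
      unfolding K_def by blast
    then show "sum w (case k of (k1,k2,k3) \<Rightarrow> rich a k1 k2 k3) \<le> 2^18 * \<beta>^27"
      using rich_mass[of k1 k2 k3 a] by simp
  qed
  also have "\<dots> \<le> (2^i)^3 * (2^18 * \<beta>^27)" using cardK beta by (intro mult_right_mono) auto
  also have "\<dots> = (2^i * \<beta>)^3 * (2^18 * \<beta>^24)" by (simp add: power_mult_distrib flip: power_add)
  also have "\<dots> = 2^18 * \<beta>^24" by (simp add: beta_arcs)
  finally show ?thesis by simp
qed

text \<open>A slab of mass \<open>T\<close> gets at least half of it either from generic pairs or
  from the others. The constant depends on \<open>t\<close> only, so the bounds for different
  \<open>i\<close> form a geometric series.\<close>

theorem heavy_slab_measure:
  "(\<Sum>y\<in>P. w y * measure lborel {\<theta>\<in>{a..a+1}. T \<le> slab_mass w P (\<beta>^100) y \<theta>})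
     \<le> (2 * near_const + 21 + 2^18) * \<beta> powr \<kappa>"
proof -
  let ?g = "\<lambda>y. {\<theta>\<in>{a..a+1}. T / 2 \<le> slab_mass w {x\<in>P. generic (x - y)} (\<beta>^100) y \<theta>}"
  let ?M = "2 * (near_const + 8) * \<beta> powr \<kappa>"
  have "(\<Sum>y\<in>P. w y * measure lborel {\<theta>\<in>{a..a+1}. T \<le> slab_mass w P (\<beta>^100) y \<theta>})
      \<le> (\<Sum>y\<in>P. w y * ?M + w y * measure lborel (bad {a..a+1} y))"
  proof (rule sum_mono)
    fix y assume y: "y \<in> P"
    have split: "slab_mass w P (\<beta>^100) y \<theta> = slab_mass w {x\<in>P. generic (x - y)} (\<beta>^100) y \<theta>
        + slab_mass w {x\<in>P. \<not> generic (x - y)} (\<beta>^100) y \<theta>" for \<theta>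
      unfolding slab_mass_def using finP
      by (subst sum.union_disjoint[symmetric]) (auto intro!: sum.cong)
    have fm: "?g y \<in> fmeasurable lborel" "bad {a..a+1} y \<in> fmeasurable lborel"
      using finP by (intro superlevel_fmeasurable[where a = a and b = "a+1"] bad_fmeasurable[where a = a and b = "a+1"]; simp)+
    have "measure lborel {\<theta>\<in>{a..a+1}. T \<le> slab_mass w P (\<beta>^100) y \<theta>} \<le> measure lborel (?g y \<union> bad {a..a+1} y)"
    proof (rule measure_mono_fmeasurable)
      show "{\<theta>\<in>{a..a+1}. T \<le> slab_mass w P (\<beta>^100) y \<theta>} \<subseteq> ?g y \<union> bad {a..a+1} y"
        unfolding bad_def using split by (auto simp: not_le)
      show "{\<theta>\<in>{a..a+1}. T \<le> slab_mass w P (\<beta>^100) y \<theta>} \<in> sets lborel"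
        using superlevel_measurable[OF finP, of "{a..a+1}"] by simp
    qed (use fm in auto)
    also have "\<dots> \<le> measure lborel (?g y) + measure lborel (bad {a..a+1} y)"
      using fm by (intro measure_Un_le) (auto simp: fmeasurable_def)
    also have "measure lborel (?g y) \<le> ?M" by (rule generic_superlevel[OF y]) auto
    finally have le: "measure lborel {\<theta>\<in>{a..a+1}. T \<le> slab_mass w P (\<beta>^100) y \<theta>} \<le> ?M + measure lborel (bad {a..a+1} y)"
      by simp
    from mult_left_mono[OF this w0[of y]]
    show "w y * measure lborel {\<theta>\<in>{a..a+1}. T \<le> slab_mass w P (\<beta>^100) y \<theta>}
        \<le> w y * ?M + w y * measure lborel (bad {a..a+1} y)" by (simp only: distrib_left)
  qed
  also have "\<dots> = sum w P * ?M + (\<Sum>y\<in>P. w y * measure lborel (bad {a..a+1} y))"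
    by (simp only: sum.distrib sum_distrib_right)
  also have "\<dots> \<le> 1 * ?M + (5 * \<beta> + 2^18 * \<beta>^24)"
    using total_mass_le near_const bad_mass by (intro add_mono mult_right_mono) auto
  also have "\<dots> \<le> ?M + (5 * \<beta> powr \<kappa> + 2^18 * \<beta> powr \<kappa>)"
  proof -
    have "\<beta> powr 1 \<le> \<beta> powr \<kappa>" using beta kappa by (intro powr_mono') auto
    then have b: "\<beta> \<le> \<beta> powr \<kappa>" using beta by simp
    moreover have "\<beta>^24 \<le> \<beta> powr \<kappa>" using b beta_power_le(2)[of 1 24] by simp
    ultimately show ?thesis by simp
  qed
  also have "\<dots> = (2 * near_const + 21 + 2^18) * \<beta> powr \<kappa>" by (simp add: algebra_simps)
  finally show ?thesis .
qed

end

section \<open>Dyadic Hausdorff content\<close>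

text \<open>Half-open cubes of side 2^(-m), given by their level \<open>m\<close> and the integer
  coordinates of a corner: each level partitions the space. Levels are natural numbers, so no side
  exceeds 1.\<close>

definition dyadic_cube :: "nat \<times> (int^'n) \<Rightarrow> (real^'n) set" where
  "dyadic_cube q = {x. \<forall>j. \<lfloor>2 ^ fst q * x$j\<rfloor> = snd q $ j}"

definition dyadic_index :: "nat \<Rightarrow> real^'n \<Rightarrow> nat \<times> (int^'n)" where
  "dyadic_index m x = (m, \<chi> j. \<lfloor>2 ^ m * x$j\<rfloor>)"

lemma fst_dyadic_index [simp]: "fst (dyadic_index m x) = m"
  by (simp add: dyadic_index_def)

lemma mem_dyadic_cube_iff: "x \<in> dyadic_cube q \<longleftrightarrow> dyadic_index (fst q) x = q"
  by (cases q) (auto simp: dyadic_cube_def dyadic_index_def vec_eq_iff)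

lemma mem_dyadic_cube_index [simp]: "x \<in> dyadic_cube (dyadic_index m x)"
  by (simp add: mem_dyadic_cube_iff)

text \<open>The coarse index is the fine one divided, as an integer, by a power of two.\<close>

lemma dyadic_cube_coarser:
  assumes "m \<le> n" "dyadic_index n x = dyadic_index n y"
  shows "dyadic_index m x = dyadic_index m y"
proof -
  have *: "\<lfloor>2^m * z\<rfloor> = \<lfloor>2^n * z\<rfloor> div 2^(n - m)" for z :: real
  proof -
    have "2^m * z = 2^n * z / 2^(n - m)" using assms(1) by (simp add: field_simps flip: power_add)
    then have "\<lfloor>2^m * z\<rfloor> = \<lfloor>2^n * z / real_of_int (2^(n - m))\<rfloor>" by simp
    also have "\<dots> = \<lfloor>2^n * z\<rfloor> div 2^(n - m)" by (rule floor_divide_real_eq_div) simp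
    finally show ?thesis .
  qed
  have "\<lfloor>2^n * x$j\<rfloor> = \<lfloor>2^n * y$j\<rfloor>" for j using assms(2) by (simp add: dyadic_index_def vec_eq_iff)
  then show ?thesis by (simp add: dyadic_index_def vec_eq_iff *)
qed

lemma dyadic_cube_dist:
  fixes x y :: "real^'n"
  assumes "x \<in> dyadic_cube q" "y \<in> dyadic_cube q"
  shows "dist x y \<le> real CARD('n) / 2 ^ fst q"
proof -
  have "\<bar>(x - y)$j\<bar> \<le> 1 / 2^fst q" for j
  proof -
    have "\<lfloor>2^fst q * x$j\<rfloor> = \<lfloor>2^fst q * y$j\<rfloor>" using assms by (simp add: dyadic_cube_def)
    then have "\<bar>2^fst q * x$j - 2^fst q * y$j\<bar> \<le> 1" by linarith
    then have "2^fst q * \<bar>x$j - y$j\<bar> \<le> 1" by (simp add: abs_mult flip: right_diff_distrib)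
    then show ?thesis by (simp add: field_simps)
  qed
  then have "(\<Sum>j\<in>UNIV. \<bar>(x - y)$j\<bar>) \<le> of_nat CARD('n) * (1 / 2^fst q)"
    by (intro sum_bounded_above) auto
  then show ?thesis using norm_le_l1_cart[of "x - y"] by (simp add: dist_norm)
qed

definition adjacent_offsets :: "(int^'n) set" where
  "adjacent_offsets = {e. \<forall>j. e$j \<in> {-1, 0, 1}}"

lemma finite_adjacent_offsets: "finite (adjacent_offsets :: (int^'n) set)"
proof -
  have "adjacent_offsets \<subseteq> (\<lambda>f. \<chi> j. f j) ` (UNIV \<rightarrow>\<^sub>E {-1, 0, 1 :: int} :: ('n \<Rightarrow> int) set)"
  proof
    fix e :: "int^'n" assume "e \<in> adjacent_offsets"
    then have "(\<lambda>j. e$j) \<in> UNIV \<rightarrow>\<^sub>E {-1, 0, 1}" by (auto simp: adjacent_offsets_def)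
    then show "e \<in> (\<lambda>f. \<chi> j. f j) ` (UNIV \<rightarrow>\<^sub>E {-1, 0, 1 :: int})" by (auto intro!: image_eqI[of _ _ "\<lambda>j. e$j"])
  qed
  moreover have "finite (UNIV \<rightarrow>\<^sub>E {-1, 0, 1 :: int} :: ('n \<Rightarrow> int) set)" by (intro finite_PiE) auto
  ultimately show ?thesis using finite_surj by blast
qed

text \<open>The cubes of equal side that touch the given one, itself included. Together they contain
  an open neighbourhood of it, at the price of a constant factor in weight.\<close>

definition neighbours :: "nat \<times> (int^'n) \<Rightarrow> (nat \<times> (int^'n)) set" where
  "neighbours q = (\<lambda>e. (fst q, snd q + e)) ` adjacent_offsets"

lemma finite_neighbours: "finite (neighbours q)"
  by (simp add: neighbours_def finite_adjacent_offsets)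

lemma card_neighbours_le: "card (neighbours (q :: nat \<times> (int^'n))) \<le> card (adjacent_offsets :: (int^'n) set)"
  unfolding neighbours_def by (intro card_image_le finite_adjacent_offsets)

lemma fst_neighbours: "q' \<in> neighbours q \<Longrightarrow> fst q' = fst q"
  by (auto simp: neighbours_def)

lemma dyadic_index_neighbours:
  fixes x y :: "real^'n"
  assumes "norm (x - y) \<le> 1 / 2^m"
  shows "dyadic_index m y \<in> neighbours (dyadic_index m x)"
proof -
  have e: "\<lfloor>2^m * y$j\<rfloor> - \<lfloor>2^m * x$j\<rfloor> \<in> {-1, 0, 1}" for j
  proof -
    have "\<bar>x$j - y$j\<bar> \<le> 1 / 2^m" using component_le_norm_cart[of "x - y" j] assms by simp
    then have "2^m * \<bar>x$j - y$j\<bar> \<le> 1" by (simp add: field_simps)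
    then have "\<bar>2^m * (x$j - y$j)\<bar> \<le> 1" by (simp add: abs_mult)
    then have "\<bar>2^m * x$j - 2^m * y$j\<bar> \<le> 1" by (simp only: right_diff_distrib)
    then have "\<bar>\<lfloor>2^m * y$j\<rfloor> - \<lfloor>2^m * x$j\<rfloor>\<bar> \<le> 1" by linarith
    then show ?thesis by auto
  qed
  show ?thesis unfolding neighbours_def
  proof (rule image_eqI)
    show "(\<chi> j. \<lfloor>2^m * y$j\<rfloor> - \<lfloor>2^m * x$j\<rfloor>) \<in> adjacent_offsets" using e by (simp add: adjacent_offsets_def)
  qed (simp add: dyadic_index_def vec_eq_iff)
qed

text \<open>The sum of the \<open>t\<close>-th powers of the sides, packaged as a measure on sets of
  cubes so that subadditivity, inclusion-exclusion and continuity from below come from measure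
  theory.\<close>

definition dyadic_weight :: "real \<Rightarrow> (nat \<times> (int^'n)) measure" where
  "dyadic_weight t = density (count_space UNIV) (\<lambda>q. ennreal ((1 / 2 ^ fst q) powr t))"

definition dyadic_content :: "real \<Rightarrow> (real^'n) set \<Rightarrow> ennreal" where
  "dyadic_content t A = (INF D\<in>{D. A \<subseteq> (\<Union>q\<in>D. dyadic_cube q)}. emeasure (dyadic_weight t) D)"

lemma sets_dyadic_weight [simp]: "D \<in> sets (dyadic_weight t)" "sets (dyadic_weight t) = UNIV"
  by (auto simp: dyadic_weight_def)

lemma emeasure_dyadic_weight_eq:
  "emeasure (dyadic_weight t) D = (\<integral>\<^sup>+q. ennreal ((1 / 2 ^ fst q) powr t) * indicator D q \<partial>count_space UNIV)"
  unfolding dyadic_weight_def by (subst emeasure_density) auto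

lemma emeasure_dyadic_weight_finite:
  assumes "finite D"
  shows "emeasure (dyadic_weight t) D = ennreal (\<Sum>q\<in>D. (1 / 2 ^ fst q) powr t)"
proof -
  have "emeasure (dyadic_weight t) D = (\<Sum>q\<in>D. ennreal ((1 / 2 ^ fst q) powr t))"
    unfolding emeasure_dyadic_weight_eq using assms
    by (subst nn_integral_count_space'[of D]) (auto simp: indicator_def)
  then show ?thesis by simp
qed

lemma dyadic_content_le: "A \<subseteq> (\<Union>q\<in>D. dyadic_cube q) \<Longrightarrow> dyadic_content t A \<le> emeasure (dyadic_weight t) D"
  unfolding dyadic_content_def by (intro INF_lower) auto

lemma dyadic_content_mono: "A \<subseteq> B \<Longrightarrow> dyadic_content t A \<le> dyadic_content t B"
  unfolding dyadic_content_def by (intro INF_superset_mono) auto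

lemma near_optimal_cover:
  assumes "dyadic_content t S < top" "0 < e"
  obtains D where "S \<subseteq> (\<Union>q\<in>D. dyadic_cube q)" "emeasure (dyadic_weight t) D < dyadic_content t S + ennreal e"
proof -
  have "dyadic_content t S < dyadic_content t S + ennreal e"
    using assms by (cases "dyadic_content t S") (auto simp: ennreal_lessI simp flip: ennreal_plus)
  then show ?thesis using that unfolding dyadic_content_def[of t S] INF_less_iff by auto
qed

lemma dyadic_content_Un: "dyadic_content t (A \<union> B) \<le> dyadic_content t A + dyadic_content t B"
proof (rule ennreal_le_epsilon)
  fix e :: real assume "dyadic_content t A + dyadic_content t B < top" and e: "0 < e"
  then have fin: "dyadic_content t A < top" "dyadic_content t B < top" by (auto simp: less_top[symmetric])
  obtain DA where DA: "A \<subseteq> (\<Union>q\<in>DA. dyadic_cube q)" "emeasure (dyadic_weight t) DA < dyadic_content t A + ennreal (e/2)"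
    using near_optimal_cover[OF fin(1), of "e/2"] e by auto
  obtain DB where DB: "B \<subseteq> (\<Union>q\<in>DB. dyadic_cube q)" "emeasure (dyadic_weight t) DB < dyadic_content t B + ennreal (e/2)"
    using near_optimal_cover[OF fin(2), of "e/2"] e by auto
  have "dyadic_content t (A \<union> B) \<le> emeasure (dyadic_weight t) (DA \<union> DB)" using DA DB by (intro dyadic_content_le) auto
  also have "\<dots> \<le> emeasure (dyadic_weight t) DA + emeasure (dyadic_weight t) DB" by (intro emeasure_subadditive) auto
  also have "\<dots> \<le> (dyadic_content t A + ennreal (e/2)) + (dyadic_content t B + ennreal (e/2))"
    using DA DB by (intro add_mono) auto
  also have "\<dots> = dyadic_content t A + dyadic_content t B + (ennreal (e/2) + ennreal (e/2))" by (simp only: ac_simps)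
  also have "ennreal (e/2) + ennreal (e/2) = ennreal e" using e by (simp flip: ennreal_plus)
  finally show "dyadic_content t (A \<union> B) \<le> dyadic_content t A + dyadic_content t B + ennreal e" .
qed

section \<open>Maximal cubes and increasing unions\<close>

definition maximal_cubes :: "(nat \<times> (int^'n)) set \<Rightarrow> (nat \<times> (int^'n)) set" where
  "maximal_cubes D = {q\<in>D. \<forall>q'\<in>D. fst q' < fst q \<longrightarrow> \<not> dyadic_cube q \<subseteq> dyadic_cube q'}"

lemma dyadic_cube_nested:
  assumes "x \<in> dyadic_cube q" "x \<in> dyadic_cube q'" "fst q' \<le> fst q"
  shows "dyadic_cube q \<subseteq> dyadic_cube q'"
proof
  fix y assume "y \<in> dyadic_cube q"
  then have "dyadic_index (fst q) y = dyadic_index (fst q) x" using assms(1) by (simp add: mem_dyadic_cube_iff)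
  then have "dyadic_index (fst q') y = dyadic_index (fst q') x" by (rule dyadic_cube_coarser[OF assms(3)])
  then show "y \<in> dyadic_cube q'" using assms(2) by (simp add: mem_dyadic_cube_iff)
qed

text \<open>Among the cubes of \<open>D\<close> that contain a point there is one of least level,
  and by nestedness it is maximal.\<close>

lemma Union_maximal_cubes: "(\<Union>q\<in>maximal_cubes D. dyadic_cube q) = (\<Union>q\<in>D. dyadic_cube q)"
proof (intro equalityI subsetI)
  fix x assume "x \<in> (\<Union>q\<in>D. dyadic_cube q)"
  then obtain q0 where "q0 \<in> D \<and> x \<in> dyadic_cube q0" by blast
  then obtain q where q: "q \<in> D" "x \<in> dyadic_cube q"
    and least: "\<And>q'. q' \<in> D \<Longrightarrow> x \<in> dyadic_cube q' \<Longrightarrow> fst q \<le> fst q'"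
    using ex_has_least_nat[of "\<lambda>q. q \<in> D \<and> x \<in> dyadic_cube q" q0 fst] by blast
  then have "q \<in> maximal_cubes D" by (fastforce simp: maximal_cubes_def not_less)
  then show "x \<in> (\<Union>q\<in>maximal_cubes D. dyadic_cube q)" using q by blast
qed (auto simp: maximal_cubes_def)

text \<open>Strong subadditivity of the weight, for the join \<open>maximal_cubes (U \<union> D)\<close> and the meet
  of two families of cubes.\<close>

lemma maximal_cubes_step:
  assumes "A \<subseteq> (\<Union>q\<in>U. dyadic_cube q)" "A \<subseteq> (\<Union>q\<in>D. dyadic_cube q)"
  shows "emeasure (dyadic_weight t) (maximal_cubes (U \<union> D)) + dyadic_content t A
    \<le> emeasure (dyadic_weight t) U + emeasure (dyadic_weight t) D"
proof -
  let ?W = "emeasure (dyadic_weight t)" and ?M = "maximal_cubes (U \<union> D)"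
  let ?R = "(U \<union> D) - ?M"
  have M: "?M \<subseteq> U \<union> D" by (auto simp: maximal_cubes_def)
  \<comment> \<open>The meet of the two families: a point of \<open>A\<close> lies in a cube of
    each. Either these coincide, or the finer one is contained in the coarser one and so is not
    maximal.\<close>
  have "A \<subseteq> (\<Union>q\<in>?R \<union> (U \<inter> D). dyadic_cube q)"
  proof
    fix x assume "x \<in> A"
    then obtain u d where u: "u \<in> U" "x \<in> dyadic_cube u" and d: "d \<in> D" "x \<in> dyadic_cube d" using assms by blast
    consider "u = d" | "fst u < fst d" | "fst d < fst u"
      using u d by (metis linorder_neqE_nat mem_dyadic_cube_iff)
    then show "x \<in> (\<Union>q\<in>?R \<union> (U \<inter> D). dyadic_cube q)"
    proof cases
      case 1 then show ?thesis using u d by blast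
    next
      case 2
      then have "d \<in> ?R" using u d dyadic_cube_nested[of x d u] by (auto simp: maximal_cubes_def intro!: bexI[of _ u])
      then show ?thesis using d by blast
    next
      case 3
      then have "u \<in> ?R" using u d dyadic_cube_nested[of x u d] by (auto simp: maximal_cubes_def intro!: bexI[of _ d])
      then show ?thesis using u by blast
    qed
  qed
  then have "dyadic_content t A \<le> ?W (?R \<union> (U \<inter> D))" by (rule dyadic_content_le)
  also have "\<dots> \<le> ?W ?R + ?W (U \<inter> D)" by (intro emeasure_subadditive) auto
  finally have "?W ?M + dyadic_content t A \<le> (?W ?M + ?W ?R) + ?W (U \<inter> D)" by (simp add: add.assoc add_left_mono)
  also have "?W ?M + ?W ?R = ?W (U \<union> D)"
    using M by (subst plus_emeasure) (auto intro: arg_cong[where f = "?W"])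
  also have "\<dots> + ?W (U \<inter> D) = ?W U + ?W D" by (rule emeasure_Un_Int[symmetric]) auto
  finally show ?thesis .
qed

text \<open>Near-optimal covers are merged one after the other, keeping only maximal cubes. By
  \<open>maximal_cubes_step\<close> each merger adds only its own error \<open>\<epsilon> n\<close>
  to the excess over the content, so the weights stay bounded.\<close>

lemma dyadic_content_incseq:
  assumes inc: "incseq A" and bound: "\<And>n. dyadic_content t (A n) \<le> ennreal c"
  shows "dyadic_content t (\<Union>n. A n) \<le> ennreal c"
proof (rule ennreal_le_epsilon)
  fix e :: real assume e: "0 < e"
  let ?W = "emeasure (dyadic_weight t)"
  define \<epsilon> where "\<epsilon> n = e * (1/2)^Suc n" for n
  have eps: "0 < \<epsilon> n" for n using e by (simp add: \<epsilon>_def)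
  have "\<exists>D. A n \<subseteq> (\<Union>q\<in>D. dyadic_cube q) \<and> ?W D < dyadic_content t (A n) + ennreal (\<epsilon> n)" for n
  proof -
    have "dyadic_content t (A n) < top" using bound[of n] by (simp add: le_less_trans)
    then show ?thesis using near_optimal_cover[OF _ eps[of n]] by metis
  qed
  then obtain D where D: "\<And>n. A n \<subseteq> (\<Union>q\<in>D n. dyadic_cube q)"
      "\<And>n. ?W (D n) < dyadic_content t (A n) + ennreal (\<epsilon> n)" by metis
  define E where "E n = (\<Union>k\<le>n. D k)" for n
  have step: "?W (maximal_cubes (E n)) \<le> dyadic_content t (A n) + ennreal (\<Sum>k\<le>n. \<epsilon> k)" for n
  proof (induction n)
    case 0
    have "?W (maximal_cubes (E 0)) \<le> ?W (D 0)" by (intro emeasure_mono) (auto simp: maximal_cubes_def E_def)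
    then show ?case using D(2)[of 0] by simp
  next
    case (Suc n)
    have sub: "A n \<subseteq> (\<Union>q\<in>maximal_cubes (E n). dyadic_cube q)" unfolding Union_maximal_cubes using D(1)[of n] by (auto simp: E_def)
    have sub': "A n \<subseteq> (\<Union>q\<in>D (Suc n). dyadic_cube q)" using D(1)[of "Suc n"] incseq_SucD[OF inc, of n] by blast
    \<comment> \<open>A maximal cube of the larger union is either new or was already maximal
      before.\<close>
    have "maximal_cubes (E (Suc n)) \<subseteq> maximal_cubes (maximal_cubes (E n) \<union> D (Suc n))"
      by (auto simp: maximal_cubes_def E_def atMost_Suc)
    then have "?W (maximal_cubes (E (Suc n))) + dyadic_content t (A n)
        \<le> ?W (maximal_cubes (maximal_cubes (E n) \<union> D (Suc n))) + dyadic_content t (A n)"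
      by (intro add_right_mono emeasure_mono) auto
    also have "\<dots> \<le> ?W (maximal_cubes (E n)) + ?W (D (Suc n))" by (rule maximal_cubes_step[OF sub sub'])
    also have "\<dots> \<le> (dyadic_content t (A n) + ennreal (\<Sum>k\<le>n. \<epsilon> k)) + (dyadic_content t (A (Suc n)) + ennreal (\<epsilon> (Suc n)))"
      using Suc.IH D(2)[of "Suc n"] by (intro add_mono) auto
    also have "\<dots> = (dyadic_content t (A (Suc n)) + (ennreal (\<Sum>k\<le>n. \<epsilon> k) + ennreal (\<epsilon> (Suc n)))) + dyadic_content t (A n)"
      by (simp only: ac_simps)
    also have "ennreal (\<Sum>k\<le>n. \<epsilon> k) + ennreal (\<epsilon> (Suc n)) = ennreal (\<Sum>k\<le>Suc n. \<epsilon> k)"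
      using eps by (simp add: less_imp_le sum_nonneg flip: ennreal_plus)
    finally have "dyadic_content t (A n) + ?W (maximal_cubes (E (Suc n)))
        \<le> dyadic_content t (A n) + (dyadic_content t (A (Suc n)) + ennreal (\<Sum>k\<le>Suc n. \<epsilon> k))"
      by (simp only: add.commute)
    moreover have "dyadic_content t (A n) \<noteq> top" using bound[of n] by (metis ennreal_neq_top top_unique)
    ultimately show ?case by (simp only: ennreal_add_left_cancel_le) simp
  qed
  have eps_sum: "(\<Sum>k\<le>n. \<epsilon> k) \<le> e" for n
  proof -
    have "(\<Sum>k\<le>n. \<epsilon> k) = e * (1 - (1/2)^Suc n)"
      by (induction n) (auto simp: \<epsilon>_def algebra_simps)
    also have "\<dots> \<le> e * 1" using e by (intro mult_left_mono) auto
    finally show ?thesis by simp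
  qed
  have le: "?W (maximal_cubes (E n)) \<le> ennreal c + ennreal e" for n
    using step[of n] bound[of n] eps_sum[of n] by (meson add_mono ennreal_leI order_trans)
  \<comment> \<open>The cubes that remain maximal from stage \<open>n\<close> on. Each maximal cube
    of the whole union occurs at some stage and is maximal ever after, so the \<open>V n\<close>
    increase to a cover and continuity from below applies.\<close>
  define V where "V n = (\<Inter>k\<in>{n..}. maximal_cubes (E k))" for n
  have "maximal_cubes (\<Union>n. E n) \<subseteq> (\<Union>n. V n)"
  proof
    fix q assume q: "q \<in> maximal_cubes (\<Union>n. E n)"
    then obtain n where n: "q \<in> E n" by (auto simp: maximal_cubes_def)
    have "q \<in> maximal_cubes (E k)" if "n \<le> k" for k
    proof -
      have "q \<in> E k" using n that by (auto simp: E_def intro: order_trans)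
      then show ?thesis using q by (auto simp: maximal_cubes_def)
    qed
    then show "q \<in> (\<Union>n. V n)" by (auto simp: V_def)
  qed
  then have "(\<Union>n. A n) \<subseteq> (\<Union>q\<in>(\<Union>n. V n). dyadic_cube q)"
    using D(1) Union_maximal_cubes[of "\<Union>n. E n"] by (fastforce simp: E_def)
  then have "dyadic_content t (\<Union>n. A n) \<le> ?W (\<Union>n. V n)" by (rule dyadic_content_le)
  also have "\<dots> = (SUP n. ?W (V n))"
    by (rule SUP_emeasure_incseq[symmetric]) (auto simp: incseq_def V_def)
  also have "\<dots> \<le> ennreal c + ennreal e"
  proof (rule SUP_least)
    fix n show "?W (V n) \<le> ennreal c + ennreal e"
      by (rule order_trans[OF emeasure_mono le[of n]]) (auto simp: V_def)
  qed
  finally show "dyadic_content t (\<Union>n. A n) \<le> ennreal c + ennreal e" .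
qed

section \<open>Compact subsets of analytic sets\<close>

text \<open>The neighbours form one translated copy of \<open>D\<close> for each offset, and
  translation preserves levels and hence weights.\<close>

lemma dyadic_weight_image_neighbours:
  fixes D :: "(nat \<times> (int^'n)) set"
  shows "emeasure (dyadic_weight t) (\<Union>q\<in>D. neighbours q)
    \<le> of_nat (card (adjacent_offsets :: (int^'n) set)) * emeasure (dyadic_weight t) D"
proof -
  let ?O = "adjacent_offsets :: (int^'n) set"
  let ?s = "\<lambda>e q :: nat \<times> (int^'n). (fst q, snd q + e)"
  have shift: "emeasure (dyadic_weight t) (?s e ` D) = emeasure (dyadic_weight t) D" for e
  proof -
    have bij: "bij_betw (?s e) D (?s e ` D)" by (intro inj_on_imp_bij_betw inj_onI) (auto simp: prod_eq_iff)
    have *: "emeasure (dyadic_weight t) D' = (\<integral>\<^sup>+q. ennreal ((1 / 2 ^ fst q) powr t) \<partial>count_space D')" for D' :: "(nat \<times> (int^'n)) set"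
      unfolding emeasure_dyadic_weight_eq by (subst nn_integral_count_space_indicator) auto
    show ?thesis unfolding * using nn_integral_bij_count_space[OF bij, of "\<lambda>q. ennreal ((1 / 2 ^ fst q) powr t)"] by simp
  qed
  have "(\<Union>q\<in>D. neighbours q) = (\<Union>e\<in>?O. ?s e ` D)" by (auto simp: neighbours_def)
  also have "emeasure (dyadic_weight t) \<dots> \<le> (\<Sum>e\<in>?O. emeasure (dyadic_weight t) (?s e ` D))"
    by (intro emeasure_subadditive_finite finite_adjacent_offsets) auto
  also have "\<dots> = of_nat (card ?O) * emeasure (dyadic_weight t) D" by (simp add: shift)
  finally show ?thesis .
qed

section \<open>Cylinders and compact sets in the Baire space\<close>

lemma open_fun_contains_cylinder:
  fixes V :: "(nat \<Rightarrow> 'a::topological_space) set"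
  assumes "open V" "\<sigma> \<in> V"
  shows "\<exists>m. {\<tau>. \<forall>i<m. \<tau> i = \<sigma> i} \<subseteq> V"
proof -
  have "openin (product_topology (\<lambda>i. euclidean) UNIV) V" using assms(1) by (simp add: open_fun_def)
  from product_topology_open_contains_basis[OF this assms(2)]
  obtain X where X: "\<sigma> \<in> Pi\<^sub>E UNIV X" "finite {i. X i \<noteq> UNIV}" "Pi\<^sub>E UNIV X \<subseteq> V" by auto
  obtain m where m: "\<And>i. i \<in> {i. X i \<noteq> UNIV} \<Longrightarrow> i < m" using finite_nat_bounded[OF X(2)] by blast
  have "{\<tau>. \<forall>i<m. \<tau> i = \<sigma> i} \<subseteq> Pi\<^sub>E UNIV X"
  proof
    fix \<tau> assume t: "\<tau> \<in> {\<tau>. \<forall>i<m. \<tau> i = \<sigma> i}"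
    have "\<tau> i \<in> X i" for i
    proof (cases "X i = UNIV")
      case False
      then have "\<tau> i = \<sigma> i" using m t by simp
      then show ?thesis using X(1) by auto
    qed simp
    then show "\<tau> \<in> Pi\<^sub>E UNIV X" by auto
  qed
  from order_trans[OF this X(3)] show ?thesis by (rule exI)
qed

lemma open_cylinder:
  "open {\<tau> :: nat \<Rightarrow> nat. \<forall>i<m. \<tau> i = \<sigma> i}"
proof -
  have "{\<tau> :: nat \<Rightarrow> nat. \<forall>i<m. \<tau> i = \<sigma> i} = Pi\<^sub>E UNIV (\<lambda>i. if i < m then {\<sigma> i} else UNIV)"
    by (auto simp: PiE_def Pi_def split: if_splits)
  also have "open \<dots>"
  proof (rule open_PiE)
    show "finite {i. (if i < m then {\<sigma> i} else UNIV) \<noteq> UNIV}"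
      by (rule finite_subset[of _ "{..<m}"]) (auto split: if_splits)
  qed (auto intro: open_discrete)
  finally show ?thesis .
qed

lemma compact_bounded_sequences: "compact {\<sigma> :: nat \<Rightarrow> nat. \<forall>i. \<sigma> i \<le> g i}"
proof -
  have "{\<sigma> :: nat \<Rightarrow> nat. \<forall>i. \<sigma> i \<le> g i} = Pi\<^sub>E UNIV (\<lambda>i. {..g i})" by auto
  moreover have "compactin (product_topology (\<lambda>i. euclidean) UNIV) (Pi\<^sub>E UNIV (\<lambda>i. {..g i}))"
    unfolding compactin_PiE by (auto intro: finite_imp_compact)
  ultimately show ?thesis by (simp add: euclidean_product_topology)
qed

text \<open>Finitely many cylinders inside \<open>V\<close> cover the compact set of sequences
  bounded by \<open>g\<close>; \<open>k\<close> bounds the lengths of their prefixes.\<close>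

lemma open_contains_bounded_prefix:
  fixes V :: "(nat \<Rightarrow> nat) set"
  assumes "open V" "{\<sigma>. \<forall>i. \<sigma> i \<le> g i} \<subseteq> V"
  shows "\<exists>k. {\<sigma>. \<forall>i<k. \<sigma> i \<le> g i} \<subseteq> V"
proof -
  let ?K = "{\<sigma> :: nat \<Rightarrow> nat. \<forall>i. \<sigma> i \<le> g i}"
  have "\<exists>m. {\<tau>. \<forall>i<m. \<tau> i = \<sigma> i} \<subseteq> V" if "\<sigma> \<in> ?K" for \<sigma>
    using open_fun_contains_cylinder[OF assms(1)] assms(2) that by blast
  then have "\<forall>\<sigma>\<in>?K. \<exists>m. {\<tau>. \<forall>i<m. \<tau> i = \<sigma> i} \<subseteq> V" by blast
  from bchoice[OF this] obtain m where m: "\<And>\<sigma>. \<sigma> \<in> ?K \<Longrightarrow> {\<tau>. \<forall>i<m \<sigma>. \<tau> i = \<sigma> i} \<subseteq> V" by blast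
  have "?K \<subseteq> (\<Union>\<sigma>\<in>?K. {\<tau>. \<forall>i<m \<sigma>. \<tau> i = \<sigma> i})" by blast
  then obtain F where F: "F \<subseteq> ?K" "finite F" "?K \<subseteq> (\<Union>\<sigma>\<in>F. {\<tau>. \<forall>i<m \<sigma>. \<tau> i = \<sigma> i})"
    by (rule compactE_image[OF compact_bounded_sequences[of g] open_cylinder])
  obtain k where k: "\<And>\<sigma>. \<sigma> \<in> F \<Longrightarrow> m \<sigma> \<le> k"
    using F(2) Max_ge[of "m ` F"] by blast
  have "\<tau> \<in> V" if t: "\<forall>i<k. \<tau> i \<le> g i" for \<tau>
  proof -
    \<comment> \<open>Cutting off after \<open>k\<close> places gives a member of the compact set
      without changing any coordinate that the cylinders see.\<close>
    define \<tau>' where "\<tau>' i = (if i < k then \<tau> i else 0)" for i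
    have "\<tau>' \<in> ?K" using t by (simp add: \<tau>'_def)
    then obtain \<sigma> where s: "\<sigma> \<in> F" "\<forall>i<m \<sigma>. \<tau>' i = \<sigma> i" using F(3) by blast
    then have "\<forall>i<m \<sigma>. \<tau> i = \<sigma> i" using k[OF s(1)] by (simp add: \<tau>'_def)
    then show ?thesis using m[of \<sigma>] F(1) s(1) by blast
  qed
  then show ?thesis by blast
qed

text \<open>The capacity argument: coordinates are bounded one at a time, keeping the content of the
  image above \<open>c\<close> by continuity along increasing sequences. In the limit a cover of
  \<open>K\<close> is enlarged to an open one, which costs the number of neighbours and already
  contains the image for some finite stage.\<close>

theorem analytic_set_compact_subset:
  fixes A :: "(real^'n) set"
  assumes "analytic_set A" "ennreal c < dyadic_content t A"
  obtains K where "compact K" "K \<subseteq> A"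
    "ennreal c \<le> of_nat (card (adjacent_offsets :: (int^'n) set)) * dyadic_content t K"
proof -
  have "A \<noteq> {}"
  proof
    assume "A = {}"
    then have "dyadic_content t A \<le> emeasure (dyadic_weight t) {}" using dyadic_content_le[of A "{}" t] by simp
    then have "dyadic_content t A = 0" by simp
    then show False using assms(2) by simp
  qed
  then obtain f :: "(nat \<Rightarrow> nat) \<Rightarrow> real^'n" where f: "continuous_on UNIV f" "range f = A"
    using assms(1) unfolding analytic_set_def by blast
  define C where "C k g = {\<sigma> :: nat \<Rightarrow> nat. \<forall>i<k. \<sigma> i \<le> g i}" for k and g :: "nat \<Rightarrow> nat"
  let ?P = "\<lambda>k g. ennreal c < dyadic_content t (f ` C k g)"
  have step: "\<exists>v. ?P (Suc k) (g(k := v))" if "?P k g" for k g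
  proof (rule ccontr)
    assume "\<nexists>v. ?P (Suc k) (g(k := v))"
    then have le: "\<And>v. dyadic_content t (f ` C (Suc k) (g(k := v))) \<le> ennreal c" by (simp add: not_less)
    have "incseq (\<lambda>v. f ` C (Suc k) (g(k := v)))"
    proof (intro incseq_SucI image_mono subsetI)
      fix v \<sigma> assume "\<sigma> \<in> C (Suc k) (g(k := v))"
      then show "\<sigma> \<in> C (Suc k) (g(k := Suc v))" by (auto simp: C_def split: if_splits intro: le_SucI)
    qed
    from dyadic_content_incseq[OF this le] have "dyadic_content t (\<Union>v. f ` C (Suc k) (g(k := v))) \<le> ennreal c" .
    moreover have "C k g \<subseteq> (\<Union>v. C (Suc k) (g(k := v)))"
    proof
      fix \<sigma> assume "\<sigma> \<in> C k g"
      then have "\<sigma> \<in> C (Suc k) (g(k := \<sigma> k))" by (auto simp: C_def less_Suc_eq)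
      then show "\<sigma> \<in> (\<Union>v. C (Suc k) (g(k := v)))" by blast
    qed
    then have "f ` C k g \<subseteq> (\<Union>v. f ` C (Suc k) (g(k := v)))" by blast
    then have "dyadic_content t (f ` C k g) \<le> dyadic_content t (\<Union>v. f ` C (Suc k) (g(k := v)))"
      by (rule dyadic_content_mono)
    ultimately show False using that by (simp add: not_less[symmetric])
  qed
  \<comment> \<open>\<open>G k\<close> holds the bounds chosen so far. Step \<open>k\<close> alters
    only the value at \<open>k\<close>, so the diagonal \<open>g\<close> agrees with
    \<open>G k\<close> below \<open>k\<close>.\<close>
  define G where "G = rec_nat (\<lambda>_. 0) (\<lambda>k g. g(k := SOME v. ?P (Suc k) (g(k := v))))"
  have G_Suc: "G (Suc k) = (G k)(k := SOME v. ?P (Suc k) ((G k)(k := v)))" for k by (simp add: G_def)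
  have GP: "?P k (G k)" for k
  proof (induction k)
    case 0 then show ?case using assms(2) f(2) by (simp add: C_def)
  next
    case (Suc k)
    show ?case using someI_ex[OF step[OF Suc]] unfolding G_Suc .
  qed
  define g where "g i = G (Suc i) i" for i
  have Gg: "G k i = g i" if "i < k" for i k
    using that by (induction k) (auto simp: G_Suc g_def less_Suc_eq)
  have gP: "?P k g" for k
  proof -
    have "C k (G k) = C k g" using Gg by (auto simp: C_def)
    then show ?thesis using GP[of k] by simp
  qed
  define K where "K = f ` {\<sigma>. \<forall>i. \<sigma> i \<le> g i}"
  have K: "compact K" "K \<subseteq> A" unfolding K_def
    using compact_continuous_image[OF continuous_on_subset[OF f(1)] compact_bounded_sequences] f(2) by auto
  let ?N = "of_nat (card (adjacent_offsets :: (int^'n) set)) :: ennreal"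
  have "ennreal c \<le> ?N * dyadic_content t K"
  proof (rule ennreal_le_epsilon)
    fix e :: real assume fin: "?N * dyadic_content t K < top" and e: "0 < e"
    have "(0 :: int^'n) \<in> adjacent_offsets" by (simp add: adjacent_offsets_def)
    then have N0: "0 < card (adjacent_offsets :: (int^'n) set)"
      using finite_adjacent_offsets card_gt_0_iff by blast
    have "dyadic_content t K < top" using fin N0 by (auto simp: ennreal_mult_less_top ennreal_mult_eq_top_iff less_top)
    then obtain D where D: "K \<subseteq> (\<Union>q\<in>D. dyadic_cube q)"
        "emeasure (dyadic_weight t) D < dyadic_content t K + ennreal (e / card (adjacent_offsets :: (int^'n) set))"
      using near_optimal_cover[of t K "e / card (adjacent_offsets :: (int^'n) set)"] e N0 by auto
    \<comment> \<open>Half-open cubes are not open, so each is enlarged by its own side; the result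
      is still covered by the neighbours.\<close>
    define U where "U = (\<Union>q\<in>D. \<Union>x\<in>dyadic_cube q. ball x (1 / 2 ^ fst q))"
    have "open U" by (auto simp: U_def)
    have "K \<subseteq> U"
    proof
      fix x assume "x \<in> K"
      then obtain q where "q \<in> D" "x \<in> dyadic_cube q" using D by blast
      moreover have "x \<in> ball x (1 / 2 ^ fst q)" by simp
      ultimately show "x \<in> U" unfolding U_def by blast
    qed
    have UN: "U \<subseteq> (\<Union>q'\<in>(\<Union>q\<in>D. neighbours q). dyadic_cube q')"
    proof
      fix y assume "y \<in> U"
      then obtain q x where q: "q \<in> D" "x \<in> dyadic_cube q" "dist x y < 1 / 2 ^ fst q" by (auto simp: U_def)
      then have "dyadic_index (fst q) y \<in> neighbours (dyadic_index (fst q) x)"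
        by (intro dyadic_index_neighbours) (simp add: dist_norm)
      also have "dyadic_index (fst q) x = q" using q by (simp add: mem_dyadic_cube_iff)
      finally show "y \<in> (\<Union>q'\<in>(\<Union>q\<in>D. neighbours q). dyadic_cube q')" using q(1) mem_dyadic_cube_index by blast
    qed
    have "open (f -` U)" using f(1) \<open>open U\<close> by (metis continuous_on_open_vimage open_UNIV Int_UNIV_right)
    moreover have "{\<sigma>. \<forall>i. \<sigma> i \<le> g i} \<subseteq> f -` U" using \<open>K \<subseteq> U\<close> by (auto simp: K_def)
    ultimately obtain k where "C k g \<subseteq> f -` U" using open_contains_bounded_prefix unfolding C_def by blast
    then have "f ` C k g \<subseteq> (\<Union>q'\<in>(\<Union>q\<in>D. neighbours q). dyadic_cube q')" using UN by blast
    then have "dyadic_content t (f ` C k g) \<le> emeasure (dyadic_weight t) (\<Union>q\<in>D. neighbours q)" by (rule dyadic_content_le)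
    also have "\<dots> \<le> ?N * emeasure (dyadic_weight t) D" by (rule dyadic_weight_image_neighbours)
    also have "\<dots> \<le> ?N * (dyadic_content t K + ennreal (e / card (adjacent_offsets :: (int^'n) set)))"
      using D(2) by (intro mult_left_mono) auto
    also have "\<dots> = ?N * dyadic_content t K + ?N * ennreal (e / card (adjacent_offsets :: (int^'n) set))"
      by (rule distrib_left)
    also have "?N * ennreal (e / card (adjacent_offsets :: (int^'n) set)) = ennreal e"
      using N0 e by (simp add: ennreal_of_nat_eq_real_of_nat flip: ennreal_mult)
    finally show "ennreal c \<le> ?N * dyadic_content t K + ennreal e" using gP[of k] by (simp add: less_imp_le[OF less_le_trans])
  qed
  then show ?thesis using that K by blast
qed

section \<open>Dyadic content and Hausdorff dimension\<close>

text \<open>If the content vanishes there are covers of arbitrarily small weight. Small weight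
  forces small cubes, so the Hausdorff measure of exponent \<open>t\<close> vanishes as
  well.\<close>

lemma dyadic_content_pos_if_dim:
  fixes A :: "(real^'n) set"
  assumes "0 < t" "ereal t < hausdorff_dim A"
  shows "0 < dyadic_content t A"
proof (rule ccontr)
  assume "\<not> 0 < dyadic_content t A"
  then have c0: "dyadic_content t A = 0" by simp
  let ?n = "real CARD('n)"
  have n: "0 < ?n" by simp
  have "hausdorff_premeasure t \<delta> A \<le> ennreal \<epsilon>" if "0 < \<delta>" "0 < \<epsilon>" for \<delta> \<epsilon>
  proof -
    \<comment> \<open>The first entry compensates for diameters that may be \<open>?n\<close> times
      the side; the second forces every cube to have diameter at most \<delta>.\<close>
    define \<epsilon>' where "\<epsilon>' = min (\<epsilon> / ?n powr t) ((\<delta> / ?n) powr t)"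
    have e': "0 < \<epsilon>'" using that n by (simp add: \<epsilon>'_def)
    obtain D where D: "A \<subseteq> (\<Union>q\<in>D. dyadic_cube q)" "emeasure (dyadic_weight t) D < ennreal \<epsilon>'"
      using near_optimal_cover[of t A \<epsilon>'] c0 e' by auto
    have small: "1 / 2 ^ fst q \<le> \<delta> / ?n" if q: "q \<in> D" for q
    proof -
      have "ennreal ((1 / 2 ^ fst q) powr t) = emeasure (dyadic_weight t) {q}"
        by (simp add: emeasure_dyadic_weight_finite)
      also have "\<dots> \<le> emeasure (dyadic_weight t) D" using q by (intro emeasure_mono) auto
      also have "\<dots> < ennreal \<epsilon>'" by (rule D(2))
      finally have "(1 / 2 ^ fst q) powr t < \<epsilon>'" by (simp add: ennreal_less_iff)
      then have "(1 / 2 ^ fst q) powr t < (\<delta> / ?n) powr t" by (simp add: \<epsilon>'_def)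
      then show ?thesis using assms(1) \<open>0 < \<delta>\<close> n by (metis less_imp_le linorder_not_less powr_mono2 divide_nonneg_nonneg)
    qed
    have cube_diam: "bounded (dyadic_cube q :: (real^'n) set)" "diameter (dyadic_cube q :: (real^'n) set) \<le> ?n / 2 ^ fst q" for q
    proof -
      show "bounded (dyadic_cube q :: (real^'n) set)" using dyadic_cube_dist unfolding bounded_two_points by blast
      show "diameter (dyadic_cube q :: (real^'n) set) \<le> ?n / 2 ^ fst q"
      proof (rule diameter_le)
        show "norm (x - y) \<le> ?n / 2 ^ fst q" if "x \<in> dyadic_cube q" "y \<in> dyadic_cube q" for x y :: "real^'n"
          using dyadic_cube_dist[OF that] by (simp only: dist_norm)
      qed simp
    qed
    define U where "U i = (if i \<in> to_nat ` D then dyadic_cube (from_nat i) else {} :: (real^'n) set)" for i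
    have "is_delta_cover \<delta> A U"
      unfolding is_delta_cover_def
    proof (intro conjI allI)
      show "A \<subseteq> (\<Union>i. U i)"
      proof
        fix x assume "x \<in> A"
        then obtain q where "q \<in> D" "x \<in> dyadic_cube q" using D by blast
        then have "x \<in> U (to_nat q)" by (simp add: U_def)
        then show "x \<in> (\<Union>i. U i)" by blast
      qed
      fix i
      show "bounded (U i)" using cube_diam(1) by (simp add: U_def)
      show "diameter (U i) \<le> \<delta>"
      proof (cases "i \<in> to_nat ` D")
        case True
        then obtain q where q: "q \<in> D" "i = to_nat q" by blast
        have "diameter (U i) \<le> ?n * (1 / 2 ^ fst q)" using cube_diam(2)[of q] q by (simp add: U_def)
        also have "\<dots> \<le> ?n * (\<delta> / ?n)" using small[OF q(1)] n by (intro mult_left_mono) auto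
        finally show ?thesis using n by simp
      next
        case False then show ?thesis using \<open>0 < \<delta>\<close> by (simp add: U_def)
      qed
    qed
    then have "hausdorff_premeasure t \<delta> A \<le> (\<Sum>i. diam_pow t (U i))"
      unfolding hausdorff_premeasure_def by (intro INF_lower) auto
    also have "\<dots> = (\<integral>\<^sup>+i. diam_pow t (U i) \<partial>count_space UNIV)" by (rule nn_integral_count_space_nat[symmetric])
    also have "\<dots> = (\<integral>\<^sup>+i. diam_pow t (U i) \<partial>count_space (to_nat ` D))"
      by (rule nn_integral_count_space_eq) (auto simp: U_def diam_pow_def)
    also have "\<dots> = (\<integral>\<^sup>+q. diam_pow t (U (to_nat q)) \<partial>count_space D)"
      by (rule nn_integral_bij_count_space[symmetric]) (intro inj_on_imp_bij_betw inj_on_subset[OF inj_to_nat] subset_UNIV)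
    also have "\<dots> \<le> (\<integral>\<^sup>+q. ennreal (?n powr t) * ennreal ((1 / 2 ^ fst q) powr t) \<partial>count_space D)"
    proof (rule nn_integral_mono)
      fix q assume "q \<in> space (count_space D)"
      then have "diam_pow t (U (to_nat q)) \<le> ennreal (diameter (dyadic_cube q :: (real^'n) set) powr t)"
        using assms(1) by (simp add: U_def diam_pow_def)
      also have "\<dots> \<le> ennreal ((?n / 2 ^ fst q) powr t)"
        using cube_diam assms(1) by (intro ennreal_leI powr_mono2) (auto simp: diameter_ge_0)
      also have "(?n / 2 ^ fst q) powr t = ?n powr t * (1 / 2 ^ fst q) powr t" by (simp flip: powr_mult)
      also have "ennreal \<dots> = ennreal (?n powr t) * ennreal ((1 / 2 ^ fst q) powr t)" by (simp add: ennreal_mult)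
      finally show "diam_pow t (U (to_nat q)) \<le> ennreal (?n powr t) * ennreal ((1 / 2 ^ fst q) powr t)" .
    qed
    also have "\<dots> = ennreal (?n powr t) * emeasure (dyadic_weight t) D"
      unfolding emeasure_dyadic_weight_eq by (subst nn_integral_cmult) (auto simp: nn_integral_count_space_indicator)
    also have "\<dots> \<le> ennreal (?n powr t) * ennreal (\<epsilon> / ?n powr t)"
      using D(2) by (intro mult_left_mono) (auto intro: order_trans[OF less_imp_le] simp: \<epsilon>'_def ennreal_leI)
    also have "\<dots> = ennreal \<epsilon>" using n \<open>0 < \<epsilon>\<close> by (simp flip: ennreal_mult)
    finally show ?thesis .
  qed
  note small = this
  have "hausdorff_premeasure t \<delta> A \<le> 0" if "0 < \<delta>" for \<delta>
  proof (rule ennreal_le_epsilon)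
    show "hausdorff_premeasure t \<delta> A \<le> 0 + ennreal e" if "0 < e" for e
      using small[OF \<open>0 < \<delta>\<close> that] by simp
  qed
  then have "hausdorff_measure t A \<le> 0" unfolding hausdorff_measure_def by (intro SUP_least) simp
  then have "hausdorff_measure t A = 0" by simp
  then have "hausdorff_dim A \<le> ereal t" unfolding hausdorff_dim_def using assms(1) by (intro INF_lower) auto
  then show False using assms(2) by simp
qed

section \<open>Discrete Frostman measures\<close>

definition cube_mass :: "(real^'n) set \<Rightarrow> (real^'n \<Rightarrow> real) \<Rightarrow> nat \<times> (int^'n) \<Rightarrow> real" where
  "cube_mass P w q = (\<Sum>p\<in>{p\<in>P. p \<in> dyadic_cube q}. w p)"

definition saturated :: "real \<Rightarrow> (real^'n) set \<Rightarrow> (real^'n \<Rightarrow> real) \<Rightarrow> nat \<times> (int^'n) \<Rightarrow> bool" where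
  "saturated t P w q \<longleftrightarrow> cube_mass P w q = (1 / 2 ^ fst q) powr t"

lemma cube_mass_nonneg: "(\<And>p. 0 \<le> w p) \<Longrightarrow> 0 \<le> cube_mass P w q"
  unfolding cube_mass_def by (intro sum_nonneg) auto

text \<open>Frostman's construction from fine to coarse scales: in every cube of the current
  generation which is too heavy, the weights are scaled down until the cube is saturated.\<close>

lemma frostman_induction:
  fixes P :: "(real^'n) set"
  assumes finP: "finite P" and inj: "inj_on (dyadic_index n) P" and "m \<le> n"
  shows "\<exists>w. (\<forall>p. 0 \<le> w p) \<and> (\<forall>q. m \<le> fst q \<longrightarrow> fst q \<le> n \<longrightarrow> cube_mass P w q \<le> (1 / 2 ^ fst q) powr t) \<and>
    (\<forall>p\<in>P. \<exists>q. m \<le> fst q \<and> fst q \<le> n \<and> p \<in> dyadic_cube q \<and> saturated t P w q)"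
  using \<open>m \<le> n\<close>
proof (induction rule: inc_induct)
  case base
  \<comment> \<open>At level \<open>n\<close> a cube contains at most one point of \<open>P\<close>,
    so this weight saturates every occupied cube.\<close>
  define w :: "real^'n \<Rightarrow> real" where "w p = (1 / 2 ^ n) powr t" for p
  have single: "{p'\<in>P. p' \<in> dyadic_cube q} \<subseteq> {p}" if "p \<in> P" "p \<in> dyadic_cube q" "fst q = n" for p q
    using inj that by (auto simp: mem_dyadic_cube_iff inj_on_def)
  have le: "cube_mass P w q \<le> (1 / 2 ^ fst q) powr t" if "fst q = n" for q
  proof (cases "{p\<in>P. p \<in> dyadic_cube q} = {}")
    case True then show ?thesis unfolding cube_mass_def by (subst True) simp
  next
    case False
    then obtain p where p: "p \<in> P" "p \<in> dyadic_cube q" by blast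
    then have "{p'\<in>P. p' \<in> dyadic_cube q} = {p}" using single that by blast
    then show ?thesis using that by (simp add: cube_mass_def w_def)
  qed
  have "\<exists>q. n \<le> fst q \<and> fst q \<le> n \<and> p \<in> dyadic_cube q \<and> saturated t P w q" if p: "p \<in> P" for p
  proof -
    have "{p'\<in>P. p' \<in> dyadic_cube (dyadic_index n p)} = {p}" using single[OF p, of "dyadic_index n p"] p by auto
    then have "saturated t P w (dyadic_index n p)" by (simp add: saturated_def cube_mass_def w_def)
    then show ?thesis by (intro exI[of _ "dyadic_index n p"]) simp
  qed
  note sat = this
  show ?case
  proof (intro exI[of _ w] conjI allI impI ballI)
    show "0 \<le> w p" for p by (simp add: w_def)
    show "cube_mass P w q \<le> (1 / 2 ^ fst q) powr t" if "n \<le> fst q" "fst q \<le> n" for q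
      using le[of q] that by simp
  qed (rule sat)
next
  case (step m)
  then obtain w where w: "\<And>p. 0 \<le> w p"
      "\<And>q. Suc m \<le> fst q \<Longrightarrow> fst q \<le> n \<Longrightarrow> cube_mass P w q \<le> (1 / 2 ^ fst q) powr t"
      "\<And>p. p \<in> P \<Longrightarrow> \<exists>q. Suc m \<le> fst q \<and> fst q \<le> n \<and> p \<in> dyadic_cube q \<and> saturated t P w q"
    by metis
  \<comment> \<open>For a cube of mass zero the quotient is zero by convention; this is harmless
    because the weights in it vanish already.\<close>
  define \<phi> where "\<phi> q = min 1 ((1 / 2 ^ m) powr t / cube_mass P w q)" for q
  define w' where "w' p = w p * \<phi> (dyadic_index m p)" for p
  have phi: "0 \<le> \<phi> q" "\<phi> q \<le> 1" for q using cube_mass_nonneg[of w P q] w(1) by (auto simp: \<phi>_def)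
  have w'0: "0 \<le> w' p" for p using w(1) phi by (simp add: w'_def)
  have w'le: "w' p \<le> w p" for p using w(1) phi by (simp add: w'_def mult_left_le)
  have mass': "cube_mass P w' q = \<phi> q * cube_mass P w q" if "fst q = m" for q
  proof -
    have "cube_mass P w' q = (\<Sum>p\<in>{p\<in>P. p \<in> dyadic_cube q}. \<phi> q * w p)"
      unfolding cube_mass_def using that by (intro sum.cong) (auto simp: w'_def mem_dyadic_cube_iff)
    then show ?thesis by (simp add: cube_mass_def sum_distrib_left)
  qed
  have le: "cube_mass P w' q \<le> (1 / 2 ^ fst q) powr t" if "m \<le> fst q" "fst q \<le> n" for q
  proof (cases "fst q = m")
    case True
    show ?thesis
    proof (cases "cube_mass P w q = 0")
      case False
      then have "0 < cube_mass P w q" using cube_mass_nonneg[of w P q] w(1) by (simp add: less_le)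
      then have "\<phi> q * cube_mass P w q \<le> (1 / 2 ^ m) powr t"
        by (simp add: \<phi>_def min_mult_distrib_right)
      then show ?thesis using mass' True by simp
    qed (use mass' True in simp)
  next
    case False
    have "cube_mass P w' q \<le> cube_mass P w q" unfolding cube_mass_def using w'le by (intro sum_mono) auto
    also have "\<dots> \<le> (1 / 2 ^ fst q) powr t" using w(2)[of q] that False by simp
    finally show ?thesis .
  qed
  have sat: "\<exists>q. m \<le> fst q \<and> fst q \<le> n \<and> p \<in> dyadic_cube q \<and> saturated t P w' q" if p: "p \<in> P" for p
  proof -
    obtain q where q: "Suc m \<le> fst q" "fst q \<le> n" "p \<in> dyadic_cube q" "saturated t P w q" using w(3)[OF p] by blast
    define q0 where "q0 = dyadic_index m p"
    have pq0: "p \<in> dyadic_cube q0" "fst q0 = m" by (auto simp: q0_def)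
    have sub: "dyadic_cube q \<subseteq> dyadic_cube q0" using dyadic_cube_nested[OF q(3) pq0(1)] q(1) pq0(2) by simp
    have "(1 / 2 ^ fst q) powr t \<le> cube_mass P w q0"
    proof -
      have "cube_mass P w q \<le> cube_mass P w q0" unfolding cube_mass_def using finP sub w(1) by (intro sum_mono2) auto
      then show ?thesis using q(4) by (simp add: saturated_def)
    qed
    then have pos: "0 < cube_mass P w q0" by (smt (verit) powr_gt_zero divide_pos_pos zero_less_power)
    show ?thesis
    \<comment> \<open>Either the cube \<open>q0\<close> of level \<open>m\<close> is left alone and
      the old saturated cube \<open>q\<close> stays saturated, or it is scaled down and becomes
      saturated itself.\<close>
    proof (cases "cube_mass P w q0 \<le> (1 / 2 ^ m) powr t")
      case True
      then have phi1: "\<phi> q0 = 1" using pos by (simp add: \<phi>_def)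
      have "cube_mass P w' q = cube_mass P w q"
        unfolding cube_mass_def
      proof (intro sum.cong refl)
        fix p' assume "p' \<in> {p\<in>P. p \<in> dyadic_cube q}"
        then have "dyadic_index m p' = q0" using sub pq0(2) by (auto simp: mem_dyadic_cube_iff subset_iff)
        then show "w' p' = w p'" using phi1 by (simp add: w'_def)
      qed
      then have "saturated t P w' q" using q(4) by (simp add: saturated_def)
      then show ?thesis using q by (intro exI[of _ q]) auto
    next
      case False
      then have "\<phi> q0 = (1 / 2 ^ m) powr t / cube_mass P w q0" using pos by (simp add: \<phi>_def)
      then have "saturated t P w' q0" using mass'[OF pq0(2)] pos pq0(2) by (simp add: saturated_def)
      then show ?thesis using pq0 step.hyps by (intro exI[of _ q0]) auto
    qed
  qed
  show ?case by (intro exI[of _ w'] conjI allI impI ballI w'0 le sat)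
qed

text \<open>\<open>P\<close> has one point in each cube of level \<open>n\<close> that meets
  \<open>K\<close>. The maximal saturated cubes are disjoint and cover \<open>K\<close>, so the
  total mass is at least their weight and thus at least the content.\<close>

theorem discrete_frostman:
  fixes K :: "(real^'n) set"
  assumes "bounded K"
  obtains P w where "finite P" "P \<subseteq> K" "\<And>p. 0 \<le> w p"
    "\<And>q. fst q \<le> n \<Longrightarrow> cube_mass P w q \<le> (1 / 2 ^ fst q) powr t"
    "dyadic_content t K \<le> ennreal (sum w P)"
proof -
  define J where "J = dyadic_index n ` K"
  have "finite J"
  proof -
    obtain B where B: "\<And>x. x \<in> K \<Longrightarrow> norm x \<le> B" using assms by (auto simp: bounded_iff)
    define M where "M = \<lceil>2^n * B\<rceil> + 1"
    let ?S = "UNIV \<rightarrow>\<^sub>E {-M..M} :: ('n \<Rightarrow> int) set"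
    have "J \<subseteq> (\<lambda>f. (n, \<chi> j. f j)) ` ?S"
    proof
      fix q assume "q \<in> J"
      then obtain x where x: "x \<in> K" "q = dyadic_index n x" by (auto simp: J_def)
      have "\<lfloor>2^n * x$j\<rfloor> \<in> {-M..M}" for j
      proof -
        have "\<bar>x$j\<bar> \<le> B" using component_le_norm_cart[of x j] B[OF x(1)] by linarith
        then have "\<bar>2^n * x$j\<bar> \<le> 2^n * B" by (simp add: abs_mult)
        then show ?thesis unfolding M_def by simp linarith
      qed
      then show "q \<in> (\<lambda>f. (n, \<chi> j. f j)) ` ?S"
        using x(2) by (intro image_eqI[of _ _ "\<lambda>j. \<lfloor>2^n * x$j\<rfloor>"]) (auto simp: dyadic_index_def)
    qed
    moreover have "finite ?S" by (intro finite_PiE) auto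
    ultimately show ?thesis using finite_surj by blast
  qed
  have "\<exists>r. \<forall>q\<in>J. r q \<in> K \<and> dyadic_index n (r q) = q" unfolding J_def by (intro bchoice) auto
  then obtain r where r: "\<And>q. q \<in> J \<Longrightarrow> r q \<in> K" "\<And>q. q \<in> J \<Longrightarrow> dyadic_index n (r q) = q" by blast
  define P where "P = r ` J"
  have P: "finite P" "P \<subseteq> K" using \<open>finite J\<close> r by (auto simp: P_def)
  have inj: "inj_on (dyadic_index n) P" using r by (auto simp: P_def inj_on_def)
  obtain w where w: "\<And>p. 0 \<le> w p" "\<And>q. fst q \<le> n \<Longrightarrow> cube_mass P w q \<le> (1 / 2 ^ fst q) powr t"
     "\<And>p. p \<in> P \<Longrightarrow> \<exists>q. fst q \<le> n \<and> p \<in> dyadic_cube q \<and> saturated t P w q"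
    using frostman_induction[OF P(1) inj le0, of t, unfolded le0[THEN eqTrueI] simp_thms] by blast
  define S where "S = {q. fst q \<le> n \<and> saturated t P w q \<and> (\<exists>p\<in>P. p \<in> dyadic_cube q)}"
  define D where "D = maximal_cubes S"
  have "S \<subseteq> (\<lambda>(m, p). dyadic_index m p) ` ({..n} \<times> P)"
  proof
    fix q assume "q \<in> S"
    then obtain p where p: "p \<in> P" "p \<in> dyadic_cube q" "fst q \<le> n" by (auto simp: S_def)
    then have "q = dyadic_index (fst q) p" by (simp add: mem_dyadic_cube_iff)
    then show "q \<in> (\<lambda>(m, p). dyadic_index m p) ` ({..n} \<times> P)" using p by force
  qed
  then have "finite S" using P(1) finite_subset by blast
  then have finD: "finite D" by (auto simp: D_def maximal_cubes_def)
  have "K \<subseteq> (\<Union>q\<in>D. dyadic_cube q)"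
  proof
    fix x assume x: "x \<in> K"
    define p where "p = r (dyadic_index n x)"
    have xJ: "dyadic_index n x \<in> J" using x by (simp add: J_def)
    then have p: "p \<in> P" "dyadic_index n p = dyadic_index n x" using r by (auto simp: P_def p_def)
    obtain q where q: "fst q \<le> n" "p \<in> dyadic_cube q" "saturated t P w q" using w(3)[OF p(1)] by blast
    \<comment> \<open>The point \<open>x\<close> and its representative \<open>p\<close> share the
      cube of level \<open>n\<close>, hence every coarser one.\<close>
    then have "x \<in> dyadic_cube q" using dyadic_cube_coarser[OF q(1) p(2)] by (simp add: mem_dyadic_cube_iff)
    moreover have "q \<in> S" using q p by (auto simp: S_def)
    ultimately show "x \<in> (\<Union>q\<in>D. dyadic_cube q)" unfolding D_def Union_maximal_cubes by blast
  qed
  then have "dyadic_content t K \<le> emeasure (dyadic_weight t) D" by (rule dyadic_content_le)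
  also have "\<dots> = ennreal (\<Sum>q\<in>D. (1 / 2 ^ fst q) powr t)" by (rule emeasure_dyadic_weight_finite[OF finD])
  also have "(\<Sum>q\<in>D. (1 / 2 ^ fst q) powr t) = (\<Sum>q\<in>D. cube_mass P w q)"
    by (intro sum.cong) (auto simp: D_def maximal_cubes_def S_def saturated_def)
  also have "\<dots> = sum w (\<Union>q\<in>D. {p\<in>P. p \<in> dyadic_cube q})"
    unfolding cube_mass_def
  proof (rule sum.UNION_disjoint[symmetric])
    show "\<forall>q\<in>D. \<forall>q'\<in>D. q \<noteq> q' \<longrightarrow> {p\<in>P. p \<in> dyadic_cube q} \<inter> {p\<in>P. p \<in> dyadic_cube q'} = {}"
    proof (intro ballI impI, rule ccontr)
      fix q q' assume q: "q \<in> D" "q' \<in> D" "q \<noteq> q'" and "{p\<in>P. p \<in> dyadic_cube q} \<inter> {p\<in>P. p \<in> dyadic_cube q'} \<noteq> {}"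
      then obtain p where p: "p \<in> dyadic_cube q" "p \<in> dyadic_cube q'" by blast
      have "fst q \<noteq> fst q'" using p q(3) by (auto simp: mem_dyadic_cube_iff)
      then show False
      proof (rule linorder_neqE_nat)
        assume "fst q < fst q'"
        then have "dyadic_cube q' \<subseteq> dyadic_cube q" by (intro dyadic_cube_nested[OF p(2,1)]) simp
        then show False using q \<open>fst q < fst q'\<close> by (auto simp: D_def maximal_cubes_def)
      next
        assume "fst q' < fst q"
        then have "dyadic_cube q \<subseteq> dyadic_cube q'" by (intro dyadic_cube_nested[OF p]) simp
        then show False using q \<open>fst q' < fst q\<close> by (auto simp: D_def maximal_cubes_def)
      qed
    qed
  qed (use finD P in auto)
  also have "\<dots> \<le> sum w P" using P w(1) by (intro sum_mono2) auto
  finally have "dyadic_content t K \<le> ennreal (sum w P)" by (simp add: ennreal_leI)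
  then show ?thesis using that P w by blast
qed

text \<open>At a level \<open>m\<close> whose side lies between \<open>r\<close> and
  \<open>2 * r\<close>, the ball is covered by the neighbours of the cube of its centre.\<close>

lemma ball_mass_le:
  fixes P :: "(real^'n) set"
  assumes "finite P" "\<And>p. 0 \<le> w p" and "0 \<le> t" "t \<le> 1"
    and cubes: "\<And>q. fst q \<le> n \<Longrightarrow> cube_mass P w q \<le> (1 / 2 ^ fst q) powr t"
    and r: "1 / 2 ^ n \<le> r" "r \<le> 1"
  shows "(\<Sum>y\<in>{y\<in>P. norm (y - x) \<le> r}. w y) \<le> 2 * real (card (adjacent_offsets :: (int^'n) set)) * r powr t"
proof -
  have "\<exists>m\<le>n. r \<le> 1 / 2 ^ m \<and> (1::real) / 2 ^ m \<le> 2 * r" using r(1)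
  proof (induction n)
    case 0 then show ?case using r(2) by simp
  next
    case (Suc n)
    show ?case
    proof (cases "1 / 2 ^ n \<le> r")
      case True then show ?thesis using Suc.IH le_SucI by blast
    next
      case False
      show ?thesis
      proof (cases "r \<le> 1 / 2 ^ Suc n")
        case True then show ?thesis using Suc.prems by (intro exI[of _ "Suc n"]) auto
      next
        case ge: False
        then show ?thesis using False by (intro exI[of _ n]) auto
      qed
    qed
  qed
  then obtain m where m: "m \<le> n" "r \<le> 1 / 2 ^ m" "(1::real) / 2 ^ m \<le> 2 * r" by blast
  have r0: "0 < r" using r(1) by (meson divide_pos_pos less_le_trans zero_less_numeral zero_less_one zero_less_power)
  let ?Q = "neighbours (dyadic_index m x)"
  have sub: "{y\<in>P. norm (y - x) \<le> r} \<subseteq> (\<Union>q\<in>?Q. {p\<in>P. p \<in> dyadic_cube q})"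
  proof
    fix y assume y: "y \<in> {y\<in>P. norm (y - x) \<le> r}"
    then have "dyadic_index m y \<in> ?Q" using m(2) by (intro dyadic_index_neighbours) (auto simp: norm_minus_commute)
    then show "y \<in> (\<Union>q\<in>?Q. {p\<in>P. p \<in> dyadic_cube q})" using y mem_dyadic_cube_index by blast
  qed
  have "(\<Sum>y\<in>{y\<in>P. norm (y - x) \<le> r}. w y) \<le> sum w (\<Union>q\<in>?Q. {p\<in>P. p \<in> dyadic_cube q})"
    using assms(1,2) sub by (intro sum_mono2 finite_UN_I finite_neighbours) simp_all
  also have "\<dots> \<le> (\<Sum>q\<in>?Q. cube_mass P w q)"
    unfolding cube_mass_def using assms(1,2) by (intro sum_UN_le finite_neighbours) simp_all
  also have "\<dots> \<le> of_nat (card ?Q) * (1 / 2 ^ m) powr t"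
  proof (rule sum_bounded_above)
    fix q assume "q \<in> ?Q"
    then have "fst q = m" using fst_neighbours by fastforce
    then show "cube_mass P w q \<le> (1 / 2 ^ m) powr t" using cubes[of q] m(1) by simp
  qed
  also have "\<dots> \<le> card (adjacent_offsets :: (int^'n) set) * (2 * r powr t)"
  proof (rule mult_mono)
    have "(1 / 2 ^ m) powr t \<le> (2 * r) powr t" using m(3) assms(3) by (intro powr_mono2) auto
    also have "\<dots> = 2 powr t * r powr t" using r0 by (simp add: powr_mult)
    also have "\<dots> \<le> 2 powr 1 * r powr t" using assms(4) by (intro mult_right_mono powr_mono) auto
    finally show "(1 / 2 ^ m) powr t \<le> 2 * r powr t" by simp
  qed (simp_all add: card_neighbours_le)
  finally show ?thesis by simp
qed

section \<open>Projections of small dimension\<close>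

text \<open>Some exponent \<open>s < \<sigma>\<close> has Hausdorff measure zero, and for diameters
  at most 1 passing from \<open>s\<close> to \<sigma> only decreases the sum. Plain powers replace
  \<open>diam_pow\<close>, including its convention at \<open>s = 0\<close>.\<close>

lemma small_cover_of_dim_less:
  fixes A :: "'a::metric_space set"
  assumes "hausdorff_dim A < ereal \<sigma>" "0 < \<delta>" "\<delta> \<le> 1" "0 < \<epsilon>"
  obtains U where "is_delta_cover \<delta> A U" "(\<Sum>k. ennreal (diameter (U k) powr \<sigma>)) < ennreal \<epsilon>"
proof -
  obtain s where s: "0 \<le> s" "s < \<sigma>" "hausdorff_measure s A = 0"
    using assms(1) unfolding hausdorff_dim_def INF_less_iff by auto
  have "hausdorff_premeasure s \<delta> A \<le> hausdorff_measure s A"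
    unfolding hausdorff_measure_def using assms(2) by (intro SUP_upper) auto
  then have "hausdorff_premeasure s \<delta> A < ennreal \<epsilon>" using s(3) assms(4) by simp
  then obtain U where U: "is_delta_cover \<delta> A U" "(\<Sum>k. diam_pow s (U k)) < ennreal \<epsilon>"
    unfolding hausdorff_premeasure_def INF_less_iff by auto
  have le: "ennreal (diameter (U k) powr \<sigma>) \<le> diam_pow s (U k)" for k
  proof -
    have d: "bounded (U k)" "diameter (U k) \<le> 1" "0 \<le> diameter (U k)"
      using U(1) assms(3) by (auto simp: is_delta_cover_def diameter_ge_0 intro: order_trans)
    consider "U k = {}" | "U k \<noteq> {}" "s = 0" | "U k \<noteq> {}" "s \<noteq> 0" by blast
    then show ?thesis
    proof cases
      case 2
      have "diameter (U k) powr \<sigma> \<le> 1 powr \<sigma>" using d s by (intro powr_mono2) auto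
      then show ?thesis using 2 by (simp add: diam_pow_def ennreal_leI flip: ennreal_1)
    next
      case 3
      have "diameter (U k) powr \<sigma> \<le> diameter (U k) powr s" using d s by (intro powr_mono') auto
      then show ?thesis using 3 by (simp add: diam_pow_def ennreal_leI)
    qed (simp add: diam_pow_def)
  qed
  have "(\<Sum>k. ennreal (diameter (U k) powr \<sigma>)) \<le> (\<Sum>k. diam_pow s (U k))"
    by (intro suminf_le le) auto
  then show ?thesis using that U by (meson le_less_trans)
qed

text \<open>Ideally the scale 2^(-100 i) is the smallest one above \<open>4 * d\<close>, hence at
  most \<open>2^102 * d\<close>. For \<open>d\<close> zero or very small the search stops earlier,
  once the power of the scale is at most \<open>e\<close>.\<close>

lemma scale_index:
  fixes d e \<sigma> :: real
  assumes "0 \<le> d" "4 * d < ((1/2)^i0)^100" "0 < e" "1/2 < \<sigma>" "\<sigma> \<le> 1"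
  obtains i where "i0 \<le> i" "4 * d < ((1/2)^i)^100" "(((1/2)^i)^100) powr \<sigma> \<le> 2^102 * d powr \<sigma> + e"
proof -
  let ?\<delta> = "\<lambda>i :: nat. ((1/2::real)^i)^100"
  have T1: "?\<delta> i powr \<sigma> \<le> (1/2)^i" for i
  proof -
    have "?\<delta> i powr \<sigma> \<le> ?\<delta> i powr (1/2)" using assms by (intro powr_mono') (auto simp: power_le_one)
    also have "\<dots> = ((1/2)^i)^50"
    proof -
      have "(x^100) powr (1/2) = x^50" if "0 < x" for x :: real
      proof -
        have "sqrt (x^(2 * 50)) = x^50" using that by (simp only: power_even_eq real_sqrt_abs) simp
        then show ?thesis using that by (simp add: powr_half_sqrt)
      qed
      then show ?thesis by simp
    qed
    also have "\<dots> \<le> ((1/2)^i)^1" by (rule power_decreasing) (auto simp: power_le_one)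
    finally show ?thesis by simp
  qed
  obtain n where n: "(1/2::real)^n < e" using real_arch_pow_inv[of e "1/2"] assms by auto
  \<comment> \<open>The least \<open>j\<close> with this property is used itself if its scale still
    exceeds \<open>4 * d\<close>; otherwise its predecessor is used, whose scale is
    \<open>2^100\<close> times larger.\<close>
  let ?Q = "\<lambda>j. i0 < j \<and> (?\<delta> j \<le> 4 * d \<or> ?\<delta> j powr \<sigma> \<le> e)"
  have "(1/2::real)^(i0 + n + 1) \<le> (1/2)^n" by (rule power_decreasing) auto
  then have "?Q (i0 + n + 1)" using T1[of "i0 + n + 1"] n by linarith
  then obtain j where j: "?Q j" "\<And>k. k < j \<Longrightarrow> \<not> ?Q k" using exists_least_iff[of ?Q] by blast
  show ?thesis
  proof (cases "?\<delta> j \<le> 4 * d")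
    case False
    moreover have "0 \<le> 2^102 * d powr \<sigma>" by simp
    ultimately show ?thesis using that[of j] j(1) by linarith
  next
    case True
    obtain k where k: "j = Suc k" using j(1) by (cases j) auto
    have "i0 \<le> k" using j(1) k by simp
    have dk: "4 * d < ?\<delta> k" using j(2)[of k] k assms(2) \<open>i0 \<le> k\<close> by (cases "k = i0") auto
    have "?\<delta> j = (1/2)^100 * ?\<delta> k" unfolding k by (simp only: power_Suc power_mult_distrib)
    then have "?\<delta> k = 2^100 * ?\<delta> j" by (simp add: power_divide)
    also have "\<dots> \<le> 2^100 * (4 * d)" using True by (intro mult_left_mono) auto
    also have "\<dots> = 2^102 * d" by simp
    finally have "?\<delta> k powr \<sigma> \<le> (2^102 * d) powr \<sigma>" using assms by (intro powr_mono2) auto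
    also have "\<dots> = (2^102) powr \<sigma> * d powr \<sigma>" using assms by (subst powr_mult) auto
    also have "\<dots> \<le> (2^102) powr 1 * d powr \<sigma>" using assms by (intro mult_right_mono powr_mono) auto
    finally have "?\<delta> k powr \<sigma> \<le> 2^102 * d powr \<sigma> + e" using assms by simp
    then show ?thesis using that[of k] \<open>i0 \<le> k\<close> dk by blast
  qed
qed

lemma cform_le_line_proj: "\<bar>cform \<theta> (x - y)\<bar> \<le> 2 * dist (\<rho> \<theta> x) (\<rho> \<theta> y)"
proof -
  have "\<rho> \<theta> x - \<rho> \<theta> y = ((x - y) \<bullet> \<gamma> \<theta>) *\<^sub>R \<gamma> \<theta>"
    by (simp add: line_proj_eq inner_diff_left scaleR_left_diff_distrib)
  then have "dist (\<rho> \<theta> x) (\<rho> \<theta> y) = \<bar>cform \<theta> (x - y)\<bar> / sqrt 2"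
    by (simp add: dist_norm norm_cone_curve inner_cone_curve)
  then have "\<bar>cform \<theta> (x - y)\<bar> = sqrt 2 * dist (\<rho> \<theta> x) (\<rho> \<theta> y)" by simp
  also have "\<dots> \<le> 2 * dist (\<rho> \<theta> x) (\<rho> \<theta> y)"
    by (intro mult_right_mono real_le_lsqrt) auto
  finally show ?thesis .
qed

lemma continuous_line_proj: "continuous_on S (\<rho> \<theta>)"
  unfolding line_proj_eq[abs_def] by (intro continuous_intros)

definition heavy :: "real \<Rightarrow> (real^3 \<Rightarrow> real) \<Rightarrow> (real^3) set \<Rightarrow> nat \<Rightarrow> real^3 \<Rightarrow> real \<Rightarrow> bool" where
  "heavy \<sigma> w P i y \<theta> \<longleftrightarrow> (((1/2)^i)^100) powr \<sigma> \<le> slab_mass w P (((1/2)^i)^100) y \<theta>"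

text \<open>Compactness makes the cover finite, so that a discrete measure of sufficiently fine scale
  sees all of its scales.\<close>

lemma heavy_mass_of_dim_less:
  assumes K: "compact K" and dim: "hausdorff_dim (\<rho> \<theta> ` K) < ereal \<sigma>" and \<sigma>: "1/2 < \<sigma>" "\<sigma> \<le> 1" and c: "0 < c"
  obtains n0 where "\<And>n P w. n0 \<le> n \<Longrightarrow> finite P \<Longrightarrow> P \<subseteq> K \<Longrightarrow> (\<And>p. 0 \<le> w p) \<Longrightarrow> c \<le> sum w P \<Longrightarrow>
      c / 2 \<le> (\<Sum>y\<in>{y\<in>P. \<exists>i\<in>{i0..n}. heavy \<sigma> w P i y \<theta>}. w y)"
proof -
  let ?\<delta> = "\<lambda>i :: nat. ((1/2::real)^i)^100"
  \<comment> \<open>Chosen so that the thresholds of the covering sets add up to at most c/4 from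
    the diameters and c/4 from the errors in \<open>scale_index\<close>.\<close>
  define \<epsilon> where "\<epsilon> = c / (4 * 2^102)"
  define d0 where "d0 = ?\<delta> i0 / 8"
  have "0 < \<epsilon>" using c by (simp add: \<epsilon>_def)
  have "?\<delta> i0 \<le> 1" by (intro power_le_one) auto
  then have d0: "0 < d0" "d0 \<le> 1" unfolding d0_def by auto
  obtain U where U: "is_delta_cover d0 (\<rho> \<theta> ` K) U" "(\<Sum>k. ennreal (diameter (U k) powr \<sigma>)) < ennreal \<epsilon>"
    using small_cover_of_dim_less[OF dim d0 \<open>0 < \<epsilon>\<close>] by metis
  have Ub: "bounded (U k)" "diameter (U k) \<le> d0" "0 \<le> diameter (U k)" for k
    using U(1) by (auto simp: is_delta_cover_def diameter_ge_0)
  have "\<exists>i. i0 \<le> i \<and> 4 * diameter (U k) < ?\<delta> i \<and> ?\<delta> i powr \<sigma> \<le> 2^102 * diameter (U k) powr \<sigma> + c / 4 * (1/2)^Suc k" for k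
  proof -
    have "4 * diameter (U k) < ?\<delta> i0" using Ub(2)[of k] d0(1) unfolding d0_def by linarith
    then show ?thesis using scale_index[of "diameter (U k)" i0 "c / 4 * (1/2)^Suc k" \<sigma>] Ub(3)[of k] c \<sigma> by (metis (no_types, lifting) divide_pos_pos half_gt_zero_iff mult_pos_pos zero_less_numeral zero_less_one zero_less_power)
  qed
  then obtain i where i: "\<And>k. i0 \<le> i k" "\<And>k. 4 * diameter (U k) < ?\<delta> (i k)"
      "\<And>k. ?\<delta> (i k) powr \<sigma> \<le> 2^102 * diameter (U k) powr \<sigma> + c / 4 * (1/2)^Suc k" by metis
  define u where "u k = (SOME x. x \<in> U k)" for k
  have Uball: "U k \<subseteq> ball (u k) (?\<delta> (i k) / 4)" for k
  proof
    fix x assume x: "x \<in> U k"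
    then have "u k \<in> U k" unfolding u_def by (rule someI)
    then have "dist (u k) x \<le> diameter (U k)" using diameter_bounded_bound[OF Ub(1)] x by blast
    then show "x \<in> ball (u k) (?\<delta> (i k) / 4)" using i(2)[of k] by simp
  qed
  \<comment> \<open>The covering sets are enlarged to open ones, still narrower than a slab of their
    scale. Compactness then yields a finite \<open>F\<close> and a largest scale index
    \<open>n0\<close> before any discrete measure is chosen.\<close>
  define V where "V k = \<rho> \<theta> -` ball (u k) (?\<delta> (i k) / 4)" for k
  have Vopen: "open (V k)" for k unfolding V_def using continuous_line_proj[of UNIV \<theta>] by (intro open_vimage) auto
  have Vcover: "K \<subseteq> (\<Union>k. V k)"
  proof
    fix x assume "x \<in> K"
    then obtain k where "\<rho> \<theta> x \<in> U k" using U(1) by (auto simp: is_delta_cover_def)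
    then have "x \<in> V k" using Uball[of k] by (auto simp only: V_def)
    then show "x \<in> (\<Union>k. V k)" by blast
  qed
  obtain F where F: "finite F" "K \<subseteq> (\<Union>k\<in>F. V k)"
    by (rule compactE_image[OF K Vopen Vcover])
  obtain n0 where n0: "\<And>k. k \<in> F \<Longrightarrow> i k \<le> n0"
    using F(1) Max_ge[of "i ` F"] by blast
  have Tsum: "(\<Sum>k\<in>F. ?\<delta> (i k) powr \<sigma>) \<le> c / 2"
  proof -
    have "ennreal (\<Sum>k\<in>F. diameter (U k) powr \<sigma>) = (\<Sum>k\<in>F. ennreal (diameter (U k) powr \<sigma>))" by simp
    also have "\<dots> \<le> (\<Sum>k. ennreal (diameter (U k) powr \<sigma>))" by (rule sum_le_suminf) (use F(1) in auto)
    also have "\<dots> \<le> ennreal \<epsilon>" using U(2) by simp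
    finally have 1: "(\<Sum>k\<in>F. diameter (U k) powr \<sigma>) \<le> \<epsilon>" using \<open>0 < \<epsilon>\<close> by simp
    have "(\<Sum>k\<in>F. (1/2::real)^Suc k) \<le> (\<Sum>k. (1/2)^Suc k)"
      using F(1) power_half_series by (intro sum_le_suminf) (auto simp: sums_iff)
    then have 2: "(\<Sum>k\<in>F. (1/2::real)^Suc k) \<le> 1" using power_half_series by (simp add: sums_iff)
    have "(\<Sum>k\<in>F. ?\<delta> (i k) powr \<sigma>) \<le> (\<Sum>k\<in>F. 2^102 * diameter (U k) powr \<sigma> + c / 4 * (1/2)^Suc k)"
      by (intro sum_mono i)
    also have "\<dots> = 2^102 * (\<Sum>k\<in>F. diameter (U k) powr \<sigma>) + c / 4 * (\<Sum>k\<in>F. (1/2)^Suc k)"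
      by (simp only: sum.distrib sum_distrib_left)
    also have "\<dots> \<le> 2^102 * \<epsilon> + c / 4 * 1" using 1 2 c by (intro add_mono mult_left_mono) auto
    also have "\<dots> = c / 2" by (simp add: \<epsilon>_def)
    finally show ?thesis .
  qed
  show ?thesis
  proof (rule that[of n0])
    fix n :: nat and P :: "(real^3) set" and w :: "real^3 \<Rightarrow> real"
    assume n: "n0 \<le> n" and P: "finite P" "P \<subseteq> K" and w: "\<And>p. 0 \<le> w p" "c \<le> sum w P"
    let ?H = "{y\<in>P. \<exists>i\<in>{i0..n}. heavy \<sigma> w P i y \<theta>}"
    \<comment> \<open>If \<open>V k\<close> contains a point \<open>y\<close> that is not heavy, all
      of \<open>V k\<close> lies in the slab of \<open>y\<close> at scale \<open>i k\<close>, whose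
      mass is below the threshold.\<close>
    have light: "(\<Sum>y\<in>{y\<in>P - ?H. y \<in> V k}. w y) \<le> ?\<delta> (i k) powr \<sigma>" if k: "k \<in> F" for k
    proof (cases "{y\<in>P - ?H. y \<in> V k} = {}")
      case True then show ?thesis unfolding True by simp
    next
      case False
      then obtain y where y: "y \<in> P" "y \<notin> ?H" "y \<in> V k" by blast
      have "i k \<in> {i0..n}" using i(1)[of k] n0[OF k] n by auto
      then have "\<not> heavy \<sigma> w P (i k) y \<theta>" using y by blast
      then have nh: "slab_mass w P (?\<delta> (i k)) y \<theta> < ?\<delta> (i k) powr \<sigma>" by (simp add: heavy_def)
      have close: "\<bar>cform \<theta> (x - y)\<bar> \<le> ?\<delta> (i k)" if "x \<in> V k" for x
      proof -
        have "dist (\<rho> \<theta> x) (\<rho> \<theta> y) \<le> dist (u k) (\<rho> \<theta> x) + dist (u k) (\<rho> \<theta> y)" by (rule dist_triangle3)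
        also have "\<dots> \<le> ?\<delta> (i k) / 4 + ?\<delta> (i k) / 4" using that y(3) by (intro add_mono less_imp_le) (auto simp: V_def)
        finally show ?thesis using cform_le_line_proj[of \<theta> x y] by simp
      qed
      have "(\<Sum>y\<in>{y\<in>P - ?H. y \<in> V k}. w y) \<le> slab_mass w P (?\<delta> (i k)) y \<theta>"
        unfolding slab_mass_def using P(1) w(1) close by (intro sum_mono2) auto
      then show ?thesis using nh by linarith
    qed
    have sub: "P - ?H \<subseteq> (\<Union>k\<in>F. {y\<in>P - ?H. y \<in> V k})" using P(2) F(2) by blast
    have "sum w (P - ?H) \<le> sum w (\<Union>k\<in>F. {y\<in>P - ?H. y \<in> V k})"
      using P(1) F(1) w(1) by (intro sum_mono2[OF _ sub]) auto
    also have "\<dots> \<le> (\<Sum>k\<in>F. \<Sum>y\<in>{y\<in>P - ?H. y \<in> V k}. w y)"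
      using P F w(1) by (intro sum_UN_le) auto
    also have "\<dots> \<le> (\<Sum>k\<in>F. ?\<delta> (i k) powr \<sigma>)" by (intro sum_mono light)
    also have "\<dots> \<le> c / 2" by (rule Tsum)
    finally have "sum w (P - ?H) \<le> c / 2" .
    moreover have "sum w P = sum w (P - ?H) + sum w ?H"
      using P(1) by (intro sum.subset_diff) auto
    ultimately show "c / 2 \<le> sum w ?H" using w(2) by linarith
  qed
qed

lemma hausdorff_dim_mono:
  assumes "A \<subseteq> B"
  shows "hausdorff_dim A \<le> hausdorff_dim B"
proof -
  have pre: "hausdorff_premeasure s \<delta> A \<le> hausdorff_premeasure s \<delta> B" for s \<delta>
  proof -
    have "{U. is_delta_cover \<delta> B U} \<subseteq> {U. is_delta_cover \<delta> A U}"
      unfolding is_delta_cover_def using assms by blast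
    then show ?thesis unfolding hausdorff_premeasure_def by (intro INF_superset_mono) auto
  qed
  have "hausdorff_measure s A \<le> hausdorff_measure s B" for s
    unfolding hausdorff_measure_def using pre by (intro SUP_mono) auto
  then have "{s. 0 \<le> s \<and> hausdorff_measure s B = 0} \<subseteq> {s. 0 \<le> s \<and> hausdorff_measure s A = 0}"
    by (metis (mono_tags, lifting) Collect_mono le_zero_eq)
  then show ?thesis unfolding hausdorff_dim_def by (intro INF_superset_mono) auto
qed

text \<open>Finite subadditivity over a cover by balls. Radius 1/2 produces a piece of diameter at
  most 1, as needed for the weights.\<close>

lemma dyadic_content_piece:
  fixes K :: "(real^'n) set"
  assumes "compact K" "0 < dyadic_content t K"
  obtains x where "0 < dyadic_content t (K \<inter> cball x (1/2))"
proof -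
  obtain F where F: "finite F" "K \<subseteq> (\<Union>x\<in>F. ball x (1/2))"
    using compactE_image[OF assms(1), of UNIV "\<lambda>x. ball x (1/2)"] by (metis UNIV_I UN_I centre_in_ball half_gt_zero open_ball subsetI zero_less_one)
  have "dyadic_content t (K \<inter> (\<Union>x\<in>F. cball x (1/2))) \<le> (\<Sum>x\<in>F. dyadic_content t (K \<inter> cball x (1/2)))"
    using F(1)
  proof (induction F)
    case empty
    have "dyadic_content t ({} :: (real^'n) set) \<le> emeasure (dyadic_weight t) {}" using dyadic_content_le[of "{}" "{}" t] by simp
    then show ?case by simp
  next
    case (insert x F)
    have "dyadic_content t (K \<inter> (\<Union>x\<in>insert x F. cball x (1/2)))
        = dyadic_content t ((K \<inter> cball x (1/2)) \<union> (K \<inter> (\<Union>x\<in>F. cball x (1/2))))" by (simp add: Int_Un_distrib)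
    also have "\<dots> \<le> dyadic_content t (K \<inter> cball x (1/2)) + dyadic_content t (K \<inter> (\<Union>x\<in>F. cball x (1/2)))"
      by (rule dyadic_content_Un)
    also have "\<dots> \<le> (\<Sum>x\<in>insert x F. dyadic_content t (K \<inter> cball x (1/2)))"
      using insert by (simp add: add_left_mono)
    finally show ?case .
  qed
  moreover have "(\<Union>x\<in>F. ball x (1/2)) \<subseteq> (\<Union>x\<in>F. cball x (1/2))"
    by (intro UN_mono order_refl ball_subset_cball)
  then have "K \<inter> (\<Union>x\<in>F. cball x (1/2)) = K" using F(2) by (intro inf.absorb1) (rule order_trans)
  ultimately have "(\<Sum>x\<in>F. dyadic_content t (K \<inter> cball x (1/2))) \<noteq> 0" using assms(2) by auto
  then obtain x where "dyadic_content t (K \<inter> cball x (1/2)) \<noteq> 0" using sum.neutral by metis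
  then show ?thesis using that by (simp add: zero_less_iff_neq_zero)
qed

text \<open>Dividing by the constant of \<open>ball_mass_le\<close> normalizes the growth bound. The
  total mass stays above a \<open>c\<close> that does not depend on the level
  \<open>n\<close>.\<close>

lemma normalized_discrete_frostman:
  fixes K :: "(real^'n) set"
  assumes "bounded K" "0 < dyadic_content t K" "0 \<le> t" "t \<le> 1"
  obtains c P w where "0 < c" "\<And>n. finite (P n)" "\<And>n. P n \<subseteq> K" "\<And>n p. 0 \<le> w n p" "\<And>n. c \<le> sum (w n) (P n)"
    "\<And>n x r. 1 / 2 ^ n \<le> r \<Longrightarrow> r \<le> 1 \<Longrightarrow> (\<Sum>y\<in>{y\<in>P n. norm (y - x) \<le> r}. w n y) \<le> r powr t"
proof -
  let ?N = "2 * real (card (adjacent_offsets :: (int^'n) set))"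
  have "(0 :: int^'n) \<in> adjacent_offsets" by (simp add: adjacent_offsets_def)
  then have N: "0 < ?N" using finite_adjacent_offsets card_gt_0_iff by fastforce
  obtain c0 where c0: "0 < c0" "ennreal c0 \<le> dyadic_content t K"
  proof (cases "dyadic_content t K = top")
    case True then show ?thesis using that[of 1] by simp
  next
    case False
    then show ?thesis using that[of "enn2real (dyadic_content t K)"] assms(2)
      by (simp add: enn2real_positive_iff less_top)
  qed
  define good where "good n P w \<longleftrightarrow> finite P \<and> P \<subseteq> K \<and> (\<forall>p. 0 \<le> w p) \<and> c0 / ?N \<le> sum w P \<and>
     (\<forall>x r. 1 / 2 ^ n \<le> r \<longrightarrow> r \<le> 1 \<longrightarrow> (\<Sum>y\<in>{y\<in>P. norm (y - x) \<le> r}. w y) \<le> r powr t)"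
    for n :: nat and P and w :: "real^'n \<Rightarrow> real"
  have "\<exists>P w. good n P w" for n
  proof -
    obtain P w where Pw: "finite P" "P \<subseteq> K" "\<And>p. 0 \<le> w p"
      "\<And>q. fst q \<le> n \<Longrightarrow> cube_mass P w q \<le> (1 / 2 ^ fst q) powr t" "dyadic_content t K \<le> ennreal (sum w P)"
      using discrete_frostman[OF assms(1), of n t] by metis
    have "ennreal c0 \<le> ennreal (sum w P)" using c0(2) Pw(5) by (rule order_trans)
    then have "c0 \<le> sum w P" using Pw(3) by (simp add: ennreal_le_iff sum_nonneg)
    then have 1: "c0 / ?N \<le> (\<Sum>p\<in>P. w p / ?N)" using N by (simp add: divide_right_mono flip: sum_divide_distrib)
    have 2: "(\<Sum>y\<in>{y\<in>P. norm (y - x) \<le> r}. w y / ?N) \<le> r powr t" if "1 / 2 ^ n \<le> r" "r \<le> 1" for x r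
    proof -
      have "(\<Sum>y\<in>{y\<in>P. norm (y - x) \<le> r}. w y) \<le> ?N * r powr t"
        by (rule ball_mass_le[OF Pw(1,3) assms(3,4) Pw(4) that])
      then show ?thesis using N by (simp add: field_simps flip: sum_divide_distrib)
    qed
    have "good n P (\<lambda>p. w p / ?N)" unfolding good_def using Pw 1 2 N by (auto intro!: divide_nonneg_nonneg)
    then show ?thesis by blast
  qed
  then have "\<forall>n. \<exists>Pw. good n (fst Pw) (snd Pw)" by auto
  from choice[OF this] obtain Pw where "\<And>n. good n (fst (Pw n)) (snd (Pw n))" by blast
  then show ?thesis using that[of "c0 / ?N" "\<lambda>n. fst (Pw n)" "\<lambda>n. snd (Pw n)"] c0(1) N
    unfolding good_def by (simp add: divide_pos_pos)
qed

text \<open>A Borel-Cantelli argument. For an exceptional \<theta> and every \<open>I\<close>, all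
  sufficiently fine discrete measures have half of \<open>c\<close> in heavy slabs at some scale
  index \<open>i \<ge> I\<close>; the angles with this property have measure at most a multiple of
  \<open>r^I\<close>, uniformly in \<open>n\<close>. The null set \<open>Z\<close> is built from
  these Borel sets only.\<close>

lemma exceptional_set_null:
  fixes K :: "(real^3) set"
  assumes K: "compact K" "\<And>x y. x \<in> K \<Longrightarrow> y \<in> K \<Longrightarrow> norm (x - y) \<le> 1" "0 < dyadic_content t K"
    and t: "1/2 < t" "t \<le> 1" and \<sigma>: "\<sigma> = 1/2 + (t - 1/2) / 200"
  shows "\<exists>Z\<in>null_sets lborel. {\<theta>\<in>{a..a+1}. hausdorff_dim (\<rho> \<theta> ` K) < ereal \<sigma>} \<subseteq> Z"
proof -
  have "0 \<le> t" using t by simp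
  obtain c P w where c: "0 < c" and P: "\<And>n. finite (P n)" "\<And>n. P n \<subseteq> K" and w: "\<And>n p. 0 \<le> w n p" "\<And>n. c \<le> sum (w n) (P n)"
    and ball: "\<And>n x r. 1 / 2 ^ n \<le> r \<Longrightarrow> r \<le> 1 \<Longrightarrow> (\<Sum>y\<in>{y\<in>P n. norm (y - x) \<le> r}. w n y) \<le> r powr t"
    by (rule normalized_discrete_frostman[OF compact_imp_bounded[OF K(1)] K(3) \<open>0 \<le> t\<close> t(2)]) (rule that; assumption)
  define e where "e = (t - 1/2) / 2"
  define C where "C = 2 * frostman_weights.near_const t + 21 + 2^18"
  define r where "r = (1/2::real) powr e"
  have "0 < e" using t by (simp add: e_def)
  then have r: "0 < r" "r < 1" using powr_less_mono2[of e "1/2" 1] by (auto simp: r_def)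
  have "400 * \<sigma> = 199 + 2 * t" unfolding \<sigma> by (simp add: field_simps)
  then have \<sigma>': "1/2 < \<sigma>" "\<sigma> \<le> 1" using t by linarith+
  define S where "S n i y = {\<theta>\<in>{a..a+1}. heavy \<sigma> (w n) (P n) i y \<theta>}" for n i y
  \<comment> \<open>The measure of level \<open>n\<close> obeys the growth bound down to radius
    2^(-n), which admits the scales 2^(-100 i) with \<open>i \<le> n div 100\<close>.\<close>
  define E where "E I n y = (\<Union>i\<in>{I..n div 100}. S n i y)" for I n y
  define H where "H I n = {\<theta>\<in>{a..a+1}. c / 2 \<le> (\<Sum>y\<in>P n. w n y * indicator (E I n y) \<theta>)}" for I n
  have S: "S n i y \<in> fmeasurable lborel" for n i y
    unfolding S_def heavy_def by (rule superlevel_fmeasurable[OF P(1), of _ a "a+1"]) auto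
  have E: "E I n y \<in> fmeasurable lborel" for I n y
    unfolding E_def using S by (intro fmeasurable.finite_UN) auto
  have H: "H I n \<in> fmeasurable lborel" for I n
  proof (rule fmeasurableI2[OF fmeasurable_interval[of a "a+1"]])
    have [measurable]: "E I n y \<in> sets borel" for y using fmeasurableD[OF E] by simp
    show "H I n \<in> sets lborel" unfolding H_def by measurable
  qed (auto simp: H_def)
  have weights: "frostman_weights (P n) (w n) t i" if "1 \<le> i" "i \<le> n div 100" for n i
  proof
    have "(1/2::real)^n \<le> (1/2)^(i * 100)" using that by (intro power_decreasing) auto
    then have le: "1 / 2^n \<le> ((1/2::real)^i)^100" by (simp add: power_one_over power_mult)
    show "norm (x - y) \<le> 1" if "x \<in> P n" "y \<in> P n" for x y using K(2) P(2) that by blast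
    show "(\<Sum>y\<in>{y\<in>P n. norm (y - x) \<le> r'}. w n y) \<le> r' powr t" if "((1/2)^i)^100 \<le> r'" "r' \<le> 1" for x r'
      using ball[of n r' x] le that by linarith
  qed (use P w t that in auto)
  have heavy_sum: "(\<Sum>y\<in>P n. w n y * measure lborel (S n i y)) \<le> C * r^i" if "1 \<le> i" "i \<le> n div 100" for n i
  proof -
    interpret frostman_weights "P n" "w n" t i by (rule weights[OF that])
    have T: "(\<beta>^100) powr \<sigma> = T"
    proof -
      have "(\<beta>^100) powr \<sigma> = (\<beta> powr real 100) powr \<sigma>" unfolding powr_realpow[OF beta(1)] ..
      also have "\<dots> = \<beta> powr (real 100 * \<sigma>)" by (rule powr_powr)
      \<comment> \<open>This identity is the reason for the value of \<sigma>: it makes the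
        threshold of \<open>heavy\<close> equal to \<open>T\<close>.\<close>
      also have "real 100 * \<sigma> = real 50 + \<kappa>" unfolding \<sigma> \<kappa>_def by (simp add: field_simps)
      also have "\<beta> powr \<dots> = T" unfolding powr_add T_def powr_realpow[OF beta(1)] ..
      finally show ?thesis .
    qed
    have "r^i = r powr real i" using r by (simp add: powr_realpow)
    also have "\<dots> = (1/2) powr (real i * \<kappa>)" unfolding r_def e_def \<kappa>_def powr_powr by (simp add: mult.commute)
    also have "\<dots> = ((1/2) powr real i) powr \<kappa>" by (rule powr_powr[symmetric])
    also have "(1/2::real) powr real i = \<beta>" unfolding \<beta>_def by (rule powr_realpow) simp
    finally have ri: "r^i = \<beta> powr \<kappa>" .
    show ?thesis using heavy_slab_measure[of a] unfolding S_def heavy_def C_def \<beta>_def[symmetric] ri T .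
  qed
  have H_le: "measure lborel (H I n) \<le> 2 * C / (c * (1 - r)) * r^I" if "1 \<le> I" for I n
  proof -
    have "c / 2 * measure lborel (H I n) \<le> (\<Sum>y\<in>P n. w n y * measure lborel (E I n y))"
      by (rule markov_weighted[OF P(1) H E w(1)]) (simp add: H_def)
    also have "\<dots> \<le> (\<Sum>y\<in>P n. w n y * (\<Sum>i\<in>{I..n div 100}. measure lborel (S n i y)))"
      unfolding E_def using S w by (intro sum_mono mult_left_mono measure_UNION_le) (auto simp: fmeasurable_def)
    also have "\<dots> = (\<Sum>i\<in>{I..n div 100}. \<Sum>y\<in>P n. w n y * measure lborel (S n i y))"
      unfolding sum_distrib_left by (rule sum.swap)
    also have "\<dots> \<le> (\<Sum>i\<in>{I..n div 100}. C * r^i)" using that by (intro sum_mono heavy_sum) auto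
    also have "\<dots> = C * (\<Sum>i\<in>{I..n div 100}. r^i)" by (simp add: sum_distrib_left)
    also have "\<dots> \<le> C * (r^I / (1 - r))"
    proof (rule mult_left_mono)
      show "(\<Sum>i\<in>{I..n div 100}. r^i) \<le> r^I / (1 - r)"
      proof (cases "I \<le> n div 100")
        case True
        then have "(\<Sum>i\<in>{I..n div 100}. r^i) = (r^I - r^Suc (n div 100)) / (1 - r)" using r by (subst sum_gp) auto
        also have "\<dots> \<le> r^I / (1 - r)" using r by (intro divide_right_mono) auto
        finally show ?thesis .
      qed (use r in auto)
      show "0 \<le> C" using frostman_weights.near_const(1)[OF weights[of 1 100]] by (simp add: C_def)
    qed
    finally show ?thesis using c r by (simp add: field_simps)
  qed
  \<comment> \<open>The lower limit of the sets \<open>H I n\<close>: its measure inherits their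
    uniform bound, although the discrete measures for different \<open>n\<close> are
    unrelated.\<close>
  define L where "L I = (\<Union>N. \<Inter>n\<in>{N..}. H I n)" for I
  have Hs: "H I n \<in> sets lborel" for I n using fmeasurableD[OF H] .
  have Hs': "(\<Inter>n\<in>{N..}. H I n) \<in> sets lborel" for I N using Hs by (intro sets.countable_INT'') auto
  have Ls: "L I \<in> sets lborel" for I unfolding L_def using Hs' by (intro sets.countable_UN) auto
  have L_le: "emeasure lborel (L I) \<le> ennreal (2 * C / (c * (1 - r)) * r^I)" if "1 \<le> I" for I
  proof -
    have "emeasure lborel (L I) = (SUP N. emeasure lborel (\<Inter>n\<in>{N..}. H I n))"
      unfolding L_def using Hs' by (intro SUP_emeasure_incseq[symmetric]) (auto simp: incseq_def)
    also have "\<dots> \<le> ennreal (2 * C / (c * (1 - r)) * r^I)"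
    proof (rule SUP_least)
      fix N
      have "emeasure lborel (\<Inter>n\<in>{N..}. H I n) \<le> emeasure lborel (H I N)" using Hs by (intro emeasure_mono) auto
      also have "\<dots> = ennreal (measure lborel (H I N))" using H by (simp add: emeasure_eq_measure2)
      also have "\<dots> \<le> ennreal (2 * C / (c * (1 - r)) * r^I)" using H_le[OF that] by (rule ennreal_leI)
      finally show "emeasure lborel (\<Inter>n\<in>{N..}. H I n) \<le> ennreal (2 * C / (c * (1 - r)) * r^I)" .
    qed
    finally show ?thesis .
  qed
  define Z where "Z = (\<Inter>I\<in>{1..}. L I)"
  have Zs: "Z \<in> sets lborel" unfolding Z_def using Ls by (intro sets.countable_INT'') auto
  have lim: "(\<lambda>I. ennreal (2 * C / (c * (1 - r)) * r^I)) \<longlonglongrightarrow> ennreal (2 * C / (c * (1 - r)) * 0)"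
    using r by (intro tendsto_ennrealI tendsto_mult tendsto_const LIMSEQ_realpow_zero) auto
  have "emeasure lborel Z \<le> ennreal (2 * C / (c * (1 - r)) * r^I)" if "1 \<le> I" for I
  proof -
    have "Z \<subseteq> L I" using that unfolding Z_def by blast
    from order_trans[OF emeasure_mono[OF this Ls] L_le[OF that]] show ?thesis .
  qed
  then have "eventually (\<lambda>I. emeasure lborel Z \<le> ennreal (2 * C / (c * (1 - r)) * r^I)) sequentially"
    by (rule eventually_sequentiallyI)
  then have "emeasure lborel Z \<le> ennreal (2 * C / (c * (1 - r)) * 0)"
    by (rule tendsto_lowerbound[OF lim]) simp
  then have "Z \<in> null_sets lborel" using Zs by (simp add: null_sets_def)
  moreover have "{\<theta>\<in>{a..a+1}. hausdorff_dim (\<rho> \<theta> ` K) < ereal \<sigma>} \<subseteq> Z"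
  proof
    fix \<theta> assume th: "\<theta> \<in> {\<theta>\<in>{a..a+1}. hausdorff_dim (\<rho> \<theta> ` K) < ereal \<sigma>}"
    then have dim: "hausdorff_dim (\<rho> \<theta> ` K) < ereal \<sigma>" by simp
    have "\<theta> \<in> L I" for I
    proof (rule heavy_mass_of_dim_less[of K \<theta> \<sigma> c I, OF K(1) dim \<sigma>' c])
      fix n0
      assume n0: "\<And>n P w. n0 \<le> n \<Longrightarrow> finite P \<Longrightarrow> P \<subseteq> K \<Longrightarrow> (\<And>p. 0 \<le> w p) \<Longrightarrow> c \<le> sum w P \<Longrightarrow>
          c / 2 \<le> (\<Sum>y\<in>{y\<in>P. \<exists>i\<in>{I..n}. heavy \<sigma> w P i y \<theta>}. w y)"
      have "\<theta> \<in> H I n" if "100 * n0 \<le> n" for n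
      proof -
        have "n0 \<le> n div 100" using that by simp
        from n0[OF this P(1,2) w(1,2)]
        have "c / 2 \<le> (\<Sum>y\<in>{y\<in>P n. \<exists>i\<in>{I..n div 100}. heavy \<sigma> (w n) (P n) i y \<theta>}. w n y)" by simp
        also have "\<dots> = (\<Sum>y\<in>P n. w n y * indicator (E I n y) \<theta>)"
          using P(1) th by (intro sum.mono_neutral_cong_left) (auto simp: E_def S_def indicator_def)
        finally show ?thesis using th by (simp add: H_def)
      qed
      then show ?thesis unfolding L_def by blast
    qed
    then show "\<theta> \<in> Z" by (simp add: Z_def)
  qed
  ultimately show ?thesis by blast
qed

theorem theorem1p9:
  fixes s :: real
  assumes "s > 1/2"
  shows "\<exists>\<sigma>::real. \<sigma> > 1/2 \<and>
           (\<forall>B :: (real^3) set. analytic_set B \<and> hausdorff_dim B = ereal s \<longrightarrow>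
              (AE \<theta> in lebesgue_on {0<..<2*pi}. hausdorff_dim (\<rho> \<theta> ` B) \<ge> ereal \<sigma>))"
proof -
  \<comment> \<open>The midpoint of 1/2 and \<open>s\<close>, capped at 1: an exponent strictly
    below the dimension of \<open>B\<close>, so that the content is positive.\<close>
  define t where "t = min 1 ((s + 1/2) / 2)"
  define \<sigma> where "\<sigma> = 1/2 + (t - 1/2) / 200"
  have t: "1/2 < t" "t \<le> 1" "t < s" using assms by (auto simp: t_def min_def field_simps)
  have "AE \<theta> in lebesgue_on {0<..<2*pi}. hausdorff_dim (\<rho> \<theta> ` B) \<ge> ereal \<sigma>"
    if B: "analytic_set B" "hausdorff_dim B = ereal s" for B :: "(real^3) set"
  proof -
    have "0 < dyadic_content t B" using B t by (intro dyadic_content_pos_if_dim) auto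
    then obtain c where c: "0 < c" "ennreal c < dyadic_content t B"
    proof -
      obtain y where y: "0 < y" "y < dyadic_content t B" using dense \<open>0 < dyadic_content t B\<close> by blast
      then have "y < top" using less_le_trans top_greatest by blast
      then show ?thesis using that[of "enn2real y"] y by (simp add: enn2real_positive_iff)
    qed
    obtain K where K: "compact K" "K \<subseteq> B" "ennreal c \<le> of_nat (card (adjacent_offsets :: (int^3) set)) * dyadic_content t K"
      using analytic_set_compact_subset[OF B(1) c(2)] by blast
    have "0 < dyadic_content t K" using K(3) c(1) by (auto simp: zero_less_iff_neq_zero)
    then obtain x where x: "0 < dyadic_content t (K \<inter> cball x (1/2))"
      using dyadic_content_piece[OF K(1)] by blast
    define K' where "K' = K \<inter> cball x (1/2)"
    have K': "compact K'" "K' \<subseteq> B" using K by (auto simp: K'_def compact_Int_closed)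
    have diam: "norm (y - z) \<le> 1" if "y \<in> K'" "z \<in> K'" for y z
      using dist_triangle3[of y z x] that by (auto simp: K'_def dist_norm)
    have "\<exists>Z. Z \<in> null_sets lborel \<and> {\<theta>\<in>{a..a+1}. hausdorff_dim (\<rho> \<theta> ` K') < ereal \<sigma>} \<subseteq> Z" for a
      using exceptional_set_null[OF K'(1) diam x[folded K'_def] t(1,2) \<sigma>_def, of a] by blast
    then have "\<forall>a. \<exists>Z. Z \<in> null_sets lborel \<and> {\<theta>\<in>{a..a+1}. hausdorff_dim (\<rho> \<theta> ` K') < ereal \<sigma>} \<subseteq> Z" by blast
    from choice[OF this] obtain Z where Z: "\<And>a. Z a \<in> null_sets lborel"
        "\<And>a. {\<theta>\<in>{a..a+1}. hausdorff_dim (\<rho> \<theta> ` K') < ereal \<sigma>} \<subseteq> Z a" by blast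
    \<comment> \<open>Since 2 pi < 8, eight intervals of length one cover all angles.\<close>
    define Z0 where "Z0 = (\<Union>k\<in>{..<8::nat}. Z (real k))"
    have "Z0 \<in> null_sets lborel" unfolding Z0_def using Z(1) by (intro null_sets_UN') auto
    then have null: "Z0 \<in> null_sets lebesgue" by (rule null_sets_completionI)
    have "hausdorff_dim (\<rho> \<theta> ` B) \<ge> ereal \<sigma>" if th: "\<theta> \<in> {0<..<2*pi}" "\<theta> \<notin> Z0" for \<theta>
    proof (rule ccontr)
      assume "\<not> hausdorff_dim (\<rho> \<theta> ` B) \<ge> ereal \<sigma>"
      then have less: "hausdorff_dim (\<rho> \<theta> ` K') < ereal \<sigma>"
        using hausdorff_dim_mono[OF image_mono[OF K'(2)], of "\<rho> \<theta>"] by simp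
      define k where "k = nat \<lfloor>\<theta>\<rfloor>"
      have "\<theta> < 8" using th pi_less_4 by auto
      then have "k < 8" "real k \<le> \<theta>" "\<theta> \<le> real k + 1" using th unfolding k_def by (auto simp: nat_less_iff floor_less_iff)
      then have "\<theta> \<in> Z0" using less Z(2)[of "real k"] by (auto simp: Z0_def)
      then show False using th by simp
    qed
    then have "AE \<theta> in lebesgue. \<theta> \<in> {0<..<2*pi} \<longrightarrow> hausdorff_dim (\<rho> \<theta> ` B) \<ge> ereal \<sigma>"
      by (intro AE_I'[OF null]) auto
    then show ?thesis by (subst AE_restrict_space_iff) auto
  qed
  then show ?thesis using t by (intro exI[of _ \<sigma>]) (auto simp: \<sigma>_def)
qed

end
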